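(* The equivalence group $G^\sim_{\bar{\mathcal F}}$ of the class $\bar{\mathcal F}$ of Fokker--Planck equations $u_t=(A(t,x)u)_{xx}+(B(t,x)u)_x$ with $A\neq0$ consists of the point transformations of the form \[ \tilde t=T(t),\quad\tilde x=X(t,x),\quad\tilde u=\frac{c_1}{X_x}u,\quad\tilde A=\frac{X_x^2}{T_t}A,\quad\tilde B=\frac{X_x}{T_t}B-\frac{X_t+X_{xx}A}{T_t}, \] where $T$ and $X$ are smooth functions of their arguments with $T_tX_x\neq0$, and $c_1$ is an arbitrary nonzero constant.
   Context: Everything is real, smooth and local; $f\neq0$ for a function means that it vanishes nowhere on its domain. The arbitrary elements of the class are the smooth functions $A$ and $B$ of $(t,x)$ with $A\neq0$, regarded as coordinates when working with equivalence transformations. The (usual) equivalence (pseudo)group of the class consists of the point transformations (local diffeomorphisms) in the space with coordinates $(t,x,u_{(2)},A,B)$, where $u_{(2)}$ denotes $u$ and its derivatives up to order two (with components for derivatives of the arbitrary elements obtained by prolongation if these are needed), that are projectable to the spaces of $(t,x,u)$ and of $(t,x,u_{(2)})$, are consistent with the contact structure of the second-order jet space (so their components for derivatives are obtained by standard prolongation and are not listed), and map every equation of the class to an equation of the class (with the transformed arbitrary elements) for any values of the arbitrary elements. *)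

theory Defs
  imports "HOL-Analysis.Analysis"
begin

section \<open>Smooth maps on open sets\<close>

fun Ck_on :: "nat \<Rightarrow> ('a::euclidean_space \<Rightarrow> 'b::real_normed_vector) \<Rightarrow> 'a set \<Rightarrow> bool" where
  "Ck_on 0 f S \<longleftrightarrow> continuous_on S f"
| "Ck_on (Suc k) f S \<longleftrightarrow>
     (\<forall>p\<in>S. f differentiable (at p)) \<and>
     (\<forall>v. Ck_on k (\<lambda>p. frechet_derivative f (at p) v) S)"

text \<open>Only meaningful for open \<^term>\<open>S\<close>.\<close>

definition smooth_on :: "('a::euclidean_space \<Rightarrow> 'b::real_normed_vector) \<Rightarrow> 'a set \<Rightarrow> bool" where
  "smooth_on f S \<longleftrightarrow> (\<forall>k. Ck_on k f S)"

definition diffeo_on :: "('a::euclidean_space \<Rightarrow> 'a) \<Rightarrow> 'a set \<Rightarrow> bool" where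
  "diffeo_on f S \<longleftrightarrow> smooth_on f S \<and> open (f ` S) \<and>
     (\<exists>g. smooth_on g (f ` S) \<and> (\<forall>p\<in>S. g (f p) = p))"

definition pd_t :: "(real \<times> real \<Rightarrow> real) \<Rightarrow> real \<times> real \<Rightarrow> real" where
  "pd_t f = (\<lambda>(t, x). deriv (\<lambda>s. f (s, x)) t)"

definition pd_x :: "(real \<times> real \<Rightarrow> real) \<Rightarrow> real \<times> real \<Rightarrow> real" where
  "pd_x f = (\<lambda>(t, x). deriv (\<lambda>y. f (t, y)) x)"


section \<open>Second-order jets of functions \<open>u(t, x)\<close>\<close>

text \<open>
  A jet is \<open>((t, x), u, (u\<^sub>t, u\<^sub>x), (u\<^sub>t\<^sub>t, u\<^sub>t\<^sub>x, u\<^sub>x\<^sub>x))\<close>; the extended space adds the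
  coordinates \<open>(A, B)\<close>.
\<close>

type_synonym jet2 = "(real \<times> real) \<times> real \<times> (real \<times> real) \<times> (real \<times> real \<times> real)"

type_synonym ext = "jet2 \<times> (real \<times> real)"

definition ext_space :: "ext set" where
  "ext_space = {(z, (a, b)) | z a b. a \<noteq> 0}"

definition jet_tx :: "jet2 \<Rightarrow> real \<times> real" where
  "jet_tx z = fst z"

definition jet_u :: "jet2 \<Rightarrow> real" where
  "jet_u z = fst (snd z)"

definition jet_txu :: "jet2 \<Rightarrow> (real \<times> real) \<times> real" where
  "jet_txu z = (jet_tx z, jet_u z)"

text \<open>
  Truncated total derivative vectors. On functions of jets that do not depend on the second-order
  coordinates, the operators below are the usual total derivatives; they are only applied to
  such functions.
\<close>

fun tvec :: "jet2 \<Rightarrow> jet2" where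
  "tvec ((t, x), u, (ut, ux), (utt, utx, uxx)) = ((1, 0), ut, (utt, utx), (0, 0, 0))"

fun xvec :: "jet2 \<Rightarrow> jet2" where
  "xvec ((t, x), u, (ut, ux), (utt, utx, uxx)) = ((0, 1), ux, (utx, uxx), (0, 0, 0))"

definition total_t :: "(jet2 \<Rightarrow> real) \<Rightarrow> jet2 \<Rightarrow> real" where
  "total_t F z = frechet_derivative F (at z) (tvec z)"

definition total_x :: "(jet2 \<Rightarrow> real) \<Rightarrow> jet2 \<Rightarrow> real" where
  "total_x F z = frechet_derivative F (at z) (xvec z)"

text \<open>
  The contact (Cartan) distribution: the common kernel at a jet of the contact forms
  \<open>du - u\<^sub>t dt - u\<^sub>x dx\<close>, \<open>du\<^sub>t - u\<^sub>t\<^sub>t dt - u\<^sub>t\<^sub>x dx\<close>, \<open>du\<^sub>x - u\<^sub>t\<^sub>x dt - u\<^sub>x\<^sub>x dx\<close>.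
\<close>

fun contact_plane :: "jet2 \<Rightarrow> jet2 set" where
  "contact_plane ((t, x), u, (ut, ux), (utt, utx, uxx)) =
     {((dt, dx), du, (dut, dux), d2) | dt dx du dut dux d2.
        du = ut * dt + ux * dx \<and>
        dut = utt * dt + utx * dx \<and>
        dux = utx * dt + uxx * dx}"

text \<open>
  Standard prolongation of \<open>t' = T, x' = X, u' = U\<close>: the functions \<open>F\<^sub>t\<^sub>'\<close>, \<open>F\<^sub>x\<^sub>'\<close> solve
  \<open>D\<^sub>t F = F\<^sub>t\<^sub>' D\<^sub>t T + F\<^sub>x\<^sub>' D\<^sub>t X\<close> and \<open>D\<^sub>x F = F\<^sub>t\<^sub>' D\<^sub>x T + F\<^sub>x\<^sub>' D\<^sub>x X\<close>.
\<close>

definition total_jac :: "(jet2 \<Rightarrow> real) \<Rightarrow> (jet2 \<Rightarrow> real) \<Rightarrow> jet2 \<Rightarrow> real" where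
  "total_jac T X z = total_t T z * total_x X z - total_x T z * total_t X z"

definition prol_t :: "(jet2 \<Rightarrow> real) \<Rightarrow> (jet2 \<Rightarrow> real) \<Rightarrow> (jet2 \<Rightarrow> real) \<Rightarrow> jet2 \<Rightarrow> real" where
  "prol_t T X F z = (total_t F z * total_x X z - total_x F z * total_t X z) / total_jac T X z"

definition prol_x :: "(jet2 \<Rightarrow> real) \<Rightarrow> (jet2 \<Rightarrow> real) \<Rightarrow> (jet2 \<Rightarrow> real) \<Rightarrow> jet2 \<Rightarrow> real" where
  "prol_x T X F z = (total_t T z * total_x F z - total_x T z * total_t F z) / total_jac T X z"

definition prolong2 ::
  "(jet2 \<Rightarrow> real) \<Rightarrow> (jet2 \<Rightarrow> real) \<Rightarrow> (jet2 \<Rightarrow> real) \<Rightarrow> jet2 \<Rightarrow> jet2" where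
  "prolong2 T X U z =
     ((T z, X z), U z,
      (prol_t T X U z, prol_x T X U z),
      (prol_t T X (prol_t T X U) z, prol_x T X (prol_t T X U) z, prol_x T X (prol_x T X U) z))"


section \<open>The class of Fokker--Planck equations\<close>

definition FP_coeffs :: "(real \<times> real) set \<Rightarrow> (real \<times> real \<Rightarrow> real) \<Rightarrow> (real \<times> real \<Rightarrow> real) \<Rightarrow> bool" where
  "FP_coeffs D A B \<longleftrightarrow> open D \<and> smooth_on A D \<and> smooth_on B D \<and> (\<forall>p\<in>D. A p \<noteq> 0)"

text \<open>
  The equation \<open>u\<^sub>t = (A u)\<^sub>x\<^sub>x + (B u)\<^sub>x\<close> as a subset of the jet space over \<^term>\<open>D\<close>, where \<open>A\<close> and
  \<open>B\<close> are defined.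
\<close>

definition FP_eq :: "(real \<times> real) set \<Rightarrow> (real \<times> real \<Rightarrow> real) \<Rightarrow> (real \<times> real \<Rightarrow> real) \<Rightarrow> jet2 set" where
  "FP_eq D A B =
     {z. jet_tx z \<in> D \<and>
         (case z of ((t, x), u, (ut, ux), (utt, utx, uxx)) \<Rightarrow>
            ut = total_x (total_x (\<lambda>w. A (jet_tx w) * jet_u w)) z
                 + total_x (\<lambda>w. B (jet_tx w) * jet_u w) z)}"


section \<open>Equivalence transformations\<close>

text \<open>
  A map \<^term>\<open>\<Phi>\<close> of the extended space matters only on the open set \<^term>\<open>W\<close>. All conditions are
  local, so that the transformations form a pseudogroup: each point of \<^term>\<open>W\<close> has a neighbourhood
  on which they hold.
\<close>

definition projectable_on :: "(ext \<Rightarrow> 'b) \<Rightarrow> (ext \<Rightarrow> ext) \<Rightarrow> ext set \<Rightarrow> bool" where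
  "projectable_on \<pi> \<Phi> N \<longleftrightarrow> (\<exists>\<phi>. \<forall>p\<in>N. \<pi> (\<Phi> p) = \<phi> (\<pi> p))"

definition point_transformation :: "(ext \<Rightarrow> ext) \<Rightarrow> ext set \<Rightarrow> bool" where
  "point_transformation \<Phi> W \<longleftrightarrow>
     (\<forall>p\<in>W. \<exists>N. open N \<and> p \<in> N \<and> N \<subseteq> W \<and> diffeo_on \<Phi> N \<and>
        projectable_on (\<lambda>(z, \<theta>). jet_txu z) \<Phi> N \<and> projectable_on (\<lambda>(z, \<theta>). z) \<Phi> N)"

definition contact_consistent :: "(ext \<Rightarrow> ext) \<Rightarrow> ext set \<Rightarrow> bool" where
  "contact_consistent \<Phi> W \<longleftrightarrow>
     (\<forall>p\<in>W. \<forall>v. fst v \<in> contact_plane (fst p) \<longrightarrow>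
        fst (frechet_derivative \<Phi> (at p) v) \<in> contact_plane (fst (\<Phi> p)))"

text \<open>
  For every equation of the class, with coefficients \<open>A, B\<close>, the graph of \<open>(A, B)\<close> is mapped (near
  each of its points in \<^term>\<open>W\<close>) to the graph of coefficients \<open>A', B'\<close> of an equation of the class,
  and the equation with \<open>A, B\<close> is mapped to the equation with \<open>A', B'\<close>.
\<close>

definition preserves_FP_class :: "(ext \<Rightarrow> ext) \<Rightarrow> ext set \<Rightarrow> bool" where
  "preserves_FP_class \<Phi> W \<longleftrightarrow>
     (\<forall>D A B z. FP_coeffs D A B \<and> jet_tx z \<in> D \<and> (z, (A (jet_tx z), B (jet_tx z))) \<in> W \<longrightarrow>
        (\<exists>N D' A' B'. open N \<and> z \<in> N \<and> FP_coeffs D' A' B' \<and>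
           (\<forall>w\<in>N. jet_tx w \<in> D \<and> (w, (A (jet_tx w), B (jet_tx w))) \<in> W \<and>
              (case \<Phi> (w, (A (jet_tx w), B (jet_tx w))) of (w', (a', b')) \<Rightarrow>
                 jet_tx w' \<in> D' \<and> a' = A' (jet_tx w') \<and> b' = B' (jet_tx w') \<and>
                 (w \<in> FP_eq D A B \<longleftrightarrow> w' \<in> FP_eq D' A' B')))))"

definition FP_equivalence_group :: "ext set \<Rightarrow> (ext \<Rightarrow> ext) set" where
  "FP_equivalence_group W =
     {\<Phi>. point_transformation \<Phi> W \<and> contact_consistent \<Phi> W \<and> preserves_FP_class \<Phi> W}"


section \<open>The explicit transformations\<close>

definition FP_form ::
  "real \<Rightarrow> (real \<Rightarrow> real) \<Rightarrow> (real \<times> real \<Rightarrow> real) \<Rightarrow> (ext \<Rightarrow> ext) \<Rightarrow> ext set \<Rightarrow> bool" where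
  "FP_form c T X \<Phi> N \<longleftrightarrow>
     smooth_on T ((\<lambda>(z, \<theta>). fst (jet_tx z)) ` N) \<and>
     smooth_on X ((\<lambda>(z, \<theta>). jet_tx z) ` N) \<and>
     (\<forall>(z, (a, b))\<in>N.
        let p = jet_tx z;
            Tt = deriv T (fst p);
            Xt = pd_t X p;
            Xx = pd_x X p;
            Xxx = pd_x (pd_x X) p
        in Tt * Xx \<noteq> 0 \<and>
           \<Phi> (z, (a, b)) =
             (prolong2 (\<lambda>w. T (fst (jet_tx w))) (\<lambda>w. X (jet_tx w))
                (\<lambda>w. c / pd_x X (jet_tx w) * jet_u w) z,
              (Xx\<^sup>2 / Tt * a, Xx / Tt * b - (Xt + Xxx * a) / Tt)))"

end

theory Submission
  imports Defs
begin

text \<open>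
  Stationarity of \<open>(t', x')\<close> along a direction of the jet space forces stationarity of the new
  coefficients for all choices of the old ones, so it forces stationarity of \<open>(t, x)\<close>; hence
  \<open>t', x'\<close> are functions of \<open>(t, x)\<close> alone. Since \<open>u\<^sub>t\<^sub>t\<close> is free on a Fokker--Planck equation but
  enters the new \<open>u\<^sub>x\<^sub>x\<close> with the factor \<open>T\<^sub>x\<^sup>2\<close>, also \<open>T\<^sub>x = 0\<close>. It then suffices to test equations
  with \<open>A = a\<close> constant and \<open>B = b + b\<^sub>1 (x - x\<^sub>0)\<close>: comparing coefficients of \<open>u\<^sub>x\<^sub>x\<close> and \<open>u\<^sub>x\<close> gives the
  new \<open>A, B\<close>, and the zeroth-order term, in which \<open>a\<close>, \<open>b\<close> and \<open>b\<^sub>1\<close> can be varied independently,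
  gives \<open>u U\<^sub>u = U\<close>, \<open>(X\<^sub>x U)\<^sub>x = 0\<close> and \<open>(X\<^sub>x U)\<^sub>t = 0\<close> for \<open>u \<noteq> 0\<close>, that is \<open>U = c u / X\<^sub>x\<close>. The constant
  \<open>c\<close> is determined locally by the transformation, hence it is the same on a connected domain.
\<close>

section \<open>Smooth maps\<close>

text \<open>Projectability alone lets the new \<open>(t, x)\<close> depend on \<open>u\<close>, so
  that fibre preservation has to come from the class. The lever is that the new coefficients are
  functions of the new \<open>(t, x)\<close>, while the slopes of the old ones at a point are
  arbitrary. The slope \<open>b1\<close> of \<open>B\<close> contributes \<open>b1 * u\<close> to
  the equation, so every jet with \<open>u \<noteq> 0\<close> lies on a test equation with
  prescribed values \<open>a\<close>, \<open>b\<close>. At \<open>u = 0\<close> this fails, and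
  identities must be carried there by continuity. Moreover, removing \<open>u = 0\<close> may
  disconnect the domain, so a vanishing derivative off \<open>u = 0\<close> could leave two
  constants; the passage through the smooth function \<open>(X_x * U)_u\<close> excludes this. In
  the converse direction the prolonged map is triangular in the jet coordinates over the base map,
  which gives its inverse by back substitution, and the defect of the new equation is
  \<open>c / (T_t * X_x)\<close> times that of the old one. The standard prolongation takes the
  mixed derivative from the new \<open>u_t\<close>; its agreement with the one taken from the new
  \<open>u_x\<close> is what the contact condition demands.\<close>

lemma Ck_on_subset: "Ck_on k f S \<Longrightarrow> S' \<subseteq> S \<Longrightarrow> Ck_on k f S'"
  by (induction k arbitrary: f) (auto intro: continuous_on_subset)

text \<open>Openness of \<open>S\<close> makes the two functions agree near each of its points, so
  they have the same derivatives there even if they differ outside \<open>S\<close>.\<close>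

lemma Ck_on_cong:
  assumes "Ck_on k f S" "open S" "\<And>p. p \<in> S \<Longrightarrow> f p = g p"
  shows "Ck_on k g S"
  using assms(1,3)
proof (induction k arbitrary: f g)
  case 0
  then show ?case using continuous_on_eq[of S f g] by simp
next
  case (Suc k)
  have der: "(g has_derivative frechet_derivative f (at p)) (at p)" if "p \<in> S" for p
    using has_derivative_transform_within_open[OF _ assms(2) that, of f _ UNIV g] Suc.prems that
    by (auto simp: frechet_derivative_works)
  have eq: "frechet_derivative f (at p) = frechet_derivative g (at p)" if "p \<in> S" for p
    using der[OF that] by (rule frechet_derivative_at)
  have "Ck_on k (\<lambda>p. frechet_derivative g (at p) v) S" for v
  proof (rule Suc.IH)
    show "Ck_on k (\<lambda>p. frechet_derivative f (at p) v) S"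
      using Suc.prems(1) unfolding Ck_on.simps by blast
    show "\<And>p. p \<in> S \<Longrightarrow> frechet_derivative f (at p) v = frechet_derivative g (at p) v"
      by (simp only: eq)
  qed
  then show ?case using der by (auto simp: differentiable_def)
qed

text \<open>Uniqueness of the derivative lets any exhibited family \<open>f'\<close> replace
  \<open>frechet_derivative\<close>, which is defined by choice.\<close>

lemma Ck_on_SucI:
  assumes "open S" "\<And>p. p \<in> S \<Longrightarrow> (f has_derivative f' p) (at p)" "\<And>v. Ck_on k (\<lambda>p. f' p v) S"
  shows "Ck_on (Suc k) f S"
  using assms Ck_on_cong[OF assms(3) assms(1)] frechet_derivative_at[OF assms(2)]
  by (auto simp: differentiable_def)

lemma Ck_on_Suc_has_derivative:
  "Ck_on (Suc k) f S \<Longrightarrow> p \<in> S \<Longrightarrow> (f has_derivative frechet_derivative f (at p)) (at p)"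
  by (simp add: frechet_derivative_works)

lemma Ck_on_imp_continuous_on: "Ck_on k f S \<Longrightarrow> continuous_on S f"
  by (cases k) (auto intro!: continuous_at_imp_continuous_on differentiable_imp_continuous_within)

lemma Ck_on_Suc_imp: "Ck_on (Suc k) f S \<Longrightarrow> Ck_on k f S"
proof (induction k arbitrary: f)
  case 0
  then show ?case using Ck_on_imp_continuous_on[of "Suc 0" f S] by simp
next
  case (Suc k)
  then show ?case by auto
qed

lemma Ck_on_const: "open S \<Longrightarrow> Ck_on k (\<lambda>p. c) S"
proof (induction k arbitrary: c)
  case (Suc k)
  show ?case by (rule Ck_on_SucI[where f'="\<lambda>p v. 0"]) (use Suc in auto)
qed auto

lemma Ck_on_bounded_linear:
  assumes "bounded_linear L" "open S"
  shows "Ck_on k f S \<Longrightarrow> Ck_on k (\<lambda>p. L (f p)) S"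
proof (induction k arbitrary: f)
  case 0
  then show ?case using bounded_linear.continuous_on[OF assms(1)] by simp
next
  case (Suc k)
  show ?case
    by (rule Ck_on_SucI[where f'="\<lambda>p v. L (frechet_derivative f (at p) v)"])
       (use Suc assms in \<open>auto intro!: bounded_linear.has_derivative[OF assms(1)] simp: frechet_derivative_works\<close>)
qed

lemma Ck_on_ident: "open S \<Longrightarrow> Ck_on k (\<lambda>p. p) S"
proof (cases k)
  case (Suc j)
  assume "open S"
  then show ?thesis unfolding Suc
    by (intro Ck_on_SucI[where f'="\<lambda>p v. v"] Ck_on_const) auto
qed auto

lemma Ck_on_add:
  assumes "open S"
  shows "Ck_on k f S \<Longrightarrow> Ck_on k g S \<Longrightarrow> Ck_on k (\<lambda>p. f p + g p) S"
proof (induction k arbitrary: f g)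
  case 0
  then show ?case by (auto intro: continuous_on_add)
next
  case (Suc k)
  show ?case
    by (rule Ck_on_SucI[where f'="\<lambda>p v. frechet_derivative f (at p) v + frechet_derivative g (at p) v"])
       (use Suc assms in \<open>auto intro!: has_derivative_add simp: frechet_derivative_works\<close>)
qed

lemma Ck_on_sum:
  assumes "open S" "finite I" "\<And>i. i \<in> I \<Longrightarrow> Ck_on k (f i) S"
  shows "Ck_on k (\<lambda>p. \<Sum>i\<in>I. f i p) S"
  using assms(2,3)
  by (induction I rule: finite_induct) (auto intro!: Ck_on_add Ck_on_const assms(1))

text \<open>By the product rule the derivative is a sum of two products of the same kind with one
  factor differentiated in each, so the induction runs over all pairs \<open>f\<close>,
  \<open>g\<close>.\<close>

lemma Ck_on_bilinear:
  assumes "bounded_bilinear m" "open S"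
  shows "Ck_on k f S \<Longrightarrow> Ck_on k g S \<Longrightarrow> Ck_on k (\<lambda>p. m (f p) (g p)) S"
proof (induction k arbitrary: f g)
  case 0
  then show ?case using bounded_bilinear.continuous_on[OF assms(1)] by simp
next
  case (Suc k)
  show ?case
  proof (rule Ck_on_SucI[OF assms(2)])
    show "((\<lambda>p. m (f p) (g p)) has_derivative
        (\<lambda>v. m (f p) (frechet_derivative g (at p) v) + m (frechet_derivative f (at p) v) (g p))) (at p)"
      if "p \<in> S" for p
      using that Suc.prems
      by (intro bounded_bilinear.FDERIV[OF assms(1)]) (auto simp: frechet_derivative_works)
    show "Ck_on k (\<lambda>p. m (f p) (frechet_derivative g (at p) v) + m (frechet_derivative f (at p) v) (g p)) S" for v
      using Suc.prems Ck_on_Suc_imp[OF Suc.prems(1)] Ck_on_Suc_imp[OF Suc.prems(2)]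
      by (intro Ck_on_add[OF assms(2)] Suc.IH) auto
  qed
qed

lemma Ck_on_Pair:
  assumes "open S"
  shows "Ck_on k f S \<Longrightarrow> Ck_on k g S \<Longrightarrow> Ck_on k (\<lambda>p. (f p, g p)) S"
proof (induction k arbitrary: f g)
  case 0
  then show ?case by (auto intro: continuous_on_Pair)
next
  case (Suc k)
  show ?case
    by (rule Ck_on_SucI[where f'="\<lambda>p v. (frechet_derivative f (at p) v, frechet_derivative g (at p) v)"])
       (use Suc assms in \<open>auto intro!: has_derivative_Pair simp: frechet_derivative_works\<close>)
qed

lemma Ck_on_inverse:
  fixes f :: "'a::euclidean_space \<Rightarrow> real"
  assumes "open S" "\<And>p. p \<in> S \<Longrightarrow> f p \<noteq> 0"
  shows "Ck_on k f S \<Longrightarrow> Ck_on k (\<lambda>p. inverse (f p)) S"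
proof (induction k)
  case 0
  then show ?case using assms by (auto intro: continuous_on_inverse)
next
  case (Suc k)
  \<comment> \<open>The derivative of the reciprocal contains the reciprocal itself, so its order
    \<open>k\<close> regularity feeds into order \<open>Suc k\<close>.\<close>
  have I: "Ck_on k (\<lambda>p. inverse (f p)) S"
    using Suc Ck_on_Suc_imp by blast
  note mult = Ck_on_bilinear[OF bounded_bilinear_mult assms(1)]
  show ?case
  proof (rule Ck_on_SucI[OF assms(1)])
    show "((\<lambda>p. inverse (f p)) has_derivative
        (\<lambda>v. (- 1) * ((inverse (f p) * frechet_derivative f (at p) v) * inverse (f p)))) (at p)" if "p \<in> S" for p
      using Deriv.has_derivative_inverse[OF assms(2)[OF that] Ck_on_Suc_has_derivative[OF Suc.prems that]]
      by simp
    show "Ck_on k (\<lambda>p. (- 1) * ((inverse (f p) * frechet_derivative f (at p) v) * inverse (f p))) S" for v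
      using Suc.prems by (intro mult I Ck_on_const assms) auto
  qed
qed

text \<open>In the chain rule \<open>p\<close> enters both the base point and the direction of the
  derivative of \<open>f\<close>. Expanding the direction in \<open>Basis\<close> separates the two:
  each summand is a scalar function times a fixed directional derivative of \<open>f\<close>
  composed with \<open>g\<close>, and the induction hypothesis applies to that composition.\<close>

lemma Ck_on_compose:
  fixes f :: "'b::euclidean_space \<Rightarrow> 'c::real_normed_vector" and g :: "'a::euclidean_space \<Rightarrow> 'b"
  assumes "open S" "open T" "g ` S \<subseteq> T"
  shows "Ck_on k f T \<Longrightarrow> Ck_on k g S \<Longrightarrow> Ck_on k (\<lambda>p. f (g p)) S"
proof (induction k arbitrary: f)
  case 0
  then show ?case using continuous_on_compose2[of T f S g] assms(3) by simp
next
  case (Suc k)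
  have gT: "g p \<in> T" if "p \<in> S" for p using that assms by auto
  have fd: "(f has_derivative frechet_derivative f (at y)) (at y)" if "y \<in> T" for y
    using Suc.prems(1) that by (rule Ck_on_Suc_has_derivative)
  show ?case
  proof (rule Ck_on_SucI[OF assms(1)])
    show "((\<lambda>p. f (g p)) has_derivative
        (\<lambda>v. \<Sum>b\<in>Basis. (frechet_derivative g (at p) v \<bullet> b) *\<^sub>R frechet_derivative f (at (g p)) b)) (at p)"
      if "p \<in> S" for p
    proof -
      have "((\<lambda>p. f (g p)) has_derivative (\<lambda>v. frechet_derivative f (at (g p)) (frechet_derivative g (at p) v))) (at p)"
        using diff_chain_at[OF Ck_on_Suc_has_derivative[OF Suc.prems(2) that] fd[OF gT[OF that]]]
        by (simp add: o_def)
      moreover have "frechet_derivative f (at (g p)) w = (\<Sum>b\<in>Basis. (w \<bullet> b) *\<^sub>R frechet_derivative f (at (g p)) b)" for w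
      proof -
        have lin: "linear (frechet_derivative f (at (g p)))"
          using fd[OF gT[OF that]] has_derivative_linear by blast
        have "frechet_derivative f (at (g p)) w = frechet_derivative f (at (g p)) (\<Sum>b\<in>Basis. (w \<bullet> b) *\<^sub>R b)"
          by (rule arg_cong[OF euclidean_representation[symmetric]])
        then show ?thesis by (simp add: linear_sum[OF lin] linear_cmul[OF lin])
      qed
      ultimately show ?thesis by (rule has_derivative_eq_rhs[OF _ ext])
    qed
    show "Ck_on k (\<lambda>p. \<Sum>b\<in>Basis. (frechet_derivative g (at p) v \<bullet> b) *\<^sub>R frechet_derivative f (at (g p)) b) S" for v
      using Suc.prems Ck_on_Suc_imp[OF Suc.prems(2)]
      by (intro Ck_on_sum assms Ck_on_bilinear[OF bounded_bilinear_scaleR] Suc.IH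
          Ck_on_bounded_linear[OF bounded_linear_inner_left]) auto
  qed
qed

lemma Ck_on_local:
  "(\<And>p. p \<in> S \<Longrightarrow> \<exists>N. open N \<and> p \<in> N \<and> Ck_on k f N) \<Longrightarrow> Ck_on k f S"
proof (induction k arbitrary: f)
  case 0
  show ?case unfolding Ck_on.simps
  proof (rule continuous_at_imp_continuous_on, rule ballI)
    fix p assume "p \<in> S"
    from 0[OF this] show "isCont f p" by (auto simp: continuous_on_eq_continuous_at)
  qed
next
  case (Suc k)
  show ?case unfolding Ck_on.simps
  proof (intro conjI ballI allI)
    fix p assume "p \<in> S"
    from Suc.prems[OF this] show "f differentiable (at p)" by auto
  next
    fix v
    show "Ck_on k (\<lambda>p. frechet_derivative f (at p) v) S"
      using Suc.prems by (intro Suc.IH) (metis Ck_on.simps(2))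
  qed
qed

section \<open>Closure properties of smooth maps\<close>

named_theorems smooth

lemma smooth_on_subset: "smooth_on f S \<Longrightarrow> S' \<subseteq> S \<Longrightarrow> smooth_on f S'"
  unfolding smooth_on_def using Ck_on_subset by blast

lemma smooth_on_cong: "smooth_on f S \<Longrightarrow> open S \<Longrightarrow> (\<And>p. p \<in> S \<Longrightarrow> f p = g p) \<Longrightarrow> smooth_on g S"
  unfolding smooth_on_def using Ck_on_cong by blast

lemma smooth_on_local: "(\<And>p. p \<in> S \<Longrightarrow> \<exists>N. open N \<and> p \<in> N \<and> smooth_on f N) \<Longrightarrow> smooth_on f S"
  unfolding smooth_on_def using Ck_on_local by metis

lemma smooth_on_const [smooth]: "open S \<Longrightarrow> smooth_on (\<lambda>p. c) S"
  unfolding smooth_on_def using Ck_on_const by blast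

lemma smooth_on_ident [smooth]: "open S \<Longrightarrow> smooth_on (\<lambda>p. p) S"
  unfolding smooth_on_def using Ck_on_ident by blast

lemma smooth_on_bounded_linear:
  "bounded_linear L \<Longrightarrow> open S \<Longrightarrow> smooth_on f S \<Longrightarrow> smooth_on (\<lambda>p. L (f p)) S"
  unfolding smooth_on_def using Ck_on_bounded_linear by blast

lemmas smooth_on_fst [smooth] = smooth_on_bounded_linear[OF bounded_linear_fst]
lemmas smooth_on_snd [smooth] = smooth_on_bounded_linear[OF bounded_linear_snd]
lemmas smooth_on_minus [smooth] = smooth_on_bounded_linear[OF bounded_linear_minus[OF bounded_linear_ident]]

lemma smooth_on_add [smooth]:
  "open S \<Longrightarrow> smooth_on f S \<Longrightarrow> smooth_on g S \<Longrightarrow> smooth_on (\<lambda>p. f p + g p) S"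
  unfolding smooth_on_def using Ck_on_add by blast

lemma smooth_on_diff [smooth]:
  "open S \<Longrightarrow> smooth_on f S \<Longrightarrow> smooth_on g S \<Longrightarrow> smooth_on (\<lambda>p. f p - g p) S"
  using smooth_on_add[OF _ _ smooth_on_minus, of S f g] by simp

lemma smooth_on_mult [smooth]:
  fixes f g :: "_ \<Rightarrow> real"
  shows "open S \<Longrightarrow> smooth_on f S \<Longrightarrow> smooth_on g S \<Longrightarrow> smooth_on (\<lambda>p. f p * g p) S"
  unfolding smooth_on_def using Ck_on_bilinear[OF bounded_bilinear_mult] by blast

lemma smooth_on_power [smooth]:
  fixes f :: "_ \<Rightarrow> real"
  shows "open S \<Longrightarrow> smooth_on f S \<Longrightarrow> smooth_on (\<lambda>p. f p ^ n) S"
  by (induction n) (auto intro!: smooth)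

lemma smooth_on_Pair [smooth]:
  "open S \<Longrightarrow> smooth_on f S \<Longrightarrow> smooth_on g S \<Longrightarrow> smooth_on (\<lambda>p. (f p, g p)) S"
  unfolding smooth_on_def using Ck_on_Pair by blast

lemma smooth_on_inverse [smooth]:
  fixes f :: "_ \<Rightarrow> real"
  shows "open S \<Longrightarrow> smooth_on f S \<Longrightarrow> (\<And>p. p \<in> S \<Longrightarrow> f p \<noteq> 0) \<Longrightarrow> smooth_on (\<lambda>p. inverse (f p)) S"
  unfolding smooth_on_def using Ck_on_inverse by blast

lemma smooth_on_divide [smooth]:
  fixes f g :: "_ \<Rightarrow> real"
  shows "open S \<Longrightarrow> smooth_on f S \<Longrightarrow> smooth_on g S \<Longrightarrow> (\<And>p. p \<in> S \<Longrightarrow> g p \<noteq> 0) \<Longrightarrow> smooth_on (\<lambda>p. f p / g p) S"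
  by (auto simp: divide_inverse intro!: smooth)

lemma smooth_on_compose:
  fixes f :: "'b::euclidean_space \<Rightarrow> 'c::real_normed_vector" and g :: "'a::euclidean_space \<Rightarrow> 'b"
  shows "smooth_on f T \<Longrightarrow> open T \<Longrightarrow> open S \<Longrightarrow> smooth_on g S \<Longrightarrow> (\<And>p. p \<in> S \<Longrightarrow> g p \<in> T)
    \<Longrightarrow> smooth_on (\<lambda>p. f (g p)) S"
  unfolding smooth_on_def using Ck_on_compose[of S T g _ f] by (metis image_subsetI)

lemma smooth_on_frechet_derivative:
  "smooth_on f S \<Longrightarrow> smooth_on (\<lambda>p. frechet_derivative f (at p) v) S"
  unfolding smooth_on_def by (metis Ck_on.simps(2))

lemma smooth_on_has_derivative:
  "smooth_on f S \<Longrightarrow> p \<in> S \<Longrightarrow> (f has_derivative frechet_derivative f (at p)) (at p)"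
  unfolding smooth_on_def using Ck_on_Suc_has_derivative by blast

lemma smooth_on_imp_continuous_on: "smooth_on f S \<Longrightarrow> continuous_on S f"
  unfolding smooth_on_def by (metis Ck_on.simps(1))

text \<open>Both functions have the same derivatives at \<open>p\<close>, so the choice inside
  \<open>frechet_derivative\<close> agrees even where no derivative exists.\<close>

lemma frechet_derivative_cong_open:
  assumes "open S" "p \<in> S" "\<And>q. q \<in> S \<Longrightarrow> f q = g q"
  shows "frechet_derivative f (at p) = frechet_derivative g (at p)"
proof -
  have "(f has_derivative D) (at p) \<longleftrightarrow> (g has_derivative D) (at p)" for D
    using has_derivative_transform_within_open[of f D p UNIV S g]
      has_derivative_transform_within_open[of g D p UNIV S f] assms by auto
  then show ?thesis unfolding frechet_derivative_def by simp
qed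

section \<open>Partial derivatives and prolongation\<close>

lemma pd_eqI:
  fixes f :: "real \<times> real \<Rightarrow> real"
  assumes "(f has_derivative D) (at p)"
  shows "pd_t f p = D (1, 0)" "pd_x f p = D (0, 1)"
    and "((\<lambda>s. f (s, snd p)) has_real_derivative D (1, 0)) (at (fst p))"
    and "((\<lambda>y. f (fst p, y)) has_real_derivative D (0, 1)) (at (snd p))"
proof -
  have lin: "linear D" using assms has_derivative_linear by blast
  obtain t x where p: "p = (t, x)" by (cases p)
  have "((\<lambda>s. f (s, x)) has_derivative (\<lambda>h. D (h, 0))) (at t)"
    by (rule has_derivative_compose[OF has_derivative_Pair[OF has_derivative_ident has_derivative_const]])
       (use assms p in simp)
  moreover have "D (h, 0) = D (1, 0) * h" for h
    using linear_cmul[OF lin, of h "(1, 0)"] by simp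
  ultimately show 1: "((\<lambda>s. f (s, snd p)) has_real_derivative D (1, 0)) (at (fst p))"
    unfolding has_field_derivative_def p fst_conv snd_conv by (rule has_derivative_eq_rhs[OF _ ext])
  have "((\<lambda>y. f (t, y)) has_derivative (\<lambda>h. D (0, h))) (at x)"
    by (rule has_derivative_compose[OF has_derivative_Pair[OF has_derivative_const has_derivative_ident]])
       (use assms p in simp)
  moreover have "D (0, h) = D (0, 1) * h" for h
    using linear_cmul[OF lin, of h "(0, 1)"] by simp
  ultimately show 2: "((\<lambda>y. f (fst p, y)) has_real_derivative D (0, 1)) (at (snd p))"
    unfolding has_field_derivative_def p fst_conv snd_conv by (rule has_derivative_eq_rhs[OF _ ext])
  show "pd_t f p = D (1, 0)" "pd_x f p = D (0, 1)"
    using DERIV_imp_deriv[OF 1] DERIV_imp_deriv[OF 2] by (simp_all add: pd_t_def pd_x_def p)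
qed

context
  fixes f :: "real \<times> real \<Rightarrow> real" and S
  assumes f: "smooth_on f S" and S: "open S"
begin

lemma smooth_on_pd [smooth]: "smooth_on (pd_t f) S" "smooth_on (pd_x f) S"
  using pd_eqI(1,2)[OF smooth_on_has_derivative[OF f]]
  by (auto intro!: smooth_on_cong[OF smooth_on_frechet_derivative[OF f] S])

lemma has_derivative_pd:
  assumes "p \<in> S"
  shows "(f has_derivative (\<lambda>v. pd_t f p * fst v + pd_x f p * snd v)) (at p)"
proof -
  note d = smooth_on_has_derivative[OF f assms]
  have lin: "linear (frechet_derivative f (at p))" using d has_derivative_linear by blast
  show ?thesis
  proof (rule has_derivative_eq_rhs[OF d], rule ext)
    fix v :: "real \<times> real"
    show "frechet_derivative f (at p) v = pd_t f p * fst v + pd_x f p * snd v"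
      using linear_add[OF lin, of "fst v *\<^sub>R (1, 0)" "snd v *\<^sub>R (0, 1)"]
        linear_cmul[OF lin, of "fst v" "(1, 0)"] linear_cmul[OF lin, of "snd v" "(0, 1)"]
        pd_eqI(1,2)[OF d] by simp
  qed
qed

lemma has_real_derivative_pd:
  assumes "(t, x) \<in> S"
  shows "((\<lambda>s. f (s, x)) has_real_derivative pd_t f (t, x)) (at t)"
    and "((\<lambda>y. f (t, y)) has_real_derivative pd_x f (t, x)) (at x)"
  using pd_eqI(3,4)[OF has_derivative_pd[OF assms]] by auto

end

text \<open>The mean value theorem in one variable and then in the other, applied in both orders,
  turns the same second difference into either mixed derivative at some point of the square.\<close>

lemma second_difference_mean_value:
  fixes f :: "real \<times> real \<Rightarrow> real"
  assumes f: "smooth_on f S" "open S" and h: "h > 0" and box: "{t..t+h} \<times> {x..x+h} \<subseteq> S"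
  shows "\<exists>p\<in>{t..t+h} \<times> {x..x+h}.
    f (t+h, x+h) - f (t+h, x) - f (t, x+h) + f (t, x) = h * h * pd_x (pd_t f) p"
    "\<exists>p\<in>{t..t+h} \<times> {x..x+h}.
    f (t+h, x+h) - f (t+h, x) - f (t, x+h) + f (t, x) = h * h * pd_t (pd_x f) p"
proof -
  note d = has_real_derivative_pd[OF f]
  note dt = has_real_derivative_pd[OF smooth_on_pd(1)[OF f] f(2)]
  note dx = has_real_derivative_pd[OF smooth_on_pd(2)[OF f] f(2)]
  have inS: "(s, y) \<in> S" if "s \<in> {t..t+h}" "y \<in> {x..x+h}" for s y using box that by auto
  have "\<exists>s>t. s < t+h \<and> (f (t+h, x+h) - f (t+h, x)) - (f (t, x+h) - f (t, x))
      = (t + h - t) * (pd_t f (s, x+h) - pd_t f (s, x))"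
    by (rule MVT2) (use h in \<open>auto intro!: DERIV_diff d inS\<close>)
  then obtain s where s: "t < s" "s < t + h" "(f (t+h, x+h) - f (t+h, x)) - (f (t, x+h) - f (t, x))
      = h * (pd_t f (s, x+h) - pd_t f (s, x))" by auto
  have "\<exists>y>x. y < x+h \<and> pd_t f (s, x+h) - pd_t f (s, x) = (x + h - x) * pd_x (pd_t f) (s, y)"
    by (rule MVT2) (use h s in \<open>auto intro!: dt inS\<close>)
  then obtain y where y: "x < y" "y < x + h" "pd_t f (s, x+h) - pd_t f (s, x) = h * pd_x (pd_t f) (s, y)"
    by auto
  show "\<exists>p\<in>{t..t+h} \<times> {x..x+h}.
    f (t+h, x+h) - f (t+h, x) - f (t, x+h) + f (t, x) = h * h * pd_x (pd_t f) p"
    by (rule bexI[of _ "(s, y)"]) (use s y in auto)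
  have "\<exists>y>x. y < x+h \<and> (f (t+h, x+h) - f (t, x+h)) - (f (t+h, x) - f (t, x))
      = (x + h - x) * (pd_x f (t+h, y) - pd_x f (t, y))"
    by (rule MVT2) (use h in \<open>auto intro!: DERIV_diff d inS\<close>)
  then obtain y where y: "x < y" "y < x + h" "(f (t+h, x+h) - f (t, x+h)) - (f (t+h, x) - f (t, x))
      = h * (pd_x f (t+h, y) - pd_x f (t, y))" by auto
  have "\<exists>s>t. s < t+h \<and> pd_x f (t+h, y) - pd_x f (t, y) = (t + h - t) * pd_t (pd_x f) (s, y)"
    by (rule MVT2) (use h y in \<open>auto intro!: dx inS\<close>)
  then obtain s where s: "t < s" "s < t + h" "pd_x f (t+h, y) - pd_x f (t, y) = h * pd_t (pd_x f) (s, y)"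
    by auto
  show "\<exists>p\<in>{t..t+h} \<times> {x..x+h}.
    f (t+h, x+h) - f (t+h, x) - f (t, x+h) + f (t, x) = h * h * pd_t (pd_x f) p"
    by (rule bexI[of _ "(s, y)"]) (use s y in \<open>auto simp: algebra_simps\<close>)
qed

text \<open>If the mixed derivatives differed at \<open>p\<close>, continuity would keep them apart
  on a small square, whereas the second difference over that square is its area times a value of
  each.\<close>

lemma pd_commute:
  fixes f :: "real \<times> real \<Rightarrow> real"
  assumes f: "smooth_on f S" "open S" and p: "p \<in> S"
  shows "pd_t (pd_x f) p = pd_x (pd_t f) p"
proof (rule ccontr)
  obtain t x where tx: "p = (t, x)" by (cases p)
  \<comment> \<open>Half of the gap: values closer than \<open>e\<close> to the two ends cannot
    coincide.\<close>
  define e where "e = \<bar>pd_t (pd_x f) p - pd_x (pd_t f) p\<bar> / 2"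
  assume "pd_t (pd_x f) p \<noteq> pd_x (pd_t f) p"
  then have e: "e > 0" by (simp add: e_def)
  let ?N = "\<lambda>g. {q \<in> S. dist (g q) (g p) < e}"
  have N: "open (?N g)" "p \<in> ?N g" if "smooth_on g S" for g :: "real \<times> real \<Rightarrow> real"
    using continuous_open_preimage[OF smooth_on_imp_continuous_on[OF that] f(2) open_ball[of "g p" e]] p e
    by (auto simp: vimage_def ball_def dist_commute Int_def)
  have sm: "smooth_on (pd_t (pd_x f)) S" "smooth_on (pd_x (pd_t f)) S" using f by (auto intro!: smooth)
  have "open (?N (pd_t (pd_x f)) \<inter> ?N (pd_x (pd_t f)))"
    "p \<in> ?N (pd_t (pd_x f)) \<inter> ?N (pd_x (pd_t f))"
    using N[OF sm(1)] N[OF sm(2)] by auto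
  then obtain A B where AB: "open A" "open B" "t \<in> A" "x \<in> B"
    "A \<times> B \<subseteq> ?N (pd_t (pd_x f)) \<inter> ?N (pd_x (pd_t f))"
    unfolding tx by (elim open_prod_elim) (auto simp: mem_Sigma_iff)
  obtain d1 d2 where d: "d1 > 0" "cball t d1 \<subseteq> A" "d2 > 0" "cball x d2 \<subseteq> B"
    using AB open_contains_cball by metis
  define h where "h = min d1 d2"
  have h: "h > 0" using d by (simp add: h_def)
  have "{t..t+h} \<subseteq> cball t d1" "{x..x+h} \<subseteq> cball x d2"
    by (auto simp: h_def cball_def dist_real_def)
  then have sub: "{t..t+h} \<times> {x..x+h} \<subseteq> ?N (pd_t (pd_x f)) \<inter> ?N (pd_x (pd_t f))"
    using AB d by blast
  then have "{t..t+h} \<times> {x..x+h} \<subseteq> S" by blast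
  note m = second_difference_mean_value[OF f h this]
  from m obtain q q' where q: "q \<in> {t..t+h} \<times> {x..x+h}" "q' \<in> {t..t+h} \<times> {x..x+h}"
    "h * h * pd_x (pd_t f) q = h * h * pd_t (pd_x f) q'" by metis
  then have "pd_x (pd_t f) q = pd_t (pd_x f) q'" using h by simp
  moreover have "dist (pd_x (pd_t f) q) (pd_x (pd_t f) p) < e" "dist (pd_t (pd_x f) q') (pd_t (pd_x f) p) < e"
    using sub q by auto
  ultimately show False by (simp add: dist_real_def e_def abs_if split: if_splits)
qed

section \<open>Partial derivatives over \<open>(t, x, u)\<close> and total derivatives\<close>

definition part_t :: "((real \<times> real) \<times> real \<Rightarrow> real) \<Rightarrow> (real \<times> real) \<times> real \<Rightarrow> real" where
  "part_t f q = frechet_derivative f (at q) ((1, 0), 0)"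

definition part_x :: "((real \<times> real) \<times> real \<Rightarrow> real) \<Rightarrow> (real \<times> real) \<times> real \<Rightarrow> real" where
  "part_x f q = frechet_derivative f (at q) ((0, 1), 0)"

definition part_u :: "((real \<times> real) \<times> real \<Rightarrow> real) \<Rightarrow> (real \<times> real) \<times> real \<Rightarrow> real" where
  "part_u f q = frechet_derivative f (at q) ((0, 0), 1)"

lemma smooth_on_part [smooth]:
  assumes "smooth_on f S"
  shows "smooth_on (part_t f) S" "smooth_on (part_x f) S" "smooth_on (part_u f) S"
  unfolding part_t_def part_x_def part_u_def by (rule smooth_on_frechet_derivative[OF assms])+

lemma has_derivative_part:
  assumes "smooth_on f S" "q \<in> S"
  shows "(f has_derivative (\<lambda>v. part_t f q * fst (fst v) + part_x f q * snd (fst v) + part_u f q * snd v)) (at q)"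
proof -
  note d = smooth_on_has_derivative[OF assms]
  have lin: "linear (frechet_derivative f (at q))" using d has_derivative_linear by blast
  show ?thesis
  proof (rule has_derivative_eq_rhs[OF d], rule ext)
    fix v :: "(real \<times> real) \<times> real"
    have "frechet_derivative f (at q) v = frechet_derivative f (at q)
        (fst (fst v) *\<^sub>R ((1, 0), 0) + snd (fst v) *\<^sub>R ((0, 1), 0) + snd v *\<^sub>R ((0, 0), 1))"
      by (rule arg_cong) (simp add: prod_eq_iff)
    also have "\<dots> = part_t f q * fst (fst v) + part_x f q * snd (fst v) + part_u f q * snd v"
      unfolding linear_add[OF lin] linear_cmul[OF lin] by (simp add: part_t_def part_x_def part_u_def)
    finally show "frechet_derivative f (at q) v = part_t f q * fst (fst v) + part_x f q * snd (fst v) + part_u f q * snd v" .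
  qed
qed

lemma part_eqI:
  assumes "(f has_derivative D) (at q)"
  shows "part_t f q = D ((1, 0), 0)" "part_x f q = D ((0, 1), 0)" "part_u f q = D ((0, 0), 1)"
  using frechet_derivative_at[OF assms] by (simp_all add: part_t_def part_x_def part_u_def)

lemma total_eqI:
  assumes "(F has_derivative F') (at z)"
  shows "total_t F z = F' (tvec z)" "total_x F z = F' (xvec z)"
  using frechet_derivative_at[OF assms] by (simp_all add: total_t_def total_x_def)

abbreviation jet_ut :: "jet2 \<Rightarrow> real" where "jet_ut z \<equiv> fst (fst (snd (snd z)))"
abbreviation jet_ux :: "jet2 \<Rightarrow> real" where "jet_ux z \<equiv> snd (fst (snd (snd z)))"

lemma has_derivative_jet_txu: "(jet_txu has_derivative jet_txu) (at z)"
  unfolding jet_txu_def jet_tx_def jet_u_def by (auto intro!: derivative_eq_intros)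

lemma has_derivative_affine_jet:
  fixes f g h :: "(real \<times> real) \<times> real \<Rightarrow> real"
  assumes "smooth_on f S" "smooth_on g S" "smooth_on h S" "jet_txu z \<in> S"
  defines "d \<equiv> \<lambda>f v. part_t f (jet_txu z) * fst (fst v) + part_x f (jet_txu z) * snd (fst v) + part_u f (jet_txu z) * fst (snd v)"
  shows "((\<lambda>w. f (jet_txu w) + g (jet_txu w) * jet_ut w + h (jet_txu w) * jet_ux w) has_derivative
    (\<lambda>v. d f v + (d g v * jet_ut z + g (jet_txu z) * jet_ut v) + (d h v * jet_ux z + h (jet_txu z) * jet_ux v))) (at z)"
proof -
  have c: "((\<lambda>w. f (jet_txu w)) has_derivative d f) (at z)" if "smooth_on f S" for f
    using has_derivative_compose[OF has_derivative_jet_txu has_derivative_part[OF that assms(4)]]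
    by (simp add: d_def jet_txu_def jet_tx_def jet_u_def)
  show ?thesis
    by (rule derivative_eq_intros c assms refl | (rule ext, simp add: algebra_simps; fail))+
qed

text \<open>When the new \<open>t\<close> and \<open>x\<close> are functions of the old ones, the
  first prolongation has components of this shape. The second-order coordinates then enter the total
  derivatives only through \<open>g\<close> and \<open>h\<close>.\<close>

lemma total_affine_jet:
  fixes f g h :: "(real \<times> real) \<times> real \<Rightarrow> real" and t x u ut ux utt utx uxx :: real
  assumes "smooth_on f S" "smooth_on g S" "smooth_on h S" "((t, x), u) \<in> S"
  defines "F \<equiv> \<lambda>w. f (jet_txu w) + g (jet_txu w) * jet_ut w + h (jet_txu w) * jet_ux w"
    and "z \<equiv> ((t, x), u, (ut, ux), (utt, utx, uxx))" and "q \<equiv> ((t, x), u)"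
  shows "total_t F z = part_t f q + part_u f q * ut + (part_t g q + part_u g q * ut) * ut + g q * utt
      + (part_t h q + part_u h q * ut) * ux + h q * utx"
    and "total_x F z = part_x f q + part_u f q * ux + (part_x g q + part_u g q * ux) * ut + g q * utx
      + (part_x h q + part_u h q * ux) * ux + h q * uxx"
  using total_eqI[OF has_derivative_affine_jet[OF assms(1-3), of z]] assms(4)
  by (simp_all add: F_def z_def q_def jet_txu_def jet_tx_def jet_u_def algebra_simps)

lemma total_cong:
  assumes "open Z" "z \<in> Z" "\<And>w. w \<in> Z \<Longrightarrow> F w = G w"
  shows "total_t F z = total_t G z" "total_x F z = total_x G z"
  using frechet_derivative_cong_open[OF assms] by (simp_all add: total_t_def total_x_def)

lemma prol_cong:
  assumes "open Z" "z \<in> Z" "\<And>w. w \<in> Z \<Longrightarrow> T w = T' w" "\<And>w. w \<in> Z \<Longrightarrow> X w = X' w"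
    "\<And>w. w \<in> Z \<Longrightarrow> F w = F' w"
  shows "prol_t T X F z = prol_t T' X' F' z" "prol_x T X F z = prol_x T' X' F' z"
  using total_cong[OF assms(1,2,3)] total_cong[OF assms(1,2,4)] total_cong[OF assms(1,2,5)]
  by (simp_all add: prol_t_def prol_x_def total_jac_def)

text \<open>Prolongation sees only germs. The first-order components agree on all of
  \<open>Z\<close> before they are differentiated again.\<close>

lemma prolong2_cong:
  assumes "open Z" "z \<in> Z" "\<And>w. w \<in> Z \<Longrightarrow> T w = T' w" "\<And>w. w \<in> Z \<Longrightarrow> X w = X' w"
    "\<And>w. w \<in> Z \<Longrightarrow> U w = U' w"
  shows "prolong2 T X U z = prolong2 T' X' U' z"
  using assms prol_cong[OF assms(1) _ assms(3,4,5)]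
    prol_cong[OF assms(1,2,3,4) prol_cong(1)[OF assms(1) _ assms(3,4,5)]]
    prol_cong[OF assms(1,2,3,4) prol_cong(2)[OF assms(1) _ assms(3,4,5)]]
  unfolding prolong2_def by simp

section \<open>The contact distribution and standard prolongation\<close>

lemma contact_plane_iff:
  "v \<in> contact_plane z \<longleftrightarrow>
     fst (snd v) = jet_ut z * fst (fst v) + jet_ux z * snd (fst v) \<and>
     jet_ut v = fst (snd (snd (snd z))) * fst (fst v) + fst (snd (snd (snd (snd z)))) * snd (fst v) \<and>
     jet_ux v = fst (snd (snd (snd (snd z)))) * fst (fst v) + snd (snd (snd (snd (snd z)))) * snd (fst v)"
  by (cases z rule: contact_plane.cases; cases v rule: contact_plane.cases) auto

lemma tvec_in_contact_plane: "tvec z \<in> contact_plane z" and xvec_in_contact_plane: "xvec z \<in> contact_plane z"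
  by (cases z rule: contact_plane.cases; auto)+

text \<open>By Cramer's rule, preserving the contact distribution determines the derivative components.\<close>

lemma contact_imp_prolong2:
  assumes Z: "open Z" and z: "z \<in> Z"
    and d: "\<And>z. z \<in> Z \<Longrightarrow> \<psi> differentiable (at z)"
    and c: "\<And>z v. z \<in> Z \<Longrightarrow> v \<in> contact_plane z \<Longrightarrow> frechet_derivative \<psi> (at z) v \<in> contact_plane (\<psi> z)"
    and j: "\<And>z. z \<in> Z \<Longrightarrow> total_jac (\<lambda>w. fst (fst (\<psi> w))) (\<lambda>w. snd (fst (\<psi> w))) z \<noteq> 0"
  shows "\<psi> z = prolong2 (\<lambda>w. fst (fst (\<psi> w))) (\<lambda>w. snd (fst (\<psi> w))) (\<lambda>w. fst (snd (\<psi> w))) z"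
proof -
  define T X U P Q where defs: "T = (\<lambda>w. fst (fst (\<psi> w)))" "X = (\<lambda>w. snd (fst (\<psi> w)))" "U = (\<lambda>w. fst (snd (\<psi> w)))"
    "P = (\<lambda>w. jet_ut (\<psi> w))" "Q = (\<lambda>w. jet_ux (\<psi> w))"
  define D where "D z = frechet_derivative \<psi> (at z)" for z
  have D: "(\<psi> has_derivative D z) (at z)" if "z \<in> Z" for z
    using d[OF that] by (simp add: D_def frechet_derivative_works)
  have der: "(T has_derivative (\<lambda>v. fst (fst (D z v)))) (at z)" "(X has_derivative (\<lambda>v. snd (fst (D z v)))) (at z)"
    "(U has_derivative (\<lambda>v. fst (snd (D z v)))) (at z)" "(P has_derivative (\<lambda>v. jet_ut (D z v))) (at z)"
    "(Q has_derivative (\<lambda>v. jet_ux (D z v))) (at z)" if "z \<in> Z" for z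
    unfolding defs by (auto intro!: derivative_eq_intros D that)
  note tot = total_eqI[OF der(1)] total_eqI[OF der(2)] total_eqI[OF der(3)] total_eqI[OF der(4)] total_eqI[OF der(5)]
  have con: "D z (tvec z) \<in> contact_plane (\<psi> z)" "D z (xvec z) \<in> contact_plane (\<psi> z)" if "z \<in> Z" for z
    using c[OF that tvec_in_contact_plane] c[OF that xvec_in_contact_plane] by (auto simp: D_def)
  have jac: "total_t T z * total_x X z - total_x T z * total_t X z \<noteq> 0" if "z \<in> Z" for z
    using j[OF that] by (simp add: total_jac_def defs)
  have first: "P z = prol_t T X U z" "Q z = prol_x T X U z" if "z \<in> Z" for z
    using con[OF that] jac[OF that] unfolding contact_plane_iff prol_t_def prol_x_def total_jac_def tot[OF that]
    by (simp_all add: defs(4,5) field_simps)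
  have second: "fst (snd (snd (snd (\<psi> z)))) = prol_t T X P z" "fst (snd (snd (snd (snd (\<psi> z))))) = prol_x T X P z"
    "snd (snd (snd (snd (snd (\<psi> z))))) = prol_x T X Q z"
    using con[OF z] jac[OF z] unfolding contact_plane_iff prol_t_def prol_x_def total_jac_def tot[OF z]
    by (simp_all add: field_simps)
  \<comment> \<open>The first-order identities hold on the whole open set \<open>Z\<close>, which
    allows them to be used under a further total derivative.\<close>
  have "prol_t T X P z = prol_t T X (prol_t T X U) z" "prol_x T X P z = prol_x T X (prol_t T X U) z"
    "prol_x T X Q z = prol_x T X (prol_x T X U) z"
    by (rule prol_cong[OF Z z]; simp add: first)+
  then show ?thesis unfolding defs(1-3)[symmetric] prolong2_def using first[OF z] second
    by (auto simp: prod_eq_iff defs)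
qed

lemma smooth_on_deriv [smooth]:
  fixes T :: "real \<Rightarrow> real"
  assumes "smooth_on T I" "open I"
  shows "smooth_on (deriv T) I"
    and "t \<in> I \<Longrightarrow> (T has_real_derivative deriv T t) (at t)"
proof -
  have d: "(T has_real_derivative frechet_derivative T (at t) 1) (at t)" if "t \<in> I" for t
  proof -
    note h = smooth_on_has_derivative[OF assms(1) that]
    have "frechet_derivative T (at t) v = frechet_derivative T (at t) 1 * v" for v
      using linear_cmul[OF has_derivative_linear[OF h], of v 1] by (simp add: mult.commute[of _ v])
    then show ?thesis unfolding has_field_derivative_def
      by (rule has_derivative_eq_rhs[OF h ext])
  qed
  then show "t \<in> I \<Longrightarrow> (T has_real_derivative deriv T t) (at t)"
    using DERIV_imp_deriv by metis
  show "smooth_on (deriv T) I"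
    using DERIV_imp_deriv[OF d]
    by (intro smooth_on_cong[OF smooth_on_frechet_derivative[OF assms(1), of 1] assms(2)]) auto
qed

section \<open>Functions linear in \<open>u\<close> and its first derivatives\<close>

lemma has_derivative_jet_tx: "(jet_tx has_derivative jet_tx) (at z)"
  unfolding jet_tx_def by (auto intro!: derivative_eq_intros)

lemma total_base:
  assumes "smooth_on f D" "open D" "jet_tx z \<in> D"
  shows "total_t (\<lambda>w. f (jet_tx w)) z = pd_t f (jet_tx z)" "total_x (\<lambda>w. f (jet_tx w)) z = pd_x f (jet_tx z)"
  using total_eqI[OF has_derivative_compose[OF has_derivative_jet_tx has_derivative_pd[OF assms]]]
  by (cases z rule: contact_plane.cases, simp add: jet_tx_def)+

lemma prol_base:
  assumes "smooth_on T D" "smooth_on X D" "open D" "jet_tx z \<in> D"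
  defines "q \<equiv> jet_tx z"
  shows "prol_t (\<lambda>w. T (jet_tx w)) (\<lambda>w. X (jet_tx w)) F z = (total_t F z * pd_x X q - total_x F z * pd_t X q) /
        (pd_t T q * pd_x X q - pd_x T q * pd_t X q)"
    and "prol_x (\<lambda>w. T (jet_tx w)) (\<lambda>w. X (jet_tx w)) F z = (pd_t T q * total_x F z - pd_x T q * total_t F z) /
        (pd_t T q * pd_x X q - pd_x T q * pd_t X q)"
  using total_base[OF assms(1,3,4)] total_base[OF assms(2,3,4)]
  by (simp_all add: prol_t_def prol_x_def total_jac_def q_def)

text \<open>The first prolongation stays in this class when \<open>U\<close> is linear in
  \<open>u\<close> and the new \<open>t\<close>, \<open>x\<close> are free of \<open>u\<close>. Its
  total derivatives then involve only \<open>pd_t\<close> and \<open>pd_x\<close> of the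
  coefficients.\<close>

definition lin_jet :: "(real \<times> real \<Rightarrow> real) \<Rightarrow> (real \<times> real \<Rightarrow> real) \<Rightarrow> (real \<times> real \<Rightarrow> real) \<Rightarrow> jet2 \<Rightarrow> real" where
  "lin_jet f g h w = f (jet_tx w) * jet_u w + g (jet_tx w) * jet_ut w + h (jet_tx w) * jet_ux w"

lemma has_derivative_lin_jet:
  assumes "smooth_on f D" "smooth_on g D" "smooth_on h D" "open D" "jet_tx z \<in> D"
  shows "(lin_jet f g h has_derivative (\<lambda>v.
      ((pd_t f (jet_tx z) * fst (fst v) + pd_x f (jet_tx z) * snd (fst v)) * jet_u z + f (jet_tx z) * fst (snd v)) +
      ((pd_t g (jet_tx z) * fst (fst v) + pd_x g (jet_tx z) * snd (fst v)) * jet_ut z + g (jet_tx z) * jet_ut v) +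
      ((pd_t h (jet_tx z) * fst (fst v) + pd_x h (jet_tx z) * snd (fst v)) * jet_ux z + h (jet_tx z) * jet_ux v))) (at z)"
proof -
  have c: "((\<lambda>w. f (jet_tx w)) has_derivative (\<lambda>v. pd_t f (jet_tx z) * fst (fst v) + pd_x f (jet_tx z) * snd (fst v))) (at z)"
    if "smooth_on f D" for f
    using has_derivative_compose[OF has_derivative_jet_tx has_derivative_pd[OF that assms(4,5)]]
    by (simp add: jet_tx_def)
  show ?thesis unfolding lin_jet_def[abs_def] jet_u_def
    by (rule derivative_eq_intros c assms refl | (rule ext, simp add: algebra_simps jet_u_def; fail))+
qed

lemma total_lin_jet:
  fixes t x u ut ux utt utx uxx :: real
  assumes "smooth_on f D" "smooth_on g D" "smooth_on h D" "open D" "(t, x) \<in> D"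
  defines "z \<equiv> ((t, x), u, (ut, ux), (utt, utx, uxx))" and "q \<equiv> (t, x)"
  shows "total_t (lin_jet f g h) z = pd_t f q * u + f q * ut + pd_t g q * ut + g q * utt + pd_t h q * ux + h q * utx"
    and "total_x (lin_jet f g h) z = pd_x f q * u + f q * ux + pd_x g q * ut + g q * utx + pd_x h q * ux + h q * uxx"
  using total_eqI[OF has_derivative_lin_jet[OF assms(1-4), of z]] assms(5)
  by (simp_all add: z_def q_def jet_tx_def jet_u_def algebra_simps)

lemma open_jet_tx_vimage: "open D \<Longrightarrow> open {w. jet_tx w \<in> D}"
  unfolding jet_tx_def using open_vimage[of D fst] by (simp add: vimage_def continuous_on_fst)

text \<open>Expansion of the divergence form. The inner total derivative is again a
  \<open>lin_jet\<close> on the open set of jets over \<open>D\<close>, so the outer one can be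
  computed from that expression.\<close>

lemma FP_eq_iff:
  fixes t x u ut ux utt utx uxx :: real
  assumes "FP_coeffs D A B"
  shows "((t, x), u, (ut, ux), (utt, utx, uxx)) \<in> FP_eq D A B \<longleftrightarrow> (t, x) \<in> D \<and>
    ut = pd_x (pd_x A) (t, x) * u + 2 * pd_x A (t, x) * ux + A (t, x) * uxx + pd_x B (t, x) * u + B (t, x) * ux"
proof (cases "(t, x) \<in> D")
  case True
  let ?z = "((t, x), u, (ut, ux), (utt, utx, uxx))"
  have D: "open D" and A: "smooth_on A D" and B: "smooth_on B D" using assms by (auto simp: FP_coeffs_def)
  have l: "(\<lambda>w. f (jet_tx w) * jet_u w) = lin_jet f (\<lambda>_. 0) (\<lambda>_. 0)" for f
    by (simp add: lin_jet_def fun_eq_iff)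
  have z0: "smooth_on (\<lambda>_. 0 :: real) D" using D by (auto intro: smooth)
  have pz: "pd_x (\<lambda>_. 0) = (\<lambda>_. 0 :: real)" by (auto simp: pd_x_def fun_eq_iff)
  have 1: "total_x (lin_jet f (\<lambda>_. 0) (\<lambda>_. 0)) w = lin_jet (pd_x f) (\<lambda>_. 0) f w"
    if "smooth_on f D" "w \<in> {w. jet_tx w \<in> D}" for f w
    using total_lin_jet(2)[OF that(1) z0 z0 D] that(2)
    by (cases w rule: contact_plane.cases) (auto simp: lin_jet_def jet_tx_def jet_u_def pz)
  have zm: "?z \<in> {w. jet_tx w \<in> D}" using True by (simp add: jet_tx_def)
  have "total_x (total_x (\<lambda>w. A (jet_tx w) * jet_u w)) ?z = total_x (lin_jet (pd_x A) (\<lambda>_. 0) A) ?z"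
    unfolding l by (rule total_cong(2)[OF open_jet_tx_vimage[OF D] zm]) (rule 1[OF A])
  also have "\<dots> = pd_x (pd_x A) (t, x) * u + 2 * pd_x A (t, x) * ux + A (t, x) * uxx"
    by (subst total_lin_jet[OF smooth_on_pd(2)[OF A D] z0 A D True]) (simp add: pz)
  finally show ?thesis using True unfolding FP_eq_def l
    by (simp add: 1[OF B zm]) (simp add: jet_tx_def lin_jet_def jet_u_def algebra_simps)
qed (simp add: FP_eq_def jet_tx_def)

lemma pd_mult:
  assumes "smooth_on f D" "smooth_on g D" "open D" "q \<in> D"
  shows "pd_t (\<lambda>q. f q * g q) q = f q * pd_t g q + pd_t f q * g q"
    "pd_x (\<lambda>q. f q * g q) q = f q * pd_x g q + pd_x f q * g q"
  using pd_eqI(1,2)[OF has_derivative_mult[OF has_derivative_pd[OF assms(1,3,4)] has_derivative_pd[OF assms(2,3,4)]]]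
  by (simp_all add: algebra_simps)

lemma pd_diff:
  assumes "smooth_on f D" "smooth_on g D" "open D" "q \<in> D"
  shows "pd_t (\<lambda>q. f q - g q) q = pd_t f q - pd_t g q" "pd_x (\<lambda>q. f q - g q) q = pd_x f q - pd_x g q"
  using pd_eqI(1,2)[OF has_derivative_diff[OF has_derivative_pd[OF assms(1,3,4)] has_derivative_pd[OF assms(2,3,4)]]]
  by (simp_all add: algebra_simps)

lemma pd_inverse:
  assumes "smooth_on f D" "open D" "q \<in> D" "f q \<noteq> 0"
  shows "pd_t (\<lambda>q. inverse (f q)) q = - pd_t f q / (f q)\<^sup>2" "pd_x (\<lambda>q. inverse (f q)) q = - pd_x f q / (f q)\<^sup>2"
  using pd_eqI(1,2)[OF Deriv.has_derivative_inverse[OF assms(4) has_derivative_pd[OF assms(1-3)]]]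
  by (simp_all add: power2_eq_square divide_inverse)

lemma pd_cong:
  assumes "open D" "q \<in> D" "\<And>q. q \<in> D \<Longrightarrow> f q = g q" "smooth_on f D"
  shows "pd_t f q = pd_t g q" "pd_x f q = pd_x g q"
  using pd_eqI(1,2)[OF smooth_on_has_derivative[OF assms(4,2)]]
    pd_eqI(1,2)[OF smooth_on_has_derivative[OF smooth_on_cong[OF assms(4,1,3)] assms(2)]]
    frechet_derivative_cong_open[OF assms(1,2), of f g] assms(3) by simp_all

section \<open>Base transformations \<open>t' = T(t)\<close>, \<open>x' = X(t, x)\<close>\<close>

locale FP_transf =
  fixes T :: "real \<Rightarrow> real" and X :: "real \<times> real \<Rightarrow> real" and I D
  assumes I: "open I" and D: "open D" and DI: "\<And>q. q \<in> D \<Longrightarrow> fst q \<in> I"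
    and T: "smooth_on T I" and X: "smooth_on X D"
    and nz: "\<And>q. q \<in> D \<Longrightarrow> deriv T (fst q) \<noteq> 0" "\<And>q. q \<in> D \<Longrightarrow> pd_x X q \<noteq> 0"
begin

abbreviation tau :: "real \<times> real \<Rightarrow> real" where "tau q \<equiv> deriv T (fst q)"

definition base :: "real \<times> real \<Rightarrow> real \<times> real" where "base q = (T (fst q), X q)"

lemma smooth_T: "smooth_on (\<lambda>q. T (fst q)) D" "smooth_on tau D"
  by (rule smooth_on_compose[OF T I D], auto intro!: smooth D DI)
     (rule smooth_on_compose[OF smooth_on_deriv(1)[OF T I] I D], auto intro!: smooth D DI)

lemma pd_T:
  assumes "q \<in> D"
  shows "pd_t (\<lambda>q. T (fst q)) q = tau q" "pd_x (\<lambda>q. T (fst q)) q = 0" "pd_x tau q = 0"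
proof -
  have "((\<lambda>q. T (fst q)) has_derivative (\<lambda>v. tau q * fst v)) (at q)"
    using has_derivative_compose[OF has_derivative_fst[OF has_derivative_ident]
        smooth_on_deriv(2)[OF T I DI[OF assms], unfolded has_field_derivative_def]] by simp
  from pd_eqI(1,2)[OF this] show "pd_t (\<lambda>q. T (fst q)) q = tau q" "pd_x (\<lambda>q. T (fst q)) q = 0" by auto
  have "(tau has_derivative (\<lambda>v. deriv (deriv T) (fst q) * fst v)) (at q)"
    using has_derivative_compose[OF has_derivative_fst[OF has_derivative_ident]
        smooth_on_deriv(2)[OF smooth_on_deriv(1)[OF T I] I DI[OF assms], unfolded has_field_derivative_def]] by simp
  from pd_eqI(2)[OF this] show "pd_x tau q = 0" by auto
qed

text \<open>As \<open>T\<close> is free of \<open>x\<close>, the Jacobian is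
  \<open>T_t * X_x\<close> and the linear system for the new derivatives is triangular: the new
  \<open>x\<close>-derivative is found alone and then enters the new
  \<open>t\<close>-derivative.\<close>

lemma prol:
  assumes "jet_tx z \<in> D"
  shows "prol_t (\<lambda>w. T (fst (jet_tx w))) (\<lambda>w. X (jet_tx w)) F z =
      (total_t F z - pd_t X (jet_tx z) * (total_x F z / pd_x X (jet_tx z))) / tau (jet_tx z)"
    and "prol_x (\<lambda>w. T (fst (jet_tx w))) (\<lambda>w. X (jet_tx w)) F z = total_x F z / pd_x X (jet_tx z)"
  using prol_base[OF smooth_T(1) X D assms] pd_T[OF assms] nz[OF assms]
  by (simp_all add: field_simps)

lemma smooth_base: "smooth_on base D"
  unfolding base_def[abs_def] by (intro smooth D smooth_T X)

lemma has_derivative_base: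
  assumes "q \<in> D"
  shows "(base has_derivative (\<lambda>v. (tau q * fst v, pd_t X q * fst v + pd_x X q * snd v))) (at q)"
  unfolding base_def[abs_def]
  using has_derivative_Pair[OF has_derivative_pd[OF smooth_T(1) D assms] has_derivative_pd[OF X D assms]]
  by (simp add: pd_T[OF assms])

lemma pd_x_pullback:
  assumes "smooth_on A V" "open V" "q \<in> D" "base q \<in> V"
  shows "pd_x (\<lambda>q. A (base q)) q = pd_x A (base q) * pd_x X q"
  using pd_eqI(2)[OF has_derivative_compose[OF has_derivative_base[OF assms(3)] has_derivative_pd[OF assms(1,2,4)]]]
  by simp

end

section \<open>The explicit transformations belong to the group\<close>

context FP_transf
begin

text \<open>The Jacobian matrix of the base map is lower triangular with diagonal
  \<open>T_t\<close>, \<open>X_x\<close>, hence invertible. The inverse function theorem supplies a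
  differentiable inverse; its smoothness is obtained by bootstrapping, because the entries of its
  derivative are smooth functions composed with the inverse itself.\<close>

lemma base_local_inverse:
  assumes q0: "q0 \<in> D"
  obtains U V g where "open U" "q0 \<in> U" "U \<subseteq> D" "open V" "smooth_on g V"
    "\<And>q. q \<in> U \<Longrightarrow> base q \<in> V \<and> g (base q) = q" "\<And>y. y \<in> V \<Longrightarrow> g y \<in> U \<and> base (g y) = y"
proof -
  \<comment> \<open>Operators for the three possibly nonzero matrix entries. Written as a
    combination of fixed operators, the derivative is continuous in \<open>q\<close> as soon as its
    scalar coefficients are.\<close>
  define L1 L2 L3 :: "(real \<times> real) \<Rightarrow>\<^sub>L (real \<times> real)"
    where "L1 = Blinfun (\<lambda>v. (fst v, 0))" and "L2 = Blinfun (\<lambda>v. (0, fst v))" and "L3 = Blinfun (\<lambda>v. (0, snd v))"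
  have L: "blinfun_apply L1 v = (fst v, 0)" "blinfun_apply L2 v = (0, fst v)" "blinfun_apply L3 v = (0, snd v)" for v
    unfolding L1_def L2_def L3_def
    by (subst bounded_linear_Blinfun_apply; auto intro!: bounded_linear_intros)+
  define f' where "f' q = tau q *\<^sub>R L1 + pd_t X q *\<^sub>R L2 + pd_x X q *\<^sub>R L3" for q
  have f': "blinfun_apply (f' q) v = (tau q * fst v, pd_t X q * fst v + pd_x X q * snd v)" for q v
    by (simp add: f'_def blinfun.add_left blinfun.scaleR_left L)
  \<comment> \<open>Entries of the inverse of the triangular Jacobian matrix.\<close>
  define s1 s2 s3 where "s1 q = inverse (tau q)" and "s2 q = - pd_t X q * inverse (tau q) * inverse (pd_x X q)"
    and "s3 q = inverse (pd_x X q)" for q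
  have s: "smooth_on s1 D" "smooth_on s2 D" "smooth_on s3 D"
    unfolding s1_def s2_def s3_def by (auto intro!: smooth smooth_T X D nz)
  define invf where "invf = s1 q0 *\<^sub>R L1 + s2 q0 *\<^sub>R L2 + s3 q0 *\<^sub>R L3"
  have der: "(base has_derivative blinfun_apply (f' q)) (at q)" if "q \<in> D" for q
    using has_derivative_base[OF that] by (simp add: f'[abs_def])
  have cont: "continuous_on D f'"
    unfolding f'_def
    by (intro continuous_intros smooth_on_imp_continuous_on smooth_T smooth_on_pd X D)
  have invf: "blinfun_apply invf v = (s1 q0 * fst v, s2 q0 * fst v + s3 q0 * snd v)" for v
    by (simp add: invf_def blinfun.add_left blinfun.scaleR_left L)
  have "invf o\<^sub>L f' q0 = id_blinfun"
    by (rule blinfun_eqI)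
       (use nz[OF q0] in \<open>simp add: f' invf s1_def s2_def s3_def field_simps prod_eq_iff\<close>)
  from inverse_function_theorem[OF D der cont q0 this]
  obtain U V g g' where g: "open U" "U \<subseteq> D" "q0 \<in> U" "open V" "base q0 \<in> V" "homeomorphism U V base g"
    and g': "\<And>y. y \<in> V \<Longrightarrow> (g has_derivative (g' y)) (at y)"
    and inv: "\<And>y. y \<in> V \<Longrightarrow> g' y = inv (blinfun_apply (f' (g y)))"
    and bij: "\<And>y. y \<in> V \<Longrightarrow> bij (blinfun_apply (f' (g y)))" by metis
  have gU: "g y \<in> U" if "y \<in> V" for y using g(6) that by (auto simp: homeomorphism_def)
  have g'_eq: "g' y v = (fst v * s1 (g y), fst v * s2 (g y) + snd v * s3 (g y))" if "y \<in> V" for y v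
  proof -
    have "g y \<in> D" using gU[OF that] g by auto
    then show ?thesis unfolding inv[OF that]
      by (intro inv_f_eq[OF bij_is_inj[OF bij[OF that]]])
         (auto simp: f' s1_def s2_def s3_def nz field_simps prod_eq_iff)
  qed
  have "Ck_on k g V" for k
  proof (induction k)
    case 0
    then show ?case using g(6) by (simp add: homeomorphism_def)
  next
    case (Suc k)
    have c: "Ck_on k (\<lambda>y. f (g y)) V" if "smooth_on f D" for f :: "real \<times> real \<Rightarrow> real"
      by (rule Ck_on_compose[OF g(4) D _ _ Suc]) (use gU g(2) that in \<open>auto simp: smooth_on_def\<close>)
    show ?case
    proof (rule Ck_on_SucI[OF g(4) g'])
      fix v
      have "Ck_on k (\<lambda>y. (fst v * s1 (g y), fst v * s2 (g y) + snd v * s3 (g y))) V"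
        by (intro Ck_on_Pair Ck_on_add Ck_on_bilinear[OF bounded_bilinear_mult] Ck_on_const c s g)
      then show "Ck_on k (\<lambda>p. g' p v) V"
        by (rule Ck_on_cong[OF _ g(4)]) (simp add: g'_eq)
    qed
  qed
  then have "smooth_on g V" by (simp add: smooth_on_def)
  moreover have "base q \<in> V \<and> g (base q) = q" if "q \<in> U" for q
    using g(6) that by (auto simp: homeomorphism_def)
  moreover have "g y \<in> U \<and> base (g y) = y" if "y \<in> V" for y
    using g(6) that by (auto simp: homeomorphism_def)
  ultimately show thesis using that g by metis
qed

end

text \<open>Restricts a diffeomorphism between \<open>M\<close> and \<open>M'\<close> to a smaller
  open set on which \<open>\<Phi>\<close> agrees with it. The image is open because it is the
  preimage of \<open>N\<close> under the inverse map.\<close>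

lemma diffeo_onI:
  assumes "open M" "open M'" "smooth_on f M" "smooth_on g M'"
    and f: "\<And>p. p \<in> M \<Longrightarrow> f p \<in> M' \<and> g (f p) = p" and g: "\<And>y. y \<in> M' \<Longrightarrow> g y \<in> M \<and> f (g y) = y"
    and N: "open N" "N \<subseteq> M" "\<And>p. p \<in> N \<Longrightarrow> \<Phi> p = f p"
  shows "diffeo_on \<Phi> N"
proof -
  have im: "\<Phi> ` N = M' \<inter> g -` N"
    using assms by (force simp: image_iff)
  have "open (\<Phi> ` N)"
    unfolding im
    using continuous_on_open_vimage[OF assms(2), of g] smooth_on_imp_continuous_on[OF assms(4)] N(1)
    by (metis Int_commute)
  moreover have "smooth_on g (\<Phi> ` N)" using smooth_on_subset[OF assms(4)] im by blast
  moreover have "g (\<Phi> p) = p" if "p \<in> N" for p using that f N by auto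
  moreover have "smooth_on \<Phi> N"
    using smooth_on_cong[OF smooth_on_subset[OF assms(3) N(2)] N(1)] N(3) by auto
  ultimately show ?thesis unfolding diffeo_on_def by blast
qed

section \<open>The second prolongation in explicit form\<close>

abbreviation jet_utt :: "jet2 \<Rightarrow> real" where "jet_utt z \<equiv> fst (snd (snd (snd z)))"
abbreviation jet_utx :: "jet2 \<Rightarrow> real" where "jet_utx z \<equiv> fst (snd (snd (snd (snd z))))"
abbreviation jet_uxx :: "jet2 \<Rightarrow> real" where "jet_uxx z \<equiv> snd (snd (snd (snd (snd z))))"

locale FP_conv = FP_transf +
  fixes c :: real
  assumes c: "c \<noteq> 0"
begin

text \<open>Coefficients of the first prolongation of \<open>U = c * u / X_x\<close>: the new
  \<open>u_x\<close> is \<open>r * u + k * u_x\<close> and the new \<open>u_t\<close> is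
  \<open>al * u + be * u_t + ga * u_x\<close>. \<open>S\<close> and \<open>G\<close> name the
  reciprocals of \<open>T_t\<close> and \<open>X_x\<close>, which keeps denominators out of the
  algebra.\<close>

definition "m = pd_x X"
definition "n = pd_t X"
definition "S q = inverse (tau q)"
definition "G q = inverse (m q)"
definition "r q = c * (G q * pd_x G q)"
definition "k q = c * (G q * G q)"
definition "al q = S q * (c * pd_t G q - n q * r q)"
definition "be q = c * (S q * G q)"
definition "ga q = - (S q * (n q * k q))"

lemma nzs: "q \<in> D \<Longrightarrow> m q \<noteq> 0" "q \<in> D \<Longrightarrow> S q \<noteq> 0" "q \<in> D \<Longrightarrow> G q \<noteq> 0" "q \<in> D \<Longrightarrow> k q \<noteq> 0"
  "q \<in> D \<Longrightarrow> be q \<noteq> 0"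
  using nz c by (auto simp: m_def S_def G_def k_def be_def)

lemma smooth_coeffs:
  "smooth_on m D" "smooth_on n D" "smooth_on S D" "smooth_on G D" "smooth_on r D" "smooth_on k D"
  "smooth_on al D" "smooth_on be D" "smooth_on ga D"
proof -
  show m: "smooth_on m D" and n: "smooth_on n D" unfolding m_def n_def by (intro smooth X D)+
  show S: "smooth_on S D" unfolding S_def[abs_def] by (intro smooth smooth_T D nz)
  show G: "smooth_on G D" unfolding G_def[abs_def] by (intro smooth m D nzs)
  show r: "smooth_on r D" unfolding r_def[abs_def] by (intro smooth G D)
  show k: "smooth_on k D" unfolding k_def[abs_def] by (intro smooth G D)
  show "smooth_on al D" unfolding al_def[abs_def] by (intro smooth G r n S D)
  show "smooth_on be D" unfolding be_def[abs_def] by (intro smooth G S D)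
  show "smooth_on ga D" unfolding ga_def[abs_def] by (intro smooth k S n D)
qed

abbreviation "Tj \<equiv> \<lambda>w. T (fst (jet_tx w))"
abbreviation "Xj \<equiv> \<lambda>w. X (jet_tx w)"
abbreviation "Uj \<equiv> \<lambda>w. c / pd_x X (jet_tx w) * jet_u w"

definition zero :: "real \<times> real \<Rightarrow> real" where "zero q = 0"

lemma zero: "smooth_on zero D" "pd_x zero q = 0" "pd_t zero q = 0"
proof -
  show "smooth_on zero D" unfolding zero_def[abs_def] using D by (rule smooth)
  show "pd_x zero q = 0" "pd_t zero q = 0"
    by (cases q; simp add: pd_x_def pd_t_def zero_def)+
qed

lemma Uj_eq: "Uj = lin_jet (\<lambda>q. c * G q) zero zero"
  by (simp add: fun_eq_iff lin_jet_def zero_def G_def m_def divide_inverse)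

lemma pd_const_mult:
  assumes "smooth_on f D" "q \<in> D"
  shows "pd_t (\<lambda>q. a * f q) q = a * pd_t f q" "pd_x (\<lambda>q. a * f q) q = a * pd_x f q"
  using pd_eqI(1,2)[OF has_derivative_mult_right[OF has_derivative_pd[OF assms(1) D assms(2)]]] by simp_all

lemma prol_first:
  assumes "jet_tx z \<in> D"
  shows "prol_x Tj Xj Uj z = lin_jet r zero k z" "prol_t Tj Xj Uj z = lin_jet al be ga z"
proof -
  have sm: "smooth_on (\<lambda>q. c * G q) D" by (intro smooth smooth_coeffs D)
  obtain t x u ut ux utt utx uxx where z: "z = ((t, x), u, (ut, ux), (utt, utx, uxx))"
    by (cases z rule: contact_plane.cases)
  have q: "(t, x) \<in> D" using assms by (simp add: z jet_tx_def)
  note tot = total_lin_jet[OF sm zero(1) zero(1) D q, of u ut ux utt utx uxx, folded z Uj_eq]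
  have "total_x Uj z * inverse (pd_x X (t, x)) = lin_jet r zero k z"
    unfolding tot pd_const_mult[OF smooth_coeffs(4) q] zero
    by (simp add: z lin_jet_def jet_tx_def jet_u_def zero_def r_def k_def G_def m_def algebra_simps)
  then show x: "prol_x Tj Xj Uj z = lin_jet r zero k z"
    using prol(2)[OF assms] by (simp add: z jet_tx_def divide_inverse)
  have "(total_t Uj z - n (t, x) * lin_jet r zero k z) * S (t, x) = lin_jet al be ga z"
    unfolding tot pd_const_mult[OF smooth_coeffs(4) q] zero
    by (simp add: z lin_jet_def jet_tx_def jet_u_def zero_def al_def be_def ga_def algebra_simps)
  then show "prol_t Tj Xj Uj z = lin_jet al be ga z"
    unfolding prol(1)[OF assms] prol(2)[OF assms, symmetric] x
    by (simp add: z jet_tx_def divide_inverse S_def n_def)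
qed

text \<open>With the two functions below and \<open>expl\<close>, this writes the second
  prolongation as a map linear in \<open>u\<close> and its derivatives, with coefficients depending
  on \<open>(t, x)\<close>. It is triangular in a suitable order of the coordinates and can
  therefore be inverted by hand.\<close>

definition expl_utx :: "jet2 \<Rightarrow> real" where
  "expl_utx w = G (jet_tx w) * (lin_jet (pd_x al) (pd_x be) (\<lambda>q. al q + pd_x ga q) w
     + be (jet_tx w) * jet_utx w + ga (jet_tx w) * jet_uxx w)"

definition expl_uxx :: "jet2 \<Rightarrow> real" where
  "expl_uxx w = G (jet_tx w) * (lin_jet (pd_x r) zero (\<lambda>q. r q + pd_x k q) w + k (jet_tx w) * jet_uxx w)"

definition expl_utt :: "jet2 \<Rightarrow> real" where
  "expl_utt w = S (jet_tx w) * (lin_jet (pd_t al) (\<lambda>q. al q + pd_t be q) (pd_t ga) w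
     + be (jet_tx w) * jet_utt w + ga (jet_tx w) * jet_utx w - n (jet_tx w) * expl_utx w)"

definition expl :: "jet2 \<Rightarrow> jet2" where
  "expl w = (base (jet_tx w), c * G (jet_tx w) * jet_u w, (lin_jet al be ga w, lin_jet r zero k w),
     (expl_utt w, expl_utx w, expl_uxx w))"

lemma total_first:
  assumes "jet_tx z \<in> D"
  shows "total_x (lin_jet r zero k) z = pd_x X (jet_tx z) * expl_uxx z"
    "total_x (lin_jet al be ga) z = pd_x X (jet_tx z) * expl_utx z"
    "total_t (lin_jet al be ga) z = tau (jet_tx z) * expl_utt z + n (jet_tx z) * expl_utx z"
proof -
  obtain t x u ut ux utt utx uxx where z: "z = ((t, x), u, (ut, ux), (utt, utx, uxx))"
    by (cases z rule: contact_plane.cases)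
  have q: "(t, x) \<in> D" using assms by (simp add: z jet_tx_def)
  have G: "pd_x X (t, x) * (G (t, x) * y) = y" for y
    using nz(2)[OF q] by (simp add: G_def m_def)
  have S: "deriv T t * (S (t, x) * y) = y" for y
    using nz(1)[OF q] by (simp add: S_def)
  show "total_x (lin_jet r zero k) z = pd_x X (jet_tx z) * expl_uxx z"
    "total_x (lin_jet al be ga) z = pd_x X (jet_tx z) * expl_utx z"
    unfolding z total_lin_jet[OF smooth_coeffs(5) zero(1) smooth_coeffs(6) D q]
      total_lin_jet[OF smooth_coeffs(7-9) D q]
    by (simp_all add: expl_uxx_def expl_utx_def jet_tx_def jet_u_def lin_jet_def zero_def zero G algebra_simps)
  have "deriv T t * expl_utt z = total_t (lin_jet al be ga) z - n (jet_tx z) * expl_utx z"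
    unfolding z total_lin_jet[OF smooth_coeffs(7-9) D q] expl_utt_def
    by (simp add: jet_tx_def S) (simp add: lin_jet_def jet_tx_def jet_u_def algebra_simps)
  then show "total_t (lin_jet al be ga) z = tau (jet_tx z) * expl_utt z + n (jet_tx z) * expl_utx z"
    by (simp add: z jet_tx_def)
qed

lemma prolong2_eq_expl:
  assumes "jet_tx z \<in> D"
  shows "prolong2 Tj Xj Uj z = expl z"
proof -
  have 1: "prol_t Tj Xj (prol_t Tj Xj Uj) z = prol_t Tj Xj (lin_jet al be ga) z"
    "prol_x Tj Xj (prol_t Tj Xj Uj) z = prol_x Tj Xj (lin_jet al be ga) z"
    "prol_x Tj Xj (prol_x Tj Xj Uj) z = prol_x Tj Xj (lin_jet r zero k) z"
    by (rule prol_cong[OF open_jet_tx_vimage[OF D] _ refl refl], use assms in simp, rule prol_first, simp)+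
  have 2: "prol_t Tj Xj (lin_jet al be ga) z = expl_utt z" "prol_x Tj Xj (lin_jet al be ga) z = expl_utx z"
    "prol_x Tj Xj (lin_jet r zero k) z = expl_uxx z"
    unfolding prol[OF assms] total_first[OF assms] using nz[OF assms] by (simp_all add: n_def)
  show ?thesis unfolding prolong2_def 1 2 prol_first[OF assms] expl_def
    by (simp add: base_def G_def m_def divide_inverse)
qed

end

section \<open>Smoothness, contact condition and inverse of the prolonged map\<close>

lemma smooth_on_lin_jet:
  assumes "smooth_on f D" "smooth_on g D" "smooth_on h D" "open D"
  shows "smooth_on (lin_jet f g h) {w. jet_tx w \<in> D}"
proof -
  note o = open_jet_tx_vimage[OF assms(4)]
  have c: "smooth_on (\<lambda>w. f (jet_tx w)) {w. jet_tx w \<in> D}" if "smooth_on f D" for f :: "real \<times> real \<Rightarrow> real"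
    by (rule smooth_on_compose[OF that assms(4) o]) (auto simp: jet_tx_def intro!: smooth o[unfolded jet_tx_def])
  show ?thesis unfolding lin_jet_def[abs_def] jet_u_def
    by (intro smooth o c assms)
qed

text \<open>On the contact plane \<open>du\<close>, \<open>du_t\<close> and \<open>du_x\<close> are
  combinations of \<open>dt\<close> and \<open>dx\<close>; substituting them into the differential
  produces the total derivatives.\<close>

lemma lin_jet_contact:
  assumes "smooth_on f D" "smooth_on g D" "smooth_on h D" "open D" "jet_tx z \<in> D"
    and "(lin_jet f g h has_derivative E) (at z)" "v \<in> contact_plane z"
  shows "E v = total_t (lin_jet f g h) z * fst (fst v) + total_x (lin_jet f g h) z * snd (fst v)"
proof -
  note d = has_derivative_lin_jet[OF assms(1-5)]
  show ?thesis
    unfolding total_eqI[OF d] has_derivative_unique[OF assms(6) d]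
    using assms(7)
    by (cases z rule: contact_plane.cases; cases v rule: contact_plane.cases)
       (auto simp: contact_plane_iff algebra_simps jet_u_def)
qed

context FP_conv
begin

abbreviation "DJ \<equiv> {w. jet_tx w \<in> D}"

lemma smooth_jet_tx_compose:
  "smooth_on f D \<Longrightarrow> smooth_on (\<lambda>w. f (jet_tx w)) DJ" for f :: "real \<times> real \<Rightarrow> 'b::real_normed_vector"
  by (rule smooth_on_compose[OF _ D open_jet_tx_vimage[OF D]])
     (auto simp: jet_tx_def intro!: smooth open_jet_tx_vimage[OF D, unfolded jet_tx_def])

lemma smooth_expl: "smooth_on expl DJ"
proof -
  note o = open_jet_tx_vimage[OF D]
  note l = smooth_on_lin_jet[OF _ _ _ D]
  note s = smooth_coeffs zero(1) smooth_coeffs[THEN smooth_on_pd(1)[OF _ D]] smooth_coeffs[THEN smooth_on_pd(2)[OF _ D]]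
  have utx: "smooth_on expl_utx DJ" unfolding expl_utx_def[abs_def]
    by (intro smooth o smooth_jet_tx_compose l s D)
  have uxx: "smooth_on expl_uxx DJ" unfolding expl_uxx_def[abs_def]
    by (intro smooth o smooth_jet_tx_compose l s D)
  have utt: "smooth_on expl_utt DJ" unfolding expl_utt_def[abs_def]
    by (intro smooth o smooth_jet_tx_compose l s D utx)
  show ?thesis unfolding expl_def[abs_def] jet_u_def
    by (intro smooth o smooth_jet_tx_compose l s D utx uxx utt smooth_base)
qed

text \<open>\<open>prolong2\<close> takes the new mixed derivative from the new \<open>u_t\<close>,
  whereas the contact form of the new \<open>u_x\<close> also needs \<open>D_t\<close> of the new
  \<open>u_x\<close>. The agreement rests on the symmetry of the mixed partials of \<open>X\<close>
  and of \<open>1 / X_x\<close>.\<close>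

lemma total_commute:
  assumes "jet_tx z \<in> D"
  shows "total_t (lin_jet r zero k) z = tau (jet_tx z) * expl_utx z + n (jet_tx z) * expl_uxx z"
proof -
  obtain t x u ut ux utt utx uxx where z: "z = ((t, x), u, (ut, ux), (utt, utx, uxx))"
    by (cases z rule: contact_plane.cases)
  define q where "q = (t, x)"
  have q: "q \<in> D" using assms by (simp add: z jet_tx_def q_def)
  note s = smooth_coeffs smooth_T
  note sp = smooth_coeffs[THEN smooth_on_pd(1)[OF _ D]] smooth_coeffs[THEN smooth_on_pd(2)[OF _ D]]
  \<comment> \<open>The definitions of the coefficients with denominators cleared; these products
    are differentiated instead of quotients.\<close>
  have e: "tau q * al q = c * pd_t G q - n q * r q" "tau q * be q = c * G q" "tau q * ga q = - (n q * k q)"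
    "m q * r q = c * pd_x G q" "m q * k q = c * G q" if "q \<in> D" for q
    using nz[OF that] by (simp_all add: al_def be_def ga_def r_def k_def S_def G_def m_def)
  have e1: "tau q * pd_x al q = c * pd_x (pd_t G) q - (n q * pd_x r q + pd_x n q * r q)"
    using pd_cong(2)[OF D q e(1) smooth_on_mult[OF D s(11) s(7)]]
    by (simp add: pd_mult[OF s(11) s(7) D q] pd_T[OF q]
      pd_diff[OF smooth_on_mult[OF D smooth_on_const[OF D] sp(4)] smooth_on_mult[OF D s(2) s(5)] D q]
      pd_mult[OF s(2) s(5) D q] pd_const_mult[OF sp(4) q])
  have e2: "tau q * pd_x be q = c * pd_x G q"
    using pd_cong(2)[OF D q e(2) smooth_on_mult[OF D s(11) s(8)]]
    by (simp add: pd_mult[OF s(11) s(8) D q] pd_T[OF q] pd_const_mult[OF s(4) q])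
  have e3: "tau q * pd_x ga q = - (n q * pd_x k q + pd_x n q * k q)"
  proof -
    have "pd_x (\<lambda>q. - (n q * k q)) q = - pd_x (\<lambda>q. n q * k q) q"
      using pd_const_mult(2)[OF smooth_on_mult[OF D s(2) s(6)] q, of "-1"] by simp
    then show ?thesis
      using pd_cong(2)[OF D q e(3) smooth_on_mult[OF D s(11) s(9)]]
      by (simp add: pd_mult[OF s(11) s(9) D q] pd_T[OF q] pd_mult[OF s(2) s(6) D q])
  qed
  have mn: "pd_t m q = pd_x n q" unfolding m_def n_def by (rule pd_commute[OF X D q])
  have e4: "m q * pd_t r q + pd_x n q * r q = c * pd_x (pd_t G) q"
    using pd_cong(1)[OF D q e(4) smooth_on_mult[OF D s(1) s(5)]]
    by (simp add: pd_mult[OF s(1) s(5) D q] pd_const_mult[OF sp(13) q] mn pd_commute[OF s(4) D q])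
  have e5: "m q * pd_t k q + pd_x n q * k q = c * pd_t G q"
    using pd_cong(1)[OF D q e(5) smooth_on_mult[OF D s(1) s(6)]]
    by (simp add: pd_mult[OF s(1) s(6) D q] pd_const_mult[OF s(4) q] mn)
  note eq = e[OF q] e1 e2 e3 e4 e5
  let ?P = "total_x (lin_jet al be ga) z" and ?Q = "total_x (lin_jet r zero k) z" and ?R = "total_t (lin_jet r zero k) z"
  have tot: "?P = pd_x al q * u + al q * ux + pd_x be q * ut + be q * utx + pd_x ga q * ux + ga q * uxx"
    "?Q = pd_x r q * u + r q * ux + pd_x k q * ux + k q * uxx"
    "?R = pd_t r q * u + r q * ut + pd_t k q * ux + k q * utx"
    using q unfolding z q_def
    by (simp_all add: total_lin_jet[OF smooth_coeffs(5) zero(1) smooth_coeffs(6) D]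
      total_lin_jet[OF smooth_coeffs(7-9) D] zero zero_def)
  have "m q * ?R = tau q * ?P + n q * ?Q"
  proof -
    have "tau q * ?P + n q * ?Q = (tau q * pd_x al q + n q * pd_x r q) * u + (tau q * pd_x be q) * ut
      + (tau q * al q + tau q * pd_x ga q + n q * r q + n q * pd_x k q) * ux
      + (tau q * be q) * utx + (tau q * ga q + n q * k q) * uxx"
      unfolding tot by (simp add: algebra_simps)
    also have "\<dots> = (m q * pd_t r q) * u + (m q * r q) * ut + (m q * pd_t k q) * ux + (m q * k q) * utx"
    proof -
      have 1: "tau q * pd_x al q + n q * pd_x r q = m q * pd_t r q" using eq by linarith
      have 2: "tau q * pd_x be q = m q * r q" using eq by linarith
      have 3: "tau q * al q + tau q * pd_x ga q + n q * r q + n q * pd_x k q = m q * pd_t k q" using eq by linarith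
      have 4: "tau q * be q = m q * k q" "tau q * ga q + n q * k q = 0" using eq by linarith+
      show ?thesis unfolding 1 2 3 4 by simp
    qed
    finally show ?thesis unfolding tot by (simp add: algebra_simps)
  qed
  also have qz: "q = jet_tx z" by (simp add: z q_def jet_tx_def)
  then have "tau q * ?P + n q * ?Q = m q * (tau q * expl_utx z + n q * expl_uxx z)"
    using total_first(1,2)[OF assms] by (simp add: m_def algebra_simps)
  finally show ?thesis using nzs(1)[OF q] unfolding qz by simp
qed

text \<open>For a vector of the contact plane all components of order at most one are determined by
  \<open>dt\<close> and \<open>dx\<close>. The three contact conditions at the target thus reduce to
  the prolongation formulas and, for the \<open>t\<close>-part of the last one, to
  \<open>total_commute\<close>.\<close>

lemma expl_contact:
  assumes "jet_tx z \<in> D" "(expl has_derivative E) (at z)" "v \<in> contact_plane z"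
  shows "E v \<in> contact_plane (expl z)"
proof -
  have base: "((\<lambda>w. base (jet_tx w)) has_derivative (\<lambda>v. fst (E v))) (at z)"
    using has_derivative_fst[OF assms(2)] by (simp add: expl_def)
  have U: "(Uj has_derivative (\<lambda>v. fst (snd (E v)))) (at z)"
    using has_derivative_fst[OF has_derivative_snd[OF assms(2)]] by (simp add: expl_def G_def m_def divide_inverse)
  have P: "(lin_jet al be ga has_derivative (\<lambda>v. jet_ut (E v))) (at z)"
    using has_derivative_fst[OF has_derivative_fst[OF has_derivative_snd[OF has_derivative_snd[OF assms(2)]]]]
    by (simp add: expl_def)
  have Q: "(lin_jet r zero k has_derivative (\<lambda>v. jet_ux (E v))) (at z)"
    using has_derivative_snd[OF has_derivative_fst[OF has_derivative_snd[OF has_derivative_snd[OF assms(2)]]]]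
    by (simp add: expl_def)
  have base': "((\<lambda>w. base (jet_tx w)) has_derivative
      (\<lambda>v. (tau (jet_tx z) * fst (fst v), n (jet_tx z) * fst (fst v) + m (jet_tx z) * snd (fst v)))) (at z)"
    using has_derivative_compose[OF has_derivative_jet_tx has_derivative_base[OF assms(1)]]
    by (simp add: n_def m_def jet_tx_def)
  have 1: "fst (E v) = (tau (jet_tx z) * fst (fst v), n (jet_tx z) * fst (fst v) + m (jet_tx z) * snd (fst v))"
    using fun_cong[OF has_derivative_unique[OF base base'], of v] .
  have 2: "jet_ut (E v) = total_t (lin_jet al be ga) z * fst (fst v) + total_x (lin_jet al be ga) z * snd (fst v)"
    by (rule lin_jet_contact[OF smooth_coeffs(7-9) D assms(1) P assms(3)])
  have 3: "jet_ux (E v) = total_t (lin_jet r zero k) z * fst (fst v) + total_x (lin_jet r zero k) z * snd (fst v)"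
    by (rule lin_jet_contact[OF smooth_coeffs(5) zero(1) smooth_coeffs(6) D assms(1) Q assms(3)])
  have 4: "fst (snd (E v)) = total_t Uj z * fst (fst v) + total_x Uj z * snd (fst v)"
    using lin_jet_contact[OF smooth_on_mult[OF D smooth_on_const[OF D] smooth_coeffs(4)] zero(1) zero(1) D assms(1) _ assms(3)] U
    unfolding Uj_eq by blast
  have 5: "total_x Uj z = m (jet_tx z) * lin_jet r zero k z"
    "total_t Uj z = tau (jet_tx z) * lin_jet al be ga z + n (jet_tx z) * lin_jet r zero k z"
    unfolding prol_first[OF assms(1), symmetric] prol[OF assms(1)]
    using nz[OF assms(1)] by (simp_all add: m_def n_def)
  have 6: "jet_ut (expl z) = lin_jet al be ga z" "jet_ux (expl z) = lin_jet r zero k z" "jet_utt (expl z) = expl_utt z"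
    "jet_utx (expl z) = expl_utx z" "jet_uxx (expl z) = expl_uxx z" by (simp_all add: expl_def)
  show ?thesis
    unfolding contact_plane_iff 1 2 3 4 5 6 fst_conv snd_conv total_first[OF assms(1)] total_commute[OF assms(1)] m_def
    by (intro conjI; algebra)
qed

definition full :: "ext \<Rightarrow> ext" where
  "full p = (let q = jet_tx (fst p) in (expl (fst p),
     (S q * (m q)\<^sup>2 * fst (snd p), S q * (m q * snd (snd p) - n q - pd_x m q * fst (snd p)))))"

text \<open>Once the base map is inverted, the old \<open>u\<close>, \<open>u_x\<close>,
  \<open>u_t\<close>, \<open>u_xx\<close>, \<open>u_tx\<close>, \<open>u_tt\<close>,
  \<open>A\<close> and \<open>B\<close> can be recovered in this order by dividing by nowhere
  vanishing coefficients. The inverse is explicit and visibly smooth.\<close>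

lemma full_diffeo:
  assumes N: "open N" "p \<in> N" "\<And>p. p \<in> N \<Longrightarrow> jet_tx (fst p) \<in> D"
    and \<Phi>: "\<And>p. p \<in> N \<Longrightarrow> \<Phi> p = full p"
  shows "\<exists>N'. open N' \<and> p \<in> N' \<and> N' \<subseteq> N \<and> diffeo_on \<Phi> N'"
proof -
  obtain Q V g where Q: "open Q" "jet_tx (fst p) \<in> Q" "Q \<subseteq> D" "open V" and g: "smooth_on g V"
    and inv: "\<And>q. q \<in> Q \<Longrightarrow> base q \<in> V \<and> g (base q) = q" "\<And>y. y \<in> V \<Longrightarrow> g y \<in> Q \<and> base (g y) = y"
    by (rule base_local_inverse[OF N(3)[OF N(2)]]) blast
  define M M' :: "ext set" where "M = {p. fst (fst p) \<in> Q}" and "M' = {y. fst (fst y) \<in> V}"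
  have M: "open M" "open M'"
    unfolding M_def M'_def using Q
    by (auto intro!: open_vimage[unfolded vimage_def, of _ "\<lambda>p. fst (fst p)"] continuous_intros)
  have sg: "smooth_on (\<lambda>y. g (fst (fst y))) M'"
    by (rule smooth_on_compose[OF g Q(4) M(2)]) (auto intro!: smooth M(2)[unfolded M'_def] simp: M'_def)
  have cg: "smooth_on (\<lambda>y. f (g (fst (fst y)))) M'" if "smooth_on f D" for f :: "real \<times> real \<Rightarrow> real"
    by (rule smooth_on_compose[OF that D M(2) sg]) (use inv Q in \<open>auto simp: M'_def\<close>)
  have nz': "m (g (fst (fst y))) \<noteq> 0" "S (g (fst (fst y))) \<noteq> 0" "G (g (fst (fst y))) \<noteq> 0"
    "k (g (fst (fst y))) \<noteq> 0" "be (g (fst (fst y))) \<noteq> 0" if "y \<in> M'" for y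
    using inv(2)[of "fst (fst y)"] that Q(3) nzs[of "g (fst (fst y))"] by (auto simp: M'_def)
  define bq where "bq y = g (fst (fst y))" for y :: ext
  define bu where "bu y = fst (snd (fst y)) / (c * G (bq y))" for y
  define bux where "bux y = (jet_ux (fst y) - r (bq y) * bu y) / k (bq y)" for y
  define but where "but y = (jet_ut (fst y) - al (bq y) * bu y - ga (bq y) * bux y) / be (bq y)" for y
  define buxx where "buxx y = (jet_uxx (fst y) / G (bq y)
      - (pd_x r (bq y) * bu y + (r (bq y) + pd_x k (bq y)) * bux y)) / k (bq y)" for y
  define butx where "butx y = (jet_utx (fst y) / G (bq y)
      - (pd_x al (bq y) * bu y + pd_x be (bq y) * but y + (al (bq y) + pd_x ga (bq y)) * bux y)
      - ga (bq y) * buxx y) / be (bq y)" for y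
  \<comment> \<open>The term with \<open>n\<close> uses the new mixed derivative, which is a
    coordinate of \<open>y\<close>, instead of reassembling it from old ones.\<close>
  define butt where "butt y = (jet_utt (fst y) / S (bq y)
      - (pd_t al (bq y) * bu y + (al (bq y) + pd_t be (bq y)) * but y + pd_t ga (bq y) * bux y)
      - ga (bq y) * butx y + n (bq y) * jet_utx (fst y)) / be (bq y)" for y
  define ba where "ba y = fst (snd y) / (S (bq y) * (m (bq y))\<^sup>2)" for y
  define bb where "bb y = (snd (snd y) / S (bq y) + n (bq y) + pd_x m (bq y) * ba y) / m (bq y)" for y
  define bck :: "ext \<Rightarrow> ext" where "bck y = ((bq y, bu y, (but y, bux y), (butt y, butx y, buxx y)), (ba y, bb y))" for y
  note s = smooth_coeffs smooth_coeffs[THEN smooth_on_pd(1)[OF _ D]] smooth_coeffs[THEN smooth_on_pd(2)[OF _ D]]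
  note cg' = cg[folded bq_def] and nzq = nz'[folded bq_def]
  have nzc: "c * G (bq y) \<noteq> 0" "S (bq y) * (m (bq y))\<^sup>2 \<noteq> 0" if "y \<in> M'" for y
    using c nzq[OF that] by auto
  have sbq: "smooth_on bq M'" unfolding bq_def[abs_def] by (rule sg)
  have su: "smooth_on bu M'" unfolding bu_def by (intro smooth M cg' s nzc)
  have sux: "smooth_on bux M'" unfolding bux_def[abs_def] by (intro smooth M cg' s nzq su)
  have sut: "smooth_on but M'" unfolding but_def[abs_def] by (intro smooth M cg' s nzq su sux)
  have suxx: "smooth_on buxx M'" unfolding buxx_def[abs_def] by (intro smooth M cg' s nzq su sux)
  have sutx: "smooth_on butx M'" unfolding butx_def[abs_def] by (intro smooth M cg' s nzq su sux sut suxx)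
  have sutt: "smooth_on butt M'" unfolding butt_def[abs_def] by (intro smooth M cg' s nzq su sux sut sutx)
  have sa: "smooth_on ba M'" unfolding ba_def[abs_def] by (intro smooth M cg' s nzc)
  have sb: "smooth_on bb M'" unfolding bb_def[abs_def] by (intro smooth M cg' s nzq sa)
  have sback: "smooth_on bck M'"
    unfolding bck_def[abs_def] by (intro smooth M sbq su sux sut suxx sutx sutt sa sb)
  have sfull: "smooth_on full M"
  proof -
    have id: "smooth_on (\<lambda>p::ext. fst p) M" by (intro smooth M)
    have e: "smooth_on (\<lambda>p. expl (fst p)) M"
      by (rule smooth_on_compose[OF smooth_expl open_jet_tx_vimage[OF D] M(1) id]) (use Q in \<open>auto simp: M_def jet_tx_def\<close>)
    have cc: "smooth_on (\<lambda>p. f (fst (fst p))) M" if "smooth_on f D" for f :: "real \<times> real \<Rightarrow> real"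
      by (rule smooth_on_compose[OF that D M(1)]) (use Q in \<open>auto simp: M_def intro!: smooth M(1)[unfolded M_def]\<close>)
    show ?thesis unfolding full_def[abs_def] Let_def jet_tx_def by (intro smooth M e cc s)
  qed
  have bf: "full p \<in> M' \<and> bck (full p) = p" if "p \<in> M" for p
  proof -
    obtain q u ut ux utt utx uxx a b where p: "p = ((q, u, (ut, ux), (utt, utx, uxx)), (a, b))"
      by (metis surj_pair)
    have q: "q \<in> Q" "q \<in> D" using that Q by (auto simp: p M_def)
    have bq: "bq (full p) = q" using inv(1)[OF q(1)] by (simp add: bq_def p full_def expl_def jet_tx_def)
    note nq = nzs[OF q(2)]
    note d = p full_def Let_def expl_def jet_tx_def lin_jet_def zero_def jet_u_def
    have u: "bu (full p) = u" unfolding bu_def bq using nq c by (simp add: d)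
    have ux: "bux (full p) = ux" unfolding bux_def bq u using nq by (simp add: d)
    have ut: "but (full p) = ut" unfolding but_def bq u ux using nq by (simp add: d)
    have uxx: "buxx (full p) = uxx" unfolding buxx_def bq u ux using nq by (simp add: d expl_uxx_def)
    have utx: "butx (full p) = utx" unfolding butx_def bq u ux ut uxx using nq by (simp add: d expl_utx_def)
    have utt: "butt (full p) = utt" unfolding butt_def bq u ux ut utx using nq by (simp add: d expl_utt_def)
    have a: "ba (full p) = a" unfolding ba_def bq using nq by (simp add: d)
    have b: "bb (full p) = b" unfolding bb_def bq a using nq by (simp add: d)
    have "full p \<in> M'" using inv(1)[OF q(1)] by (simp add: M'_def d)
    then show ?thesis unfolding bck_def bq u ux ut uxx utx utt a b by (simp add: p)
  qed
  have fb: "bck y \<in> M \<and> full (bck y) = y" if "y \<in> M'" for y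
  proof -
    have q: "bq y \<in> Q" "base (bq y) = fst (fst y)" using that inv(2)[of "fst (fst y)"] by (auto simp: M'_def bq_def)
    then have qD: "bq y \<in> D" using Q by auto
    note nq = nzs[OF qD]
    note d = full_def Let_def expl_def jet_tx_def lin_jet_def zero_def jet_u_def
    have u: "c * G (bq y) * bu y = fst (snd (fst y))" using nq c by (simp add: bu_def)
    have ux: "r (bq y) * bu y + k (bq y) * bux y = jet_ux (fst y)" using nq by (simp add: bux_def)
    have ut: "al (bq y) * bu y + be (bq y) * but y + ga (bq y) * bux y = jet_ut (fst y)" using nq by (simp add: but_def)
    have uxx: "G (bq y) * (pd_x r (bq y) * bu y + (r (bq y) + pd_x k (bq y)) * bux y + k (bq y) * buxx y) = jet_uxx (fst y)"
      using nq by (simp add: buxx_def)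
    have utx: "G (bq y) * (pd_x al (bq y) * bu y + pd_x be (bq y) * but y + (al (bq y) + pd_x ga (bq y)) * bux y
        + be (bq y) * butx y + ga (bq y) * buxx y) = jet_utx (fst y)"
      using nq by (simp add: butx_def)
    have utt: "S (bq y) * (pd_t al (bq y) * bu y + (al (bq y) + pd_t be (bq y)) * but y + pd_t ga (bq y) * bux y
        + be (bq y) * butt y + ga (bq y) * butx y - n (bq y) * jet_utx (fst y)) = jet_utt (fst y)"
      using nq by (simp add: butt_def)
    have a: "S (bq y) * (m (bq y))\<^sup>2 * ba y = fst (snd y)" using nq by (simp add: ba_def)
    have b: "S (bq y) * (m (bq y) * bb y - n (bq y) - pd_x m (bq y) * ba y) = snd (snd y)" using nq by (simp add: bb_def)
    have "full (bck y) = y"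
      using u ux ut uxx utx utt a b q(2)
      by (simp add: d bck_def expl_uxx_def expl_utx_def expl_utt_def prod_eq_iff)
    then show ?thesis using q(1) by (simp add: M_def bck_def)
  qed
  show ?thesis
  proof (intro exI[of _ "N \<inter> M"] conjI)
    show "diffeo_on \<Phi> (N \<inter> M)"
      by (rule diffeo_onI[OF M sfull sback bf fb]) (use N(1) M \<Phi> in auto)
    show "p \<in> N \<inter> M" using N Q by (auto simp: M_def jet_tx_def)
  qed (use N M in auto)
qed

end

section \<open>The transformed equation\<close>

lemma pd_x_eqI:
  "((\<lambda>y. f (t, y)) has_real_derivative d) (at x) \<Longrightarrow> pd_x f (t, x) = d"
  by (simp add: pd_x_def DERIV_imp_deriv)

text \<open>The difference of the two sides of the new equation, with numbers in place of functions:
  \<open>g\<close> is \<open>1 / X_x\<close>, \<open>s\<close> is \<open>1 / T_t\<close>, and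
  \<open>mx\<close>, \<open>mxx\<close>, \<open>nx\<close> stand for \<open>X_xx\<close>,
  \<open>X_xxx\<close>, \<open>X_tx\<close>. In this form it is a polynomial identity modulo
  \<open>m * g = 1\<close>, free of divisions.\<close>

lemma FP_transform_identity:
  fixes c s g m mx mxx n nx A Ax Axx B Bx u ut ux uxx :: real
  assumes "m * g = 1"
  defines "r \<equiv> - c * mx * g ^ 3" and "rx \<equiv> - c * (mxx * g ^ 3 - 3 * mx\<^sup>2 * g ^ 4)" and "k \<equiv> c * g\<^sup>2"
    and "kx \<equiv> - 2 * c * mx * g ^ 3"
  shows "s * (- c * nx * g\<^sup>2 - n * r) * u + c * s * g * ut - s * n * k * ux -
     (g * s * (2 * mxx * A + 3 * mx * Ax + m * Axx) * (c * g * u)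
      + 2 * (s * (2 * mx * A + m * Ax)) * (r * u + k * ux)
      + s * m\<^sup>2 * A * (g * (rx * u + (r + kx) * ux + k * uxx))
      + g * s * (mx * B + m * Bx - nx - (mxx * A + mx * Ax)) * (c * g * u)
      + s * (m * B - n - mx * A) * (r * u + k * ux))
    = c * s * g * (ut - (Axx * u + 2 * Ax * ux + A * uxx + Bx * u + B * ux))"
  unfolding r_def rx_def k_def kx_def using assms(1) by algebra

context FP_conv
begin

text \<open>The defect of the new equation is the old one times \<open>c * S * G\<close>, which
  vanishes nowhere, so both equations hold at corresponding jets. The work lies in expressing the
  derivatives of \<open>A'\<close> and \<open>B'\<close> at \<open>base q\<close> through those of
  \<open>A\<close>, \<open>B\<close> and \<open>X\<close>.\<close>

lemma FP_eq_transform: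
  assumes eq: "FP_coeffs D0 A B" "FP_coeffs V A' B'" and U: "open U" "U \<subseteq> D" "U \<subseteq> D0"
    and A': "\<And>q. q \<in> U \<Longrightarrow> base q \<in> V \<and> A' (base q) = S q * (m q)\<^sup>2 * A q \<and>
      B' (base q) = S q * (m q * B q - n q - pd_x m q * A q)"
    and w: "jet_tx w \<in> U"
  shows "w \<in> FP_eq D0 A B \<longleftrightarrow> expl w \<in> FP_eq V A' B'"
proof -
  note sub = smooth_on_subset[OF _ U(2)] smooth_on_subset[OF _ U(3)]
  have sm: "smooth_on m U" "smooth_on n U" "smooth_on A U" "smooth_on B U" "smooth_on G U" "smooth_on k U"
    using sub smooth_coeffs eq(1) by (auto simp: FP_coeffs_def)
  have V: "open V" "smooth_on A' V" "smooth_on B' V" using eq(2) by (auto simp: FP_coeffs_def)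
  have S: "S (t, y) = inverse (deriv T t)" for t y by (simp add: S_def)
  note dx = has_real_derivative_pd(2)[OF _ U(1)]
  have Gx: "pd_x G q = - pd_x m q * (G q)\<^sup>2" and Gt: "pd_t G q = - pd_x n q * (G q)\<^sup>2" if "q \<in> U" for q
    using pd_inverse[OF smooth_coeffs(1) D _ nzs(1), of q] that U pd_commute[OF X D, of q]
    by (auto simp: G_def[abs_def] m_def n_def divide_inverse power_inverse)
  have rG: "r q = - c * pd_x m q * (G q) ^ 3" if "q \<in> U" for q
    using Gx[OF that] by (simp add: r_def power2_eq_square power3_eq_cube)
  have pull: "pd_x f (base q) = G q * d" if "smooth_on f V" "q \<in> U" "q = (t, x)"
    "((\<lambda>y. h (t, y)) has_real_derivative d) (at x)" "\<And>q. q \<in> U \<Longrightarrow> f (base q) = h q"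
    "smooth_on h U" for f h q t x d
  \<comment> \<open>Because \<open>T\<close> is free of \<open>x\<close>, differentiating the
    pull-back of \<open>f\<close> in \<open>x\<close> yields \<open>X_x\<close> times the
    \<open>x\<close>-derivative of \<open>f\<close>. Hence derivatives of the new coefficients are
    read off from their pull-backs, at the cost of a factor \<open>G\<close>.\<close>
  proof -
    have "pd_x (\<lambda>q. f (base q)) q = d"
      using pd_cong(2)[OF U(1) that(2), of h "\<lambda>q. f (base q)"] that(5,6) pd_x_eqI[of h t, OF that(4)] that(3) by simp
    moreover have "pd_x (\<lambda>q. f (base q)) q = pd_x f (base q) * m q"
      using pd_x_pullback[OF that(1) V(1), of q] A'[OF that(2)] that(2) U by (auto simp: m_def)
    ultimately show ?thesis using nzs[of q] that(2) U by (auto simp: G_def)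
  qed
  have sS: "smooth_on S U" using sub(1) smooth_coeffs by auto
  have A'x: "pd_x A' (base q) = S q * (2 * pd_x m q * A q + m q * pd_x A q)" if q: "q \<in> U" for q
  proof -
    obtain t x where tx: "q = (t, x)" by (cases q)
    note d = dx[OF _ q[unfolded tx]]
    have "((\<lambda>y. S (t, y) * (m (t, y))\<^sup>2 * A (t, y)) has_real_derivative
        m q * (S q * (2 * pd_x m q * A q + m q * pd_x A q))) (at x)"
      unfolding S tx by (auto intro!: derivative_eq_intros d sm simp: power2_eq_square algebra_simps)
    moreover have "smooth_on (\<lambda>q. S q * (m q)\<^sup>2 * A q) U" by (intro smooth U sS sm)
    ultimately have "pd_x A' (base q) = G q * (m q * (S q * (2 * pd_x m q * A q + m q * pd_x A q)))"
      using pull[where h="\<lambda>q. S q * (m q)\<^sup>2 * A q", OF V(2) q tx] A' by simp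
    then show ?thesis using nzs(1)[of q] q U by (auto simp: G_def)
  qed
  obtain t x u ut ux utt utx uxx where wz: "w = ((t, x), u, (ut, ux), (utt, utx, uxx))"
    by (cases w rule: contact_plane.cases)
  define q where "q = (t, x)"
  have q: "q \<in> U" using w by (simp add: wz q_def jet_tx_def)
  note d = dx[OF _ q[unfolded q_def]]
  have mG: "m q * G q = 1" using nzs(1)[of q] q U by (auto simp: G_def)
  have A'xx: "pd_x (pd_x A') (base q) = G q * S q * (2 * pd_x (pd_x m) q * A q + 3 * pd_x m q * pd_x A q + m q * pd_x (pd_x A) q)"
  proof -
    have "((\<lambda>y. S (t, y) * (2 * pd_x m (t, y) * A (t, y) + m (t, y) * pd_x A (t, y))) has_real_derivative
        S q * (2 * pd_x (pd_x m) q * A q + 3 * pd_x m q * pd_x A q + m q * pd_x (pd_x A) q)) (at x)"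
      unfolding S q_def by (auto intro!: derivative_eq_intros d sm smooth U(1) simp: algebra_simps)
    moreover have "smooth_on (\<lambda>q. S q * (2 * pd_x m q * A q + m q * pd_x A q)) U" by (intro smooth U sS sm)
    ultimately have "pd_x (pd_x A') (base q) = G q * (S q * (2 * pd_x (pd_x m) q * A q + 3 * pd_x m q * pd_x A q + m q * pd_x (pd_x A) q))"
      using pull[where h="\<lambda>q. S q * (2 * pd_x m q * A q + m q * pd_x A q)", OF smooth_on_pd(2)[OF V(2,1)] q q_def _ A'x]  by simp
    then show ?thesis by simp
  qed
  have B'x: "pd_x B' (base q) = G q * S q * (pd_x m q * B q + m q * pd_x B q - pd_x n q - (pd_x (pd_x m) q * A q + pd_x m q * pd_x A q))"
  proof -
    have "((\<lambda>y. S (t, y) * (m (t, y) * B (t, y) - n (t, y) - pd_x m (t, y) * A (t, y))) has_real_derivative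
        S q * (pd_x m q * B q + m q * pd_x B q - pd_x n q - (pd_x (pd_x m) q * A q + pd_x m q * pd_x A q))) (at x)"
      unfolding S q_def by (auto intro!: derivative_eq_intros d sm smooth U(1) simp: algebra_simps)
    moreover have "smooth_on (\<lambda>q. S q * (m q * B q - n q - pd_x m q * A q)) U" by (intro smooth U sS sm)
    ultimately have "pd_x B' (base q) = G q * (S q * (pd_x m q * B q + m q * pd_x B q - pd_x n q - (pd_x (pd_x m) q * A q + pd_x m q * pd_x A q)))"
      using pull[where h="\<lambda>q. S q * (m q * B q - n q - pd_x m q * A q)", OF V(3) q q_def] A' by simp
    then show ?thesis by simp
  qed
  have kx: "pd_x k q = - 2 * c * pd_x m q * (G q) ^ 3"
  proof -
    have "((\<lambda>y. k (t, y)) has_real_derivative - 2 * c * pd_x m q * (G q) ^ 3) (at x)"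
      unfolding k_def using Gx[OF q, unfolded q_def]
      by (auto intro!: derivative_eq_intros d sm simp: q_def power2_eq_square power3_eq_cube algebra_simps)
    from pd_x_eqI[of k t, OF this] show ?thesis by (simp add: q_def)
  qed
  have rx: "pd_x r q = - c * (pd_x (pd_x m) q * (G q) ^ 3 - 3 * (pd_x m q)\<^sup>2 * (G q) ^ 4)"
  proof -
    have "((\<lambda>y. - c * pd_x m (t, y) * (G (t, y)) ^ 3) has_real_derivative
        - c * (pd_x (pd_x m) q * (G q) ^ 3 - 3 * (pd_x m q)\<^sup>2 * (G q) ^ 4)) (at x)"
      by (auto intro!: derivative_eq_intros d sm smooth U(1) simp: Gx[OF q] q_def[symmetric])
         (simp add: power2_eq_square power3_eq_cube power4_eq_xxxx algebra_simps)
    from pd_x_eqI[of "\<lambda>q. - c * pd_x m q * (G q) ^ 3" t, OF this]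
      pd_cong(2)[OF U(1) q rG smooth_on_subset[OF smooth_coeffs(5) U(2)]]
    show ?thesis by (simp add: q_def)
  qed
  have bV: "base q \<in> V" and A'q: "A' (base q) = S q * (m q)\<^sup>2 * A q"
    "B' (base q) = S q * (m q * B q - n q - pd_x m q * A q)" using A'[OF q] by auto
  let ?R = "pd_x (pd_x A) q * u + 2 * pd_x A q * ux + A q * uxx + pd_x B q * u + B q * ux"
  let ?u = "c * G q * u" and ?ut = "al q * u + be q * ut + ga q * ux" and ?ux = "r q * u + k q * ux"
  let ?uxx = "G q * (pd_x r q * u + (r q + pd_x k q) * ux + k q * uxx)"
  let ?R' = "pd_x (pd_x A') (base q) * ?u + 2 * pd_x A' (base q) * ?ux + A' (base q) * ?uxx + pd_x B' (base q) * ?u + B' (base q) * ?ux"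
  have "?ut - ?R' = c * S q * G q * (ut - ?R)"
    using FP_transform_identity[OF mG, where c=c and s="S q" and mx="pd_x m q" and mxx="pd_x (pd_x m) q" and n="n q"
        and nx="pd_x n q" and A="A q" and Ax="pd_x A q" and Axx="pd_x (pd_x A) q" and B="B q" and Bx="pd_x B q"
        and u=u and ut=ut and ux=ux and uxx=uxx]
    unfolding A'x[OF q] A'xx B'x A'q kx[symmetric] rx[symmetric] rG[OF q, symmetric]
    by (simp add: al_def be_def ga_def k_def Gt[OF q] power2_eq_square algebra_simps)
  then have "?ut = ?R' \<longleftrightarrow> ut = ?R"
    using nzs(2,3)[of q] q U c by auto
  moreover have "w \<in> FP_eq D0 A B \<longleftrightarrow> ut = ?R"
    unfolding wz FP_eq_iff[OF eq(1)] using q U by (auto simp: q_def)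
  moreover have "expl w \<in> FP_eq V A' B' \<longleftrightarrow> ?ut = ?R'"
  proof -
    have e: "expl w = ((fst (base q), snd (base q)), ?u, (?ut, ?ux), (expl_utt w, expl_utx w, ?uxx))"
      by (simp add: expl_def expl_uxx_def lin_jet_def wz q_def jet_tx_def jet_u_def zero_def)
    show ?thesis unfolding e FP_eq_iff[OF eq(2)] using bV by simp
  qed
  ultimately show ?thesis by simp
qed

end

section \<open>Preservation of the class\<close>

definition maps_FP_at where
  "maps_FP_at W \<Phi> D A B D' A' B' w \<longleftrightarrow> jet_tx w \<in> D \<and> (w, (A (jet_tx w), B (jet_tx w))) \<in> W \<and>
     (let p = \<Phi> (w, (A (jet_tx w), B (jet_tx w))); q = jet_tx (fst p) in
       q \<in> D' \<and> snd p = (A' q, B' q) \<and> (w \<in> FP_eq D A B \<longleftrightarrow> fst p \<in> FP_eq D' A' B'))"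

lemma preserves_FP_class_iff:
  "preserves_FP_class \<Phi> W \<longleftrightarrow>
     (\<forall>D A B z. FP_coeffs D A B \<and> jet_tx z \<in> D \<and> (z, (A (jet_tx z), B (jet_tx z))) \<in> W \<longrightarrow>
        (\<exists>N D' A' B'. open N \<and> z \<in> N \<and> FP_coeffs D' A' B' \<and> (\<forall>w\<in>N. maps_FP_at W \<Phi> D A B D' A' B' w)))"
  unfolding preserves_FP_class_def maps_FP_at_def by (simp add: case_prod_unfold Let_def prod_eq_iff)

lemma open_graph_vimage:
  assumes "open D" "smooth_on A D" "smooth_on B D" "open N"
  shows "open {w. jet_tx w \<in> D \<and> (w, (A (jet_tx w), B (jet_tx w))) \<in> N}"
proof -
  note o = open_jet_tx_vimage[OF assms(1)]
  have "continuous_on {w. jet_tx w \<in> D} (\<lambda>w. (w, (A (jet_tx w), B (jet_tx w))))"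
    by (intro continuous_intros continuous_on_compose2[OF smooth_on_imp_continuous_on[OF assms(2)]]
        continuous_on_compose2[OF smooth_on_imp_continuous_on[OF assms(3)]])
       (auto simp: jet_tx_def intro!: continuous_intros)
  from continuous_open_preimage[OF this o assms(4)] show ?thesis
    by (simp add: vimage_def Int_def)
qed

context FP_conv
begin

text \<open>The new coefficients are the transformed old ones transported by the local inverse
  \<open>g\<close> of the base map. Their domain \<open>V'\<close> is cut down so that
  \<open>g\<close> leads back into the domain of \<open>A\<close> and \<open>B\<close>.\<close>

lemma full_preserves:
  assumes N: "open N" "N \<subseteq> W" "\<And>p. p \<in> N \<Longrightarrow> jet_tx (fst p) \<in> D"
    and \<Phi>: "\<And>p. p \<in> N \<Longrightarrow> \<Phi> p = full p"
    and AB: "FP_coeffs D0 A B" and z: "jet_tx z \<in> D0" "(z, (A (jet_tx z), B (jet_tx z))) \<in> N"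
  shows "\<exists>N D' A' B'. open N \<and> z \<in> N \<and> FP_coeffs D' A' B' \<and> (\<forall>w\<in>N. maps_FP_at W \<Phi> D0 A B D' A' B' w)"
proof -
  have ab: "open D0" "smooth_on A D0" "smooth_on B D0" "\<And>q. q \<in> D0 \<Longrightarrow> A q \<noteq> 0" using AB by (auto simp: FP_coeffs_def)
  have zD: "jet_tx z \<in> D" using N(3)[OF z(2)] by simp
  obtain Q V g where Q: "open Q" "jet_tx z \<in> Q" "Q \<subseteq> D" "open V" and g: "smooth_on g V"
    and inv: "\<And>q. q \<in> Q \<Longrightarrow> base q \<in> V \<and> g (base q) = q" "\<And>y. y \<in> V \<Longrightarrow> g y \<in> Q \<and> base (g y) = y"
    by (rule base_local_inverse[OF zD]) blast
  define U where "U = Q \<inter> D0"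
  have U: "open U" "jet_tx z \<in> U" "U \<subseteq> D" "U \<subseteq> D0" using Q ab z by (auto simp: U_def)
  define V' where "V' = V \<inter> g -` U"
  have V': "open V'" unfolding V'_def
    by (rule continuous_open_preimage[OF smooth_on_imp_continuous_on[OF g] Q(4) U(1)])
  define A' where "A' y = S (g y) * (m (g y))\<^sup>2 * A (g y)" for y
  define B' where "B' y = S (g y) * (m (g y) * B (g y) - n (g y) - pd_x m (g y) * A (g y))" for y
  have gV: "smooth_on g V'" "\<And>y. y \<in> V' \<Longrightarrow> g y \<in> U" using smooth_on_subset[OF g] by (auto simp: V'_def)
  have cg: "smooth_on (\<lambda>y. f (g y)) V'" if "smooth_on f D \<or> smooth_on f D0" for f :: "real \<times> real \<Rightarrow> real"
  proof -
    have "smooth_on f U" using that smooth_on_subset U by metis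
    from smooth_on_compose[OF this U(1) V' gV] show ?thesis by simp
  qed
  note c = cg[OF disjI1] cg[OF disjI2]
  have sA: "smooth_on A' V'" unfolding A'_def[abs_def]
    by (intro smooth V' c(1)[OF smooth_coeffs(1)] c(1)[OF smooth_coeffs(3)] c(2)[OF ab(2)])
  have sB: "smooth_on B' V'" unfolding B'_def[abs_def]
    by (intro smooth V' c(1)[OF smooth_coeffs(1)] c(1)[OF smooth_coeffs(2)] c(1)[OF smooth_coeffs(3)]
      c(1)[OF smooth_on_pd(2)[OF smooth_coeffs(1) D]] c(2)[OF ab(2)] c(2)[OF ab(3)])
  have nzA: "A' y \<noteq> 0" if "y \<in> V'" for y
    using gV(2)[OF that] U nzs[of "g y"] ab(4)[of "g y"] by (auto simp: A'_def)
  have FP': "FP_coeffs V' A' B'" using V' sA sB nzA by (auto simp: FP_coeffs_def)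
  have bU: "base q \<in> V' \<and> g (base q) = q" if "q \<in> U" for q
    using inv(1)[of q] that by (auto simp: V'_def U_def)
  have tr: "w \<in> FP_eq D0 A B \<longleftrightarrow> expl w \<in> FP_eq V' A' B'" if "jet_tx w \<in> U" for w
    by (rule FP_eq_transform[OF AB FP' U(1,3,4) _ that]) (simp add: A'_def B'_def bU)
  define M where "M = {w. jet_tx w \<in> U \<and> (w, (A (jet_tx w), B (jet_tx w))) \<in> N}"
  have "open M" unfolding M_def
    by (rule open_graph_vimage[OF U(1) _ _ N(1)]) (use ab U smooth_on_subset in blast)+
  moreover have "z \<in> M" using U z by (simp add: M_def)
  moreover have "maps_FP_at W \<Phi> D0 A B V' A' B' w" if "w \<in> M" for w
  proof -
    have w: "jet_tx w \<in> U" "(w, (A (jet_tx w), B (jet_tx w))) \<in> N" using that by (auto simp: M_def)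
    have e: "jet_tx (expl w) = base (jet_tx w)" by (simp add: expl_def jet_tx_def)
    have 1: "A' (base (jet_tx w)) = S (jet_tx w) * (m (jet_tx w))\<^sup>2 * A (jet_tx w)"
      "B' (base (jet_tx w)) = S (jet_tx w) * (m (jet_tx w) * B (jet_tx w) - n (jet_tx w) - pd_x m (jet_tx w) * A (jet_tx w))"
      unfolding A'_def B'_def using bU[OF w(1)] by simp_all
    have 2: "jet_tx w \<in> D0" "(w, (A (jet_tx w), B (jet_tx w))) \<in> W" "base (jet_tx w) \<in> V'"
      using w U(4) N(2) bU[OF w(1)] by blast+
    show ?thesis
      unfolding maps_FP_at_def \<Phi>[OF w(2)] full_def Let_def fst_conv snd_conv e 1 using 2 tr[OF w(1)] by simp
  qed
  ultimately show ?thesis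
    using FP' by (intro exI[of _ M] exI[of _ V'] exI[of _ A'] exI[of _ B'] conjI ballI) simp_all
qed

end

section \<open>From the explicit form to membership in the group\<close>

lemma projectable_on_congI:
  assumes "\<And>p. p \<in> N \<Longrightarrow> \<pi> (\<Phi> p) = \<phi> (\<pi> p)"
  shows "projectable_on \<pi> \<Phi> N"
  using assms unfolding projectable_on_def by blast

lemma projectable_on_subset: "projectable_on \<pi> \<Phi> N \<Longrightarrow> M \<subseteq> N \<Longrightarrow> projectable_on \<pi> \<Phi> M"
  unfolding projectable_on_def by blast

definition FP_form_at ::
  "real \<Rightarrow> (real \<Rightarrow> real) \<Rightarrow> (real \<times> real \<Rightarrow> real) \<Rightarrow> (ext \<Rightarrow> ext) \<Rightarrow> ext \<Rightarrow> bool" where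
  "FP_form_at c T X \<Phi> p \<longleftrightarrow> (let q = jet_tx (fst p); Tt = deriv T (fst q); Xx = pd_x X q in
     Tt * Xx \<noteq> 0 \<and>
     \<Phi> p = (prolong2 (\<lambda>w. T (fst (jet_tx w))) (\<lambda>w. X (jet_tx w)) (\<lambda>w. c / pd_x X (jet_tx w) * jet_u w) (fst p),
       (Xx\<^sup>2 / Tt * fst (snd p), Xx / Tt * snd (snd p) - (pd_t X q + pd_x (pd_x X) q * fst (snd p)) / Tt)))"

lemma FP_form_iff:
  "FP_form c T X \<Phi> N \<longleftrightarrow> smooth_on T ((\<lambda>(z, \<theta>). fst (jet_tx z)) ` N) \<and>
     smooth_on X ((\<lambda>(z, \<theta>). jet_tx z) ` N) \<and> (\<forall>p\<in>N. FP_form_at c T X \<Phi> p)"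
  by (simp add: FP_form_def FP_form_at_def Let_def case_prod_unfold)

lemma FP_form_projections:
  assumes "FP_form c T X \<Phi> N" "open N"
  defines "D \<equiv> (\<lambda>(z, \<theta>). jet_tx z) ` N" and "I \<equiv> (\<lambda>(z, \<theta>). fst (jet_tx z)) ` N"
  shows "open D" "open I" "smooth_on T I" "smooth_on X D"
proof -
  have De: "D = fst ` fst ` N" unfolding D_def jet_tx_def by (auto simp: image_image case_prod_unfold)
  have Ie: "I = fst ` D" unfolding De I_def jet_tx_def by (auto simp: image_image case_prod_unfold)
  show D: "open D" unfolding De by (intro open_image_fst assms)
  show "open I" unfolding Ie by (intro open_image_fst D)
  show "smooth_on T I" "smooth_on X D" using assms(1) unfolding FP_form_iff D_def I_def by blast+
qed

lemma FP_form_FP_conv: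
  assumes form: "FP_form c T X \<Phi> N" and N: "open N" and c: "c \<noteq> 0"
  defines "D \<equiv> (\<lambda>(z, \<theta>). jet_tx z) ` N" and "I \<equiv> (\<lambda>(z, \<theta>). fst (jet_tx z)) ` N"
  shows "FP_conv T X I D c" "p \<in> N \<Longrightarrow> jet_tx (fst p) \<in> D" "p \<in> N \<Longrightarrow> \<Phi> p = FP_conv.full T X c p"
proof -
  note pr = FP_form_projections[OF form N, folded D_def I_def]
  have Ie: "I = fst ` D" unfolding D_def I_def by (auto simp: image_image case_prod_unfold)
  have f: "FP_form_at c T X \<Phi> p" if "p \<in> N" for p
    using form that by (simp add: FP_form_iff)
  have nz: "deriv T (fst q) \<noteq> 0 \<and> pd_x X q \<noteq> 0" if "q \<in> D" for q
    using that f unfolding D_def FP_form_at_def Let_def by fastforce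
  show conv: "FP_conv T X I D c"
    by unfold_locales (use pr nz c in \<open>auto simp: Ie\<close>)
  interpret FP_conv T X I D c by (rule conv)
  show pD: "jet_tx (fst p) \<in> D" if "p \<in> N" for p using that unfolding D_def by (auto simp: case_prod_unfold)
  show "\<Phi> p = full p" if "p \<in> N" for p
  proof -
    have "\<Phi> p = (prolong2 Tj Xj Uj (fst p), snd (\<Phi> p))"
      using f[OF that] by (simp add: FP_form_at_def Let_def)
    also have "\<dots> = full p"
      unfolding prolong2_eq_expl[OF pD[OF that]] full_def using f[OF that]
      by (simp add: FP_form_at_def Let_def S_def m_def n_def divide_inverse algebra_simps)
    finally show ?thesis .
  qed
qed

text \<open>All three conditions are local, so each can be verified on a neighbourhood where
  \<open>\<Phi>\<close> coincides with the map \<open>full\<close>.\<close>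

lemma FP_form_imp_equivalence_group:
  assumes W: "open W" and c: "c \<noteq> 0"
    and form: "\<And>p. p \<in> W \<Longrightarrow> \<exists>N. open N \<and> p \<in> N \<and> N \<subseteq> W \<and> (\<exists>T X. FP_form c T X \<Phi> N)"
  shows "\<Phi> \<in> FP_equivalence_group W"
  unfolding FP_equivalence_group_def
proof (intro CollectI conjI)
  show "point_transformation \<Phi> W"
    unfolding point_transformation_def
  proof
    fix p assume "p \<in> W"
    from form[OF this] obtain N T X where N: "open N" "p \<in> N" "N \<subseteq> W" and f: "FP_form c T X \<Phi> N" by blast
    note F = FP_form_FP_conv[OF f N(1) c]
    interpret FP_conv T X "(\<lambda>(z, \<theta>). fst (jet_tx z)) ` N" "(\<lambda>(z, \<theta>). jet_tx z) ` N" c by (rule F(1))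
    have "projectable_on (\<lambda>(z, \<theta>). jet_txu z) \<Phi> N"
      by (rule projectable_on_congI[where \<phi>="\<lambda>(q, u). (base q, c * G q * u)"])
         (auto simp: F(3) full_def Let_def expl_def jet_txu_def jet_tx_def jet_u_def)
    moreover have "projectable_on (\<lambda>(z, \<theta>). z) \<Phi> N"
      by (rule projectable_on_congI[where \<phi>=expl]) (auto simp: F(3) full_def Let_def)
    moreover obtain N' where "open N'" "p \<in> N'" "N' \<subseteq> N" "diffeo_on \<Phi> N'"
      using full_diffeo[OF N(1,2) F(2,3)] by blast
    ultimately show "\<exists>N. open N \<and> p \<in> N \<and> N \<subseteq> W \<and> diffeo_on \<Phi> N \<and>
        projectable_on (\<lambda>(z, \<theta>). jet_txu z) \<Phi> N \<and> projectable_on (\<lambda>(z, \<theta>). z) \<Phi> N"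
      using N(3) projectable_on_subset by (meson order.trans)
  qed
  show "contact_consistent \<Phi> W"
    unfolding contact_consistent_def
  proof (intro ballI allI impI)
    fix p v :: ext assume p: "p \<in> W" and v: "fst v \<in> contact_plane (fst p)"
    from form[OF p] obtain N T X where N: "open N" "p \<in> N" "N \<subseteq> W" and f: "FP_form c T X \<Phi> N" by blast
    note F = FP_form_FP_conv[OF f N(1) c]
    interpret FP_conv T X "(\<lambda>(z, \<theta>). fst (jet_tx z)) ` N" "(\<lambda>(z, \<theta>). jet_tx z) ` N" c by (rule F(1))
    obtain N' where N': "open N'" "p \<in> N'" "diffeo_on \<Phi> N'"
      using full_diffeo[OF N(1,2) F(2,3)] by blast
    have d: "(\<Phi> has_derivative frechet_derivative \<Phi> (at p)) (at p)"
      using N' smooth_on_has_derivative by (auto simp: diffeo_on_def)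
    have e: "(expl has_derivative frechet_derivative expl (at (fst p))) (at (fst p))"
      using smooth_on_has_derivative[OF smooth_expl] F(2)[OF N(2)] by auto
    \<comment> \<open>The jet part of \<open>full\<close> depends on the jet alone, so near
      \<open>p\<close> the jet component of the derivative of \<open>\<Phi>\<close> is the
      derivative of \<open>expl\<close>.\<close>
    have "((\<lambda>p. expl (fst p)) has_derivative (\<lambda>v. frechet_derivative expl (at (fst p)) (fst v))) (at p)"
      by (rule has_derivative_compose[OF has_derivative_fst[OF has_derivative_ident] e])
    moreover have "((\<lambda>p. expl (fst p)) has_derivative (\<lambda>v. fst (frechet_derivative \<Phi> (at p) v))) (at p)"
      by (rule has_derivative_transform_within_open[OF has_derivative_fst[OF d] N(1,2)])
         (simp add: F(3) full_def Let_def)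
    ultimately have "fst (frechet_derivative \<Phi> (at p) v) = frechet_derivative expl (at (fst p)) (fst v)"
      by (metis has_derivative_unique)
    then show "fst (frechet_derivative \<Phi> (at p) v) \<in> contact_plane (fst (\<Phi> p))"
      using expl_contact[OF F(2)[OF N(2)] e v] F(3)[OF N(2)] by (simp add: full_def Let_def)
  qed
  show "preserves_FP_class \<Phi> W"
    unfolding preserves_FP_class_iff
  proof (intro allI impI, elim conjE)
    fix D0 A B z assume AB: "FP_coeffs D0 A B" and z: "jet_tx z \<in> D0" "(z, (A (jet_tx z), B (jet_tx z))) \<in> W"
    from form[OF z(2)] obtain N T X where N: "open N" "(z, (A (jet_tx z), B (jet_tx z))) \<in> N" "N \<subseteq> W"
      and f: "FP_form c T X \<Phi> N" by blast
    note F = FP_form_FP_conv[OF f N(1) c]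
    interpret FP_conv T X "(\<lambda>(z, \<theta>). fst (jet_tx z)) ` N" "(\<lambda>(z, \<theta>). jet_tx z) ` N" c by (rule F(1))
    show "\<exists>N D' A' B'. open N \<and> z \<in> N \<and> FP_coeffs D' A' B' \<and> (\<forall>w\<in>N. maps_FP_at W \<Phi> D0 A B D' A' B' w)"
      by (rule full_preserves[OF N(1,3) F(2,3) AB z(1) N(2)])
  qed
qed

section \<open>Reduction to functions of \<open>t\<close> and \<open>x\<close>\<close>

lemma derivative_along_line:
  assumes "(f has_derivative D) (at p)"
  shows "((\<lambda>s::real. f (p + s *\<^sub>R v)) has_derivative (\<lambda>s. s *\<^sub>R D v)) (at 0)"
proof -
  have "((\<lambda>s::real. p + s *\<^sub>R v) has_derivative (\<lambda>s. s *\<^sub>R v)) (at 0)"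
    by (auto intro!: derivative_eq_intros)
  from has_derivative_compose[OF this, of f D] assms
  show ?thesis using linear_cmul[OF has_derivative_linear[OF assms]] by simp
qed

lemma derivative_zero_along_constant_line:
  assumes "(f has_derivative D) (at p)" "open N" "p \<in> N"
    and "\<And>s. p + s *\<^sub>R v \<in> N \<Longrightarrow> f (p + s *\<^sub>R v) = f p"
  shows "D v = 0"
proof -
  let ?N = "(\<lambda>s::real. p + s *\<^sub>R v) -` N"
  have "open ?N" by (rule open_vimage[OF assms(2)]) (auto intro!: continuous_intros)
  moreover have "0 \<in> ?N" using assms by simp
  ultimately have "((\<lambda>s::real. f p) has_derivative (\<lambda>s. s *\<^sub>R D v)) (at 0)"
    by (intro has_derivative_transform_within_open[OF derivative_along_line[OF assms(1)]]) (use assms(4) in auto)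
  from fun_cong[OF has_derivative_unique[OF this has_derivative_const], of 1] show ?thesis by simp
qed

section \<open>The differential of an equivalence transformation\<close>

locale FP_equiv =
  fixes \<Phi> :: "ext \<Rightarrow> ext" and W :: "ext set"
  assumes W: "open W" and W_ext: "W \<subseteq> ext_space" and group: "\<Phi> \<in> FP_equivalence_group W"
begin

lemma point: "point_transformation \<Phi> W" and contact: "contact_consistent \<Phi> W" and preserves: "preserves_FP_class \<Phi> W"
  using group by (auto simp: FP_equivalence_group_def)

definition D\<Phi> :: "ext \<Rightarrow> ext \<Rightarrow> ext" where "D\<Phi> p = frechet_derivative \<Phi> (at p)"

text \<open>The local inverse makes the derivative injective. Projectability says that the
  projection of the image is constant along the fibres, so the derivative sends vertical vectors to
  vertical vectors.\<close>

lemma deriv_facts: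
  assumes p: "p \<in> W"
  shows "(\<Phi> has_derivative D\<Phi> p) (at p)" "linear (D\<Phi> p)" "inj (D\<Phi> p)"
    and "jet_txu (fst v) = jet_txu 0 \<Longrightarrow> jet_txu (fst (D\<Phi> p v)) = jet_txu 0"
    and "fst v = 0 \<Longrightarrow> fst (D\<Phi> p v) = 0"
proof -
  obtain N where N: "open N" "p \<in> N" "diffeo_on \<Phi> N"
    and pr: "projectable_on (\<lambda>(z, \<theta>). jet_txu z) \<Phi> N" "projectable_on (\<lambda>(z, \<theta>). z) \<Phi> N"
    using point p unfolding point_transformation_def by blast
  show d: "(\<Phi> has_derivative D\<Phi> p) (at p)"
    using N smooth_on_has_derivative by (auto simp: diffeo_on_def D\<Phi>_def)
  then show lin: "linear (D\<Phi> p)" using has_derivative_linear by blast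
  obtain g where g: "open (\<Phi> ` N)" "smooth_on g (\<Phi> ` N)" "\<And>q. q \<in> N \<Longrightarrow> g (\<Phi> q) = q"
    using N by (auto simp: diffeo_on_def)
  obtain g' where "(g has_derivative g') (at (\<Phi> p))"
    using smooth_on_has_derivative[OF g(2), of "\<Phi> p"] N(2) by blast
  from has_derivative_compose[OF d this]
  have "((\<lambda>q. q) has_derivative (\<lambda>v. g' (D\<Phi> p v))) (at p)"
    by (rule has_derivative_transform_within_open[OF _ N(1,2)]) (simp add: g(3))
  from has_derivative_unique[OF this has_derivative_ident] have "g' (D\<Phi> p v) = v" for v by metis
  then show "inj (D\<Phi> p)" by (metis injI)
 have j: "linear jet_txu" "jet_txu (0::jet2) = 0"
    by (auto simp: jet_txu_def jet_tx_def jet_u_def linear_iff zero_prod_def)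
  show "jet_txu (fst (D\<Phi> p v)) = jet_txu 0" if "jet_txu (fst v) = jet_txu 0"
  proof -
    have "((\<lambda>q. jet_txu (fst (\<Phi> q))) has_derivative (\<lambda>v. jet_txu (fst (D\<Phi> p v)))) (at p)"
      by (rule has_derivative_compose[OF has_derivative_fst[OF d] has_derivative_jet_txu])
    then have "jet_txu (fst (D\<Phi> p v)) = 0"
    proof (rule derivative_zero_along_constant_line[OF _ N(1,2)])
      fix s assume s: "p + s *\<^sub>R v \<in> N"
      have "jet_txu (fst (p + s *\<^sub>R v)) = jet_txu (fst p)"
        using that linear_add[OF j(1)] linear_cmul[OF j(1)] j(2) by simp
      then show "jet_txu (fst (\<Phi> (p + s *\<^sub>R v))) = jet_txu (fst (\<Phi> p))"
        using pr(1) s N(2) unfolding projectable_on_def case_prod_unfold by metis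
    qed
    then show ?thesis using j by simp
  qed
  show "fst (D\<Phi> p v) = 0" if "fst v = 0"
  proof (rule derivative_zero_along_constant_line[OF has_derivative_fst[OF d] N(1,2)])
    fix s assume s: "p + s *\<^sub>R v \<in> N"
    obtain \<phi> where "\<And>q. q \<in> N \<Longrightarrow> fst (\<Phi> q) = \<phi> (fst q)"
      using pr(2) unfolding projectable_on_def case_prod_unfold by blast
    then show "fst (\<Phi> (p + s *\<^sub>R v)) = fst (\<Phi> p)"
      using s N(2) that by simp
  qed
qed

text \<open>Suppose \<open>w\<close> moves \<open>(t, x)\<close> while the new \<open>(t, x)\<close>
  is stationary. For each \<open>\<delta>\<close> there are affine coefficients whose graph contains
  the line through \<open>p\<close> in direction \<open>(w, \<delta>)\<close>. Along it the new
  coefficients are functions of the stationary new \<open>(t, x)\<close>, so their derivative is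
  zero for every \<open>\<delta>\<close>; comparing two values of \<open>\<delta>\<close>
  contradicts injectivity.\<close>

lemma kernel:
  assumes p: "p \<in> W" and L: "jet_tx (fst (D\<Phi> p (w, 0))) = 0"
  shows "jet_tx w = 0"
proof (rule ccontr)
  assume w: "jet_tx w \<noteq> 0"
  obtain z a b where pz: "p = (z, (a, b))" by (metis surj_pair)
  \<comment> \<open>Normalised so that the affine function with gradient \<open>e\<close> grows at
    unit rate along \<open>w\<close>.\<close>
  define e where "e = jet_tx w /\<^sub>R (jet_tx w \<bullet> jet_tx w)"
  have e: "jet_tx w \<bullet> e = 1" using w by (simp add: e_def)
  have a: "a \<noteq> 0" using W_ext p by (auto simp: pz ext_space_def)
  note d = deriv_facts[OF p]
  have fstv: "jet_tx (fst (D\<Phi> p (w, \<delta>))) = 0" for \<delta>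
  proof -
    have "D\<Phi> p (w, \<delta>) = D\<Phi> p (w, 0) + D\<Phi> p (0, \<delta>)"
      using linear_add[OF d(2), of "(w, 0)" "(0, \<delta>)"] by simp
    then show ?thesis using L d(5)[of "(0, \<delta>)"] by (simp add: jet_tx_def)
  qed
  have key: "snd (D\<Phi> p (w, \<delta>)) = 0" for \<delta>
  proof -
    define A B where "A = (\<lambda>q. a + fst \<delta> * ((q - jet_tx z) \<bullet> e))" and "B = (\<lambda>q. b + snd \<delta> * ((q - jet_tx z) \<bullet> e))"
    have sm: "smooth_on A UNIV" "smooth_on B UNIV"
      unfolding A_def B_def
      by (intro smooth smooth_on_bounded_linear[OF bounded_linear_inner_left] open_UNIV)+
    define D0 where "D0 = {q. A q \<noteq> 0}"
    have "open D0" unfolding D0_def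
      using smooth_on_imp_continuous_on[OF sm(1)] by (intro open_Collect_neq) auto
    then have FP: "FP_coeffs D0 A B"
      using smooth_on_subset[OF sm(1)] smooth_on_subset[OF sm(2)] by (auto simp: FP_coeffs_def D0_def)
    have at0: "A (jet_tx z) = a" "B (jet_tx z) = b" by (auto simp: A_def B_def)
    have "jet_tx z \<in> D0" "(z, (A (jet_tx z), B (jet_tx z))) \<in> W" using a p at0 by (auto simp: D0_def pz)
    then obtain N D' A' B' where N: "open N" "z \<in> N" "FP_coeffs D' A' B'"
      and tr: "\<And>w. w \<in> N \<Longrightarrow> maps_FP_at W \<Phi> D0 A B D' A' B' w"
      using preserves[unfolded preserves_FP_class_iff, rule_format, of D0 A B z] FP by blast
    have line: "(z + s *\<^sub>R w, (A (jet_tx (z + s *\<^sub>R w)), B (jet_tx (z + s *\<^sub>R w)))) = p + s *\<^sub>R (w, \<delta>)" for s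
      using e by (simp add: pz A_def B_def jet_tx_def prod_eq_iff)
    define C where "C y = (A' y, B' y)" for y
    have tr': "snd (\<Phi> (p + s *\<^sub>R (w, \<delta>))) = C (jet_tx (fst (\<Phi> (p + s *\<^sub>R (w, \<delta>)))))"
      if "z + s *\<^sub>R w \<in> N" for s
      using tr[OF that] unfolding maps_FP_at_def Let_def line by (simp add: C_def)
    have tr0: "jet_tx (fst (\<Phi> p)) \<in> D'" using tr[OF N(2)] by (simp add: maps_FP_at_def Let_def at0 pz)
    have "smooth_on C D'" unfolding C_def[abs_def] using N(3) by (auto simp: FP_coeffs_def intro!: smooth)
    then obtain C' where C': "(C has_derivative C') (at (jet_tx (fst (\<Phi> p))))"
      using smooth_on_has_derivative tr0 by blast
    have tx: "((\<lambda>q. jet_tx (fst (\<Phi> q))) has_derivative (\<lambda>v. jet_tx (fst (D\<Phi> p v)))) (at p)"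
      by (rule has_derivative_compose[OF has_derivative_fst[OF d(1)] has_derivative_jet_tx])
    have l1: "((\<lambda>s::real. C (jet_tx (fst (\<Phi> (p + s *\<^sub>R (w, \<delta>)))))) has_derivative
        (\<lambda>s. s *\<^sub>R C' (jet_tx (fst (D\<Phi> p (w, \<delta>)))))) (at 0)"
      by (rule derivative_along_line[OF has_derivative_compose[OF tx C']])
    have l2: "((\<lambda>s::real. snd (\<Phi> (p + s *\<^sub>R (w, \<delta>)))) has_derivative (\<lambda>s. s *\<^sub>R snd (D\<Phi> p (w, \<delta>)))) (at 0)"
      by (rule derivative_along_line[OF has_derivative_snd[OF d(1)]])
    let ?N = "(\<lambda>s::real. z + s *\<^sub>R w) -` N"
    have N': "open ?N" by (rule open_vimage[OF N(1)]) (auto intro!: continuous_intros)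
    have "0 \<in> ?N" using N by simp
    have "((\<lambda>s::real. C (jet_tx (fst (\<Phi> (p + s *\<^sub>R (w, \<delta>)))))) has_derivative (\<lambda>s. s *\<^sub>R snd (D\<Phi> p (w, \<delta>)))) (at 0)"
      by (rule has_derivative_transform_within_open[OF l2 N' \<open>0 \<in> ?N\<close>])
         (use tr' in \<open>simp del: scaleR_Pair\<close>)
    from fun_cong[OF has_derivative_unique[OF this l1], of 1]
    have "snd (D\<Phi> p (w, \<delta>)) = C' 0" by (simp add: fstv)
    then show ?thesis using linear_0[OF has_derivative_linear[OF C']] by simp
  qed
  \<comment> \<open>A pure change of \<open>A\<close> has no effect on the new coefficients by
    \<open>key\<close>, and none on the new jet by projectability.\<close>
  have "D\<Phi> p (0, (1, 0)) = D\<Phi> p (w, (1, 0)) - D\<Phi> p (w, 0)"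
    using linear_diff[OF d(2), of "(w, (1, 0))" "(w, 0)"] by simp
  then have "snd (D\<Phi> p (0, (1, 0))) = 0" using key[of "(1, 0)"] key[of 0] by simp
  then have "D\<Phi> p (0, (1, 0)) = 0" using d(5)[of "(0, (1, 0))"] by (simp add: prod_eq_iff)
  then have "D\<Phi> p (0, (1, 0)) = D\<Phi> p 0" using linear_0[OF d(2)] by simp
  from injD[OF d(3) this] show False by (simp add: zero_prod_def)
qed

definition e_t :: jet2 where "e_t = ((1, 0), 0, (0, 0), (0, 0, 0))"
definition e_x :: jet2 where "e_x = ((0, 1), 0, (0, 0), (0, 0, 0))"
definition e_u :: jet2 where "e_u = ((0, 0), 1, (0, 0), (0, 0, 0))"

text \<open>By \<open>kernel\<close>, \<open>L\<close> is injective on the span of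
  \<open>e_t\<close> and \<open>e_x\<close>, hence maps it onto the plane. A vertical
  \<open>w\<close> has the same image as some combination of these two vectors; the difference is
  killed by \<open>L\<close>, so its \<open>(t, x)\<close>-part is zero and the combination
  vanishes. For the last claim, a surjective derivative must reach the
  \<open>u\<close>-direction.\<close>

lemma jacobian:
  assumes p: "p \<in> W"
  defines "L \<equiv> \<lambda>w. jet_tx (fst (D\<Phi> p (w, 0)))"
  shows "fst (L e_t) * snd (L e_x) - fst (L e_x) * snd (L e_t) \<noteq> 0"
    and "jet_tx (fst v) = 0 \<Longrightarrow> jet_tx (fst (D\<Phi> p v)) = 0"
    and "jet_u (fst (D\<Phi> p (e_u, 0))) \<noteq> 0"
proof -
  note d = deriv_facts[OF p]
  have lin: "linear L"
    unfolding L_def linear_iff jet_tx_def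
    using linear_add[OF d(2), of "(_, 0)" "(_, 0)"] linear_cmul[OF d(2), of _ "(_, 0)"] by simp
  have k: "jet_tx w = 0" if "L w = 0" for w using kernel[OF p] that by (simp add: L_def)
  have comb: "L (\<alpha> *\<^sub>R e_t + \<beta> *\<^sub>R e_x) = \<alpha> *\<^sub>R L e_t + \<beta> *\<^sub>R L e_x" for \<alpha> \<beta>
    using linear_add[OF lin] linear_cmul[OF lin] by simp
  have tx: "jet_tx (\<alpha> *\<^sub>R e_t + \<beta> *\<^sub>R e_x) = (\<alpha>, \<beta>)" for \<alpha> \<beta> by (simp add: jet_tx_def e_t_def e_x_def)
  have indep: "\<alpha> = 0 \<and> \<beta> = 0" if "\<alpha> *\<^sub>R L e_t + \<beta> *\<^sub>R L e_x = 0" for \<alpha> \<beta>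
    using k[of "\<alpha> *\<^sub>R e_t + \<beta> *\<^sub>R e_x"] that comb tx by (simp add: zero_prod_def)
  show det: "fst (L e_t) * snd (L e_x) - fst (L e_x) * snd (L e_t) \<noteq> 0"
  proof
    assume 0: "fst (L e_t) * snd (L e_x) - fst (L e_x) * snd (L e_t) = 0"
    have "fst (L e_x) *\<^sub>R L e_t + (- fst (L e_t)) *\<^sub>R L e_x = 0" "snd (L e_x) *\<^sub>R L e_t + (- snd (L e_t)) *\<^sub>R L e_x = 0"
      using 0 by (auto simp: prod_eq_iff algebra_simps)
    then have "fst (L e_t) = 0 \<and> snd (L e_t) = 0"
      using indep[of "fst (L e_x)" "- fst (L e_t)"] indep[of "snd (L e_x)" "- snd (L e_t)"] by simp
    then have "1 *\<^sub>R L e_t + 0 *\<^sub>R L e_x = 0" by (simp add: prod_eq_iff)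
    then show False using indep[of 1 0] by simp
  qed
  have L0: "L w = 0" if "jet_tx w = 0" for w
  proof -
    let ?d = "fst (L e_t) * snd (L e_x) - fst (L e_x) * snd (L e_t)"
    \<comment> \<open>Coordinates of \<open>L w\<close> in the basis \<open>L e_t\<close>,
      \<open>L e_x\<close>, by Cramer's rule.\<close>
    define \<alpha> \<beta> where "\<alpha> = (fst (L w) * snd (L e_x) - snd (L w) * fst (L e_x)) / ?d"
      and "\<beta> = (snd (L w) * fst (L e_t) - fst (L w) * snd (L e_t)) / ?d"
    have "\<alpha> *\<^sub>R L e_t + \<beta> *\<^sub>R L e_x = L w"
      using det by (auto simp: prod_eq_iff \<alpha>_def \<beta>_def divide_simps) (simp_all add: algebra_simps)
    then have "L (w - (\<alpha> *\<^sub>R e_t + \<beta> *\<^sub>R e_x)) = 0" using linear_diff[OF lin] comb by simp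
    from k[OF this] have "(\<alpha>, \<beta>) = 0" using that tx by (simp add: jet_tx_def)
    then have "\<alpha> = 0" "\<beta> = 0" by (auto simp: zero_prod_def)
    then show ?thesis using \<open>\<alpha> *\<^sub>R L e_t + \<beta> *\<^sub>R L e_x = L w\<close> by simp
  qed
  have split: "jet_tx (fst (D\<Phi> p v)) = L (fst v)" for v
  proof -
    have "D\<Phi> p v = D\<Phi> p (fst v, 0) + D\<Phi> p (0, snd v)"
      using linear_add[OF d(2), of "(fst v, 0)" "(0, snd v)"] by simp
    then show ?thesis using d(5)[of "(0, snd v)"] by (simp add: L_def jet_tx_def)
  qed
  show "jet_tx (fst (D\<Phi> p v)) = 0" if "jet_tx (fst v) = 0" using L0[OF that] split by simp
  show "jet_u (fst (D\<Phi> p (e_u, 0))) \<noteq> 0"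
  proof
    assume 0: "jet_u (fst (D\<Phi> p (e_u, 0))) = 0"
    have "surj (D\<Phi> p)" using linear_injective_imp_surjective[OF d(2,3)] by simp
    then obtain v where v: "D\<Phi> p v = (e_u, 0)" by (metis surjD)
    then have "L (fst v) = 0" using split[of v] by (simp add: e_u_def jet_tx_def zero_prod_def)
    then have t: "jet_tx (fst v) = 0" by (rule k)
    have "jet_txu (fst (v - jet_u (fst v) *\<^sub>R (e_u, 0))) = jet_txu 0"
      using t by (simp add: jet_txu_def jet_u_def jet_tx_def e_u_def zero_prod_def)
    from d(4)[OF this] have "jet_u (fst (D\<Phi> p (v - jet_u (fst v) *\<^sub>R (e_u, 0)))) = 0"
      by (simp add: jet_txu_def jet_u_def)
    moreover have "D\<Phi> p (v - jet_u (fst v) *\<^sub>R (e_u, 0)) = D\<Phi> p v - jet_u (fst v) *\<^sub>R D\<Phi> p (e_u, 0)"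
      unfolding linear_diff[OF d(2)] linear_cmul[OF d(2)] by simp
    ultimately have "jet_u (fst (D\<Phi> p v)) = jet_u (fst v) * jet_u (fst (D\<Phi> p (e_u, 0)))"
      by (simp add: jet_u_def)
    then show False using 0 v by (simp add: jet_u_def e_u_def)
  qed
qed

end

section \<open>Product neighbourhoods\<close>

lemma open_product_balls:
  fixes a :: "'a::metric_space" and b :: "'b::metric_space"
  assumes "open N" "(a, b) \<in> N"
  obtains d e where "d > 0" "e > 0" "ball a d \<times> ball b e \<subseteq> N"
proof -
  obtain A B where AB: "open A" "open B" "a \<in> A" "b \<in> B" "A \<times> B \<subseteq> N"
    using assms by (elim open_prod_elim) auto
  obtain d e where de: "d > 0" "ball a d \<subseteq> A" "e > 0" "ball b e \<subseteq> B"
    using openE[OF AB(1,3)] openE[OF AB(2,4)] by metis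
  show thesis by (rule that[OF de(1,3)]) (use AB de in blast)
qed

text \<open>A product neighbourhood on which the jet part of \<open>\<Phi>\<close> is a
  prolongation. Convexity of \<open>I\<close>, \<open>J\<close>, \<open>K\<close> serves the
  constancy arguments; openness of \<open>R\<close> and \<open>M\<close> permits independent
  variation of the derivatives of \<open>u\<close> and of the values of \<open>A\<close> and
  \<open>B\<close>. At this stage \<open>T2\<close> may still depend on \<open>x\<close>.\<close>

locale FP_box = FP_equiv +
  fixes I J K :: "real set" and R :: "((real \<times> real) \<times> (real \<times> real \<times> real)) set" and M :: "(real \<times> real) set"
    and T2 X :: "real \<times> real \<Rightarrow> real" and U :: "(real \<times> real) \<times> real \<Rightarrow> real"
  assumes open_box: "open I" "open J" "open K" "open R" "open M"
    and convex_box: "convex I" "convex J" "convex K"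
    and nonempty_box: "I \<noteq> {}" "J \<noteq> {}" "K \<noteq> {}" "R \<noteq> {}" "M \<noteq> {}"
    and box_W: "((I \<times> J) \<times> (K \<times> R)) \<times> M \<subseteq> W"
    and sm_T2: "smooth_on T2 (I \<times> J)" and sm_X: "smooth_on X (I \<times> J)" and sm_U: "smooth_on U ((I \<times> J) \<times> K)"
    and jac: "\<And>q. q \<in> I \<times> J \<Longrightarrow> pd_t T2 q * pd_x X q - pd_x T2 q * pd_t X q \<noteq> 0"
    and U_u: "\<And>q. q \<in> (I \<times> J) \<times> K \<Longrightarrow> part_u U q \<noteq> 0"
    and fst_\<Phi>: "\<And>p. p \<in> ((I \<times> J) \<times> (K \<times> R)) \<times> M \<Longrightarrow>
      fst (\<Phi> p) = prolong2 (\<lambda>w. T2 (jet_tx w)) (\<lambda>w. X (jet_tx w)) (\<lambda>w. U (jet_txu w)) (fst p)"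

context FP_equiv
begin

lemma local_box:
  assumes p0: "p0 \<in> W"
  obtains I J K R M T2 X U where "FP_box \<Phi> W I J K R M T2 X U" "p0 \<in> ((I \<times> J) \<times> (K \<times> R)) \<times> M"
proof -
  obtain t x u r \<theta> where p0e: "p0 = (((t, x), u, r), \<theta>)" by (metis surj_pair)
  obtain N where N: "open N" "p0 \<in> N" "N \<subseteq> W" "diffeo_on \<Phi> N"
    and pr: "projectable_on (\<lambda>(z, \<theta>). jet_txu z) \<Phi> N" "projectable_on (\<lambda>(z, \<theta>). z) \<Phi> N"
    using point p0 unfolding point_transformation_def by blast
  obtain d1 e1 where b1: "d1 > 0" "e1 > 0" "ball ((t, x), u, r) d1 \<times> ball \<theta> e1 \<subseteq> N"
    by (rule open_product_balls[OF N(1) N(2)[unfolded p0e]])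
  obtain d2 e2 where b2: "d2 > 0" "e2 > 0" "ball (t, x) d2 \<times> ball (u, r) e2 \<subseteq> ball ((t, x), u, r) d1"
    by (rule open_product_balls[of "ball ((t, x), u, r) d1" "(t, x)" "(u, r)"]) (use b1 in auto)
  obtain d3 e3 where b3: "d3 > 0" "e3 > 0" "ball t d3 \<times> ball x e3 \<subseteq> ball (t, x) d2"
    by (rule open_product_balls[of "ball (t, x) d2" t x]) (use b2 in auto)
  obtain d4 e4 where b4: "d4 > 0" "e4 > 0" "ball u d4 \<times> ball r e4 \<subseteq> ball (u, r) e2"
    by (rule open_product_balls[of "ball (u, r) e2" u r]) (use b2 in auto)
  define I J K R M where "I = ball t d3" and "J = ball x e3" and "K = ball u d4" and "R = ball r e4" and "M = ball \<theta> e1"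
  note defs = I_def J_def K_def R_def M_def
  have op: "open I" "open J" "open K" "open R" "open M" and cv: "convex I" "convex J" "convex K" "convex R" "convex M"
    and mem: "t \<in> I" "x \<in> J" "u \<in> K" "r \<in> R" "\<theta> \<in> M"
    using b1 b2 b3 b4 by (auto simp: defs)
  let ?box = "((I \<times> J) \<times> (K \<times> R)) \<times> M"
  have box: "?box \<subseteq> N" using b1(3) b2(3) b3(3) b4(3) unfolding defs by blast
  then have bW: "?box \<subseteq> W" using N(3) by blast
  have sm: "smooth_on \<Phi> N" using N(4) by (simp add: diffeo_on_def)
  define T2 X U where "T2 q = fst (fst (fst (\<Phi> ((q, u, r), \<theta>))))" and "X q = snd (fst (fst (\<Phi> ((q, u, r), \<theta>))))"
    and "U qu = fst (snd (fst (\<Phi> ((fst qu, snd qu, r), \<theta>))))" for q qu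
  have oIJ: "open (I \<times> J)" "open ((I \<times> J) \<times> K)" using op by (auto intro!: open_Times)
  have c1: "smooth_on (\<lambda>q. \<Phi> ((q, u, r), \<theta>)) (I \<times> J)"
    by (rule smooth_on_compose[OF sm N(1) oIJ(1)]) (use box mem oIJ in \<open>auto intro!: smooth\<close>)
  have c2: "smooth_on (\<lambda>qu. \<Phi> ((fst qu, snd qu, r), \<theta>)) ((I \<times> J) \<times> K)"
    by (rule smooth_on_compose[OF sm N(1) oIJ(2)]) (use box mem oIJ in \<open>auto intro!: smooth\<close>)
  have s: "smooth_on T2 (I \<times> J)" "smooth_on X (I \<times> J)" "smooth_on U ((I \<times> J) \<times> K)"
    unfolding T2_def[abs_def] X_def[abs_def] U_def[abs_def] by (intro smooth oIJ c1 c2)+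
  have inb: "((q, u', r'), \<theta>') \<in> ?box" if "q \<in> I \<times> J" "u' \<in> K" "r' \<in> R" "\<theta>' \<in> M" for q u' r' \<theta>'
    using that by auto
  have TX: "fst (fst (\<Phi> p)) = (T2 (jet_tx (fst p)), X (jet_tx (fst p)))" if p: "p \<in> ?box" for p
  proof -
    obtain q u' r' \<theta>' where pe: "p = ((q, u', r'), \<theta>')" by (metis surj_pair)
    have m: "q \<in> I \<times> J" "u' \<in> K" "r' \<in> R" "\<theta>' \<in> M" using p by (auto simp: pe)
    let ?f = "\<lambda>y. jet_tx (fst (\<Phi> ((q, fst (fst y), snd (fst y)), snd y)))"
    have "?f ((u', r'), \<theta>') = ?f ((u, r), \<theta>)"
    proof (rule has_derivative_zero_unique[where f="?f" and s="(K \<times> R) \<times> M"])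
      show "convex ((K \<times> R) \<times> M)" using cv by (intro convex_Times)
      fix y :: "(real \<times> (real \<times> real) \<times> real \<times> real \<times> real) \<times> real \<times> real"
      assume y: "y \<in> (K \<times> R) \<times> M"
      let ?p = "((q, fst (fst y), snd (fst y)), snd y)"
      have pW: "?p \<in> W" using bW inb[OF m(1), of "fst (fst y)" "snd (fst y)" "snd y"] y by auto
      have 1: "((\<lambda>y. ((q, fst (fst y), snd (fst y)), snd y)) has_derivative (\<lambda>h. ((0, fst (fst h), snd (fst h)), snd h))) (at y)"
        by (auto intro!: derivative_eq_intros)
      have "(?f has_derivative (\<lambda>h. jet_tx (fst (D\<Phi> ?p ((0, fst (fst h), snd (fst h)), snd h))))) (at y)"
        by (rule has_derivative_compose[OF has_derivative_compose[OF 1 has_derivative_fst[OF deriv_facts(1)[OF pW]]] has_derivative_jet_tx])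
      moreover have "jet_tx (fst (D\<Phi> ?p ((0, fst (fst h), snd (fst h)), snd h))) = 0" for h
        by (rule jacobian(2)[OF pW]) (simp add: jet_tx_def)
      ultimately show "(?f has_derivative (\<lambda>h. 0)) (at y within (K \<times> R) \<times> M)"
        by (simp add: has_derivative_at_withinI)
    qed (use m mem in auto)
    then show ?thesis by (simp add: pe T2_def X_def jet_tx_def)
  qed
  have Ue: "fst (snd (fst (\<Phi> p))) = U (jet_txu (fst p))" if p: "p \<in> ?box" for p
  proof -
    obtain q u' r' \<theta>' where pe: "p = ((q, u', r'), \<theta>')" by (metis surj_pair)
    have "p \<in> N" "((q, u', r), \<theta>) \<in> N" using p box mem by (auto simp: pe)
    moreover obtain \<phi> where "\<And>q. q \<in> N \<Longrightarrow> jet_txu (fst (\<Phi> q)) = \<phi> (jet_txu (fst q))"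
      using pr(1) unfolding projectable_on_def case_prod_unfold by blast
    ultimately have "jet_txu (fst (\<Phi> p)) = jet_txu (fst (\<Phi> ((q, u', r), \<theta>)))"
      by (simp add: pe jet_txu_def jet_tx_def jet_u_def)
    then show ?thesis by (simp add: pe U_def jet_txu_def jet_tx_def jet_u_def)
  qed
  have jac: "pd_t T2 q * pd_x X q - pd_x T2 q * pd_t X q \<noteq> 0" if q: "q \<in> I \<times> J" for q
  proof -
    let ?p = "((q, u, r), \<theta>)"
    have pW: "?p \<in> W" using bW inb q mem by auto
    have 1: "((\<lambda>q. ((q, u, r), \<theta>)) has_derivative (\<lambda>h. ((h, 0, 0), 0))) (at q)"
      by (auto intro!: derivative_eq_intros simp: zero_prod_def)
    have "((\<lambda>q. fst (fst (\<Phi> ((q, u, r), \<theta>)))) has_derivative (\<lambda>h. fst (fst (D\<Phi> ?p ((h, 0, 0), 0))))) (at q)"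
      by (rule has_derivative_fst[OF has_derivative_fst[OF has_derivative_compose[OF 1 deriv_facts(1)[OF pW]]]])
    then have "(T2 has_derivative (\<lambda>h. fst (fst (fst (D\<Phi> ?p ((h, 0, 0), 0)))))) (at q)"
      "(X has_derivative (\<lambda>h. snd (fst (fst (D\<Phi> ?p ((h, 0, 0), 0)))))) (at q)"
      unfolding T2_def[abs_def] X_def[abs_def] by (auto intro: has_derivative_fst has_derivative_snd)
    from pd_eqI(1,2)[OF this(1)] pd_eqI(1,2)[OF this(2)] jacobian(1)[OF pW]
    show ?thesis by (simp add: e_t_def e_x_def jet_tx_def zero_prod_def)
  qed
  have Uu: "part_u U qu \<noteq> 0" if qu: "qu \<in> (I \<times> J) \<times> K" for qu
  proof -
    let ?p = "((fst qu, snd qu, r), \<theta>)"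
    have pW: "?p \<in> W" using bW inb[of "fst qu" "snd qu"] qu mem by auto
    have 1: "((\<lambda>q. ((fst q, snd q, r), \<theta>)) has_derivative (\<lambda>h. ((fst h, snd h, 0), 0))) (at qu)"
      by (auto intro!: derivative_eq_intros simp: zero_prod_def)
    have "(U has_derivative (\<lambda>h. fst (snd (fst (D\<Phi> ?p ((fst h, snd h, 0), 0)))))) (at qu)"
      unfolding U_def[abs_def]
      by (rule has_derivative_fst[OF has_derivative_snd[OF has_derivative_fst[OF has_derivative_compose[OF 1 deriv_facts(1)[OF pW]]]]])
    from part_eqI(3)[OF this] jacobian(3)[OF pW] show ?thesis by (simp add: e_u_def jet_u_def zero_prod_def)
  qed
  let ?Z = "(I \<times> J) \<times> (K \<times> R)"
  have oZ: "open ?Z" using op by (intro open_Times)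
  define \<psi> where "\<psi> w = fst (\<Phi> (w, \<theta>))" for w
  have d\<psi>: "(\<psi> has_derivative (\<lambda>v. fst (D\<Phi> (w, \<theta>) (v, 0)))) (at w)" if "w \<in> ?Z" for w
  proof -
    have pW: "(w, \<theta>) \<in> W" using bW mem that by auto
    have 1: "((\<lambda>w. (w, \<theta>)) has_derivative (\<lambda>h. (h, 0))) (at w)" by (auto intro!: derivative_eq_intros)
    show ?thesis unfolding \<psi>_def[abs_def]
      by (rule has_derivative_fst[OF has_derivative_compose[OF 1 deriv_facts(1)[OF pW]]])
  qed
  have \<psi>: "\<psi> w = prolong2 (\<lambda>w. T2 (jet_tx w)) (\<lambda>w. X (jet_tx w)) (\<lambda>w. U (jet_txu w)) w" if w: "w \<in> ?Z" for w
  proof -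
    have "\<psi> w = prolong2 (\<lambda>w. fst (fst (\<psi> w))) (\<lambda>w. snd (fst (\<psi> w))) (\<lambda>w. fst (snd (\<psi> w))) w"
    proof (rule contact_imp_prolong2[OF oZ w])
      fix w assume w: "w \<in> ?Z"
      show "\<psi> differentiable (at w)" using d\<psi>[OF w] by (auto simp: differentiable_def)
      have pW: "(w, \<theta>) \<in> W" using bW mem w by auto
      show "frechet_derivative \<psi> (at w) v \<in> contact_plane (\<psi> w)" if "v \<in> contact_plane w" for v
        using contact pW that frechet_derivative_at[OF d\<psi>[OF w], symmetric]
        unfolding contact_consistent_def D\<Phi>_def \<psi>_def by (metis fst_conv)
      \<comment> \<open>Vertical vectors do not move the new \<open>(t, x)\<close>, so
        \<open>tvec w\<close> and \<open>xvec w\<close> may be replaced by \<open>e_t\<close> and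
        \<open>e_x\<close>, and the total Jacobian is the ordinary one.\<close>
      have split: "jet_tx (fst (D\<Phi> (w, \<theta>) (v, 0))) = jet_tx (fst (D\<Phi> (w, \<theta>) (v', 0)))" if "jet_tx v = jet_tx v'" for v v'
        using jacobian(2)[OF pW, of "(v - v', 0)"] that linear_diff[OF deriv_facts(2)[OF pW], of "(v, 0)" "(v', 0)"]
        by (simp add: jet_tx_def)
      have e: "jet_tx (tvec w) = jet_tx e_t" "jet_tx (xvec w) = jet_tx e_x"
        by (cases w rule: contact_plane.cases; simp add: jet_tx_def e_t_def e_x_def)+
      show "total_jac (\<lambda>w. fst (fst (\<psi> w))) (\<lambda>w. snd (fst (\<psi> w))) w \<noteq> 0"
        using jacobian(1)[OF pW] total_eqI[OF has_derivative_fst[OF has_derivative_fst[OF d\<psi>[OF w]]]]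
          total_eqI[OF has_derivative_snd[OF has_derivative_fst[OF d\<psi>[OF w]]]] split[OF e(1)] split[OF e(2)]
        unfolding total_jac_def by (simp add: jet_tx_def)
    qed
    also have "\<dots> = prolong2 (\<lambda>w. T2 (jet_tx w)) (\<lambda>w. X (jet_tx w)) (\<lambda>w. U (jet_txu w)) w"
      by (rule prolong2_cong[OF oZ w]; use TX Ue mem in \<open>simp add: \<psi>_def\<close>)
    finally show ?thesis .
  qed
  have f\<Phi>: "fst (\<Phi> p) = prolong2 (\<lambda>w. T2 (jet_tx w)) (\<lambda>w. X (jet_tx w)) (\<lambda>w. U (jet_txu w)) (fst p)" if p: "p \<in> ?box" for p
  proof -
    obtain \<phi> where \<phi>: "\<And>q. q \<in> N \<Longrightarrow> fst (\<Phi> q) = \<phi> (fst q)"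
      using pr(2) unfolding projectable_on_def case_prod_unfold by blast
    have "p \<in> N" "(fst p, \<theta>) \<in> N" "fst p \<in> ?Z" using p box mem by auto
    then show ?thesis using \<phi>[of p] \<phi>[of "(fst p, \<theta>)"] \<psi>[of "fst p"] by (simp add: \<psi>_def)
  qed
  have "FP_box \<Phi> W I J K R M T2 X U"
    by unfold_locales (use op cv mem bW s jac Uu f\<Phi> in \<open>auto simp del: mem_Sigma_iff\<close>)
  moreover have "p0 \<in> ?box" using mem by (simp add: p0e)
  ultimately show thesis using that by blast
qed

end

section \<open>Test equations and the vanishing of \<open>T_x\<close>\<close>

lemma total_txu:
  fixes t x u ut ux :: real and d2 :: "real \<times> real \<times> real"
  assumes "smooth_on f S" "((t, x), u) \<in> S"
  defines "z \<equiv> ((t, x), u, (ut, ux), d2)"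
  shows "total_t (\<lambda>w. f (jet_txu w)) z = part_t f ((t, x), u) + part_u f ((t, x), u) * ut"
    and "total_x (\<lambda>w. f (jet_txu w)) z = part_x f ((t, x), u) + part_u f ((t, x), u) * ux"
proof -
  have q: "jet_txu z = ((t, x), u)" by (simp add: z_def jet_txu_def jet_tx_def jet_u_def)
  note d = has_derivative_compose[OF has_derivative_jet_txu, of f _ z, unfolded q, OF has_derivative_part[OF assms(1,2)]]
  show "total_t (\<lambda>w. f (jet_txu w)) z = part_t f ((t, x), u) + part_u f ((t, x), u) * ut"
    "total_x (\<lambda>w. f (jet_txu w)) z = part_x f ((t, x), u) + part_u f ((t, x), u) * ux"
    unfolding total_eqI[OF d] by (cases d2; simp add: z_def jet_txu_def jet_tx_def jet_u_def)+
qed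

lemma exists_nonzero_shift:
  fixes p v :: "'a::real_normed_vector"
  assumes "open N" "p \<in> N"
  obtains s :: real where "s \<noteq> 0" "p + s *\<^sub>R v \<in> N"
proof -
  have o: "open ((\<lambda>s::real. p + s *\<^sub>R v) -` N)"
    by (rule open_vimage[OF assms(1)]) (auto intro!: continuous_intros)
  obtain e where "e > 0" "ball 0 e \<subseteq> (\<lambda>s::real. p + s *\<^sub>R v) -` N"
    by (rule openE[OF o, of 0]) (use assms(2) in auto)
  then have "e / 2 \<noteq> 0" "p + (e / 2) *\<^sub>R v \<in> N" by (auto simp: subset_iff)
  then show thesis by (rule that)
qed

context FP_box
begin

abbreviation "P \<equiv> I \<times> J"
abbreviation "E \<equiv> P \<times> K"
abbreviation "Z \<equiv> P \<times> (K \<times> R)"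

definition psi :: "jet2 \<Rightarrow> jet2" where
  "psi = prolong2 (\<lambda>w. T2 (jet_tx w)) (\<lambda>w. X (jet_tx w)) (\<lambda>w. U (jet_txu w))"

definition base2 :: "real \<times> real \<Rightarrow> real \<times> real" where "base2 q = (T2 q, X q)"

lemma opens: "open P" "open E" "open Z"
  using open_box by (auto intro!: open_Times)

text \<open>The slope \<open>b1\<close> adds \<open>b1 * u\<close> to the test equation without
  moving the point \<open>(a, b)\<close> above \<open>x\<close>. It is thus a parameter of the
  equation on which the image of the extended point does not depend.\<close>

lemma transfer:
  fixes t x u ut ux utt utx uxx a b b1 :: real
  assumes z: "((t, x), u, (ut, ux), (utt, utx, uxx)) \<in> Z" and ab: "(a, b) \<in> M"
  defines "B \<equiv> \<lambda>y. b + b1 * (y - x)"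
  obtains N V A' B' where "open N" "((t, x), u, (ut, ux), (utt, utx, uxx)) \<in> N" "N \<subseteq> Z" "FP_coeffs V A' B'"
    "\<And>t x u ut ux utt utx uxx. ((t, x), u, (ut, ux), (utt, utx, uxx)) \<in> N \<Longrightarrow>
      base2 (t, x) \<in> V \<and>
      snd (\<Phi> (((t, x), u, (ut, ux), (utt, utx, uxx)), (a, B x))) = (A' (base2 (t, x)), B' (base2 (t, x))) \<and>
      (ut = a * uxx + B x * ux + b1 * u \<longleftrightarrow> psi ((t, x), u, (ut, ux), (utt, utx, uxx)) \<in> FP_eq V A' B')"
proof -
  let ?z = "((t, x), u, (ut, ux), (utt, utx, uxx))"
  define A0 B0 where "A0 = (\<lambda>q::real \<times> real. a)" and "B0 = (\<lambda>q::real \<times> real. B (snd q))"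
  have pW: "(?z, (a, b)) \<in> W" using box_W z ab by auto
  then have a: "a \<noteq> 0" using W_ext by (auto simp: ext_space_def)
  have sm: "smooth_on A0 UNIV" "smooth_on B0 UNIV"
    unfolding A0_def B0_def B_def by (intro smooth open_UNIV)+
  have FP: "FP_coeffs UNIV A0 B0" using sm a by (auto simp: FP_coeffs_def A0_def)
  have "(?z, (A0 (jet_tx ?z), B0 (jet_tx ?z))) \<in> W" using pW by (simp add: A0_def B0_def B_def jet_tx_def)
  then obtain N0 V A' B' where N0: "open N0" "?z \<in> N0" and FP': "FP_coeffs V A' B'"
      and tr: "\<forall>w\<in>N0. maps_FP_at W \<Phi> UNIV A0 B0 V A' B' w"
    using preserves[unfolded preserves_FP_class_iff, rule_format, of UNIV A0 B0 ?z] FP by blast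
  define N where "N = N0 \<inter> {w. jet_tx w \<in> UNIV \<and> (w, (A0 (jet_tx w), B0 (jet_tx w))) \<in> Z \<times> M}"
  show thesis
  proof (rule that[of N V A' B'])
    show "open N" unfolding N_def
      using open_graph_vimage[OF open_UNIV sm open_Times[OF opens(3) open_box(5)]] N0(1) by blast
    show "?z \<in> N" using N0 z ab by (auto simp: N_def A0_def B0_def B_def jet_tx_def)
    show "N \<subseteq> Z" by (auto simp: N_def)
    show "FP_coeffs V A' B'" by (rule FP')
    fix t' x' u ut ux utt utx uxx :: real
    let ?w = "((t', x'), u, (ut, ux), (utt, utx, uxx))"
    assume w: "?w \<in> N"
    have AB: "A0 (t', x') = a" "B0 (t', x') = B x'" by (auto simp: A0_def B0_def)
    have wM: "(?w, (a, B x')) \<in> Z \<times> M" using w by (auto simp: N_def jet_tx_def A0_def B0_def)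
    have tx: "jet_tx ?w = (t', x')" by (simp add: jet_tx_def)
    have f: "fst (\<Phi> (?w, (a, B x'))) = psi ?w" using fst_\<Phi>[OF wM] by (simp add: psi_def)
    have b: "jet_tx (psi ?w) = base2 (t', x')" by (simp add: psi_def prolong2_def base2_def jet_tx_def)
    have pdA: "pd_x A0 = (\<lambda>q. 0)" "pd_x B0 = (\<lambda>q. b1)"
      unfolding A0_def B0_def B_def by (auto simp: fun_eq_iff intro!: pd_x_eqI derivative_eq_intros)
    have eq: "?w \<in> FP_eq UNIV A0 B0 \<longleftrightarrow> ut = a * uxx + B x' * ux + b1 * u"
      unfolding FP_eq_iff[OF FP] pdA by (auto simp: AB pd_x_def)
    from w have "?w \<in> N0" by (simp add: N_def)
    from bspec[OF tr this] show "base2 (t', x') \<in> V \<and>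
      snd (\<Phi> (?w, (a, B x'))) = (A' (base2 (t', x')), B' (base2 (t', x'))) \<and>
      (ut = a * uxx + B x' * ux + b1 * u \<longleftrightarrow> psi ?w \<in> FP_eq V A' B')"
      unfolding maps_FP_at_def Let_def tx AB f b eq by simp
  qed
qed

lemma pd_x_T2:
  assumes q: "q \<in> P"
  shows "pd_x T2 q = 0"
proof -
  obtain t x where tx: "q = (t, x)" by (cases q)
  obtain u where u: "u \<in> K" "u \<noteq> 0"
  proof -
    obtain k where k: "k \<in> K" using nonempty_box by auto
    obtain s where "s \<noteq> 0" "k + s *\<^sub>R 1 \<in> K" by (rule exists_nonzero_shift[OF open_box(3) k])
    then show thesis using that k by (cases "k = 0") auto
  qed
  obtain ut ux utt utx uxx where r: "((ut, ux), (utt, utx, uxx)) \<in> R" using nonempty_box by auto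
  obtain a b where ab: "(a, b) \<in> M" using nonempty_box by auto
  \<comment> \<open>The slope that puts the chosen jet on the test equation;
    \<open>u \<noteq> 0\<close> makes it available.\<close>
  define b1 where "b1 = (ut - a * uxx - b * ux) / u"
  have z: "((t, x), u, (ut, ux), (utt, utx, uxx)) \<in> Z" using q u r by (auto simp: tx)
  obtain N V A' B' where N: "open N" "((t, x), u, (ut, ux), (utt, utx, uxx)) \<in> N" "N \<subseteq> Z" and FP: "FP_coeffs V A' B'"
    and tr: "\<And>t x' u ut ux utt utx uxx. ((t, x'), u, (ut, ux), (utt, utx, uxx)) \<in> N \<Longrightarrow>
      base2 (t, x') \<in> V \<and>
      snd (\<Phi> (((t, x'), u, (ut, ux), (utt, utx, uxx)), (a, b + b1 * (x' - x)))) = (A' (base2 (t, x')), B' (base2 (t, x'))) \<and>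
      (ut = a * uxx + (b + b1 * (x' - x)) * ux + b1 * u \<longleftrightarrow> psi ((t, x'), u, (ut, ux), (utt, utx, uxx)) \<in> FP_eq V A' B')"
    by (rule transfer[OF z ab, of b1]) blast
  obtain s where s: "s \<noteq> 0" "((t, x), u, (ut, ux), (utt, utx, uxx)) + s *\<^sub>R (0, 0, (0, 0), (1, 0, 0)) \<in> N"
    by (rule exists_nonzero_shift[OF N(1,2)])
  let ?w = "\<lambda>s. ((t, x), u, (ut, ux), (utt + s, utx, uxx))"
  have wN: "?w s \<in> N" "?w 0 \<in> N" using s N(2) by (auto simp: zero_prod_def)
  have eq: "ut = a * uxx + (b + b1 * (x - x)) * ux + b1 * u" using u by (simp add: b1_def)
  have in_eq: "psi (?w s) \<in> FP_eq V A' B'" "psi (?w 0) \<in> FP_eq V A' B'"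
    using tr[OF wN(1)] tr[OF wN(2)] eq by simp_all
  define Jq where "Jq q = pd_t T2 q * pd_x X q - pd_x T2 q * pd_t X q" for q
  have Jnz: "Jq q \<noteq> 0" if "q \<in> P" for q using jac[OF that] by (simp add: Jq_def)
  note spd = smooth_on_pd[OF sm_T2 opens(1)] smooth_on_pd[OF sm_X opens(1)]
  have sJ: "smooth_on Jq P" unfolding Jq_def[abs_def] by (intro smooth opens spd)
  have lift: "smooth_on (\<lambda>qu. k (fst qu)) E" if "smooth_on k P" for k :: "real \<times> real \<Rightarrow> real"
    by (rule smooth_on_compose[OF that opens(1,2)]) (auto intro!: smooth opens)
  \<comment> \<open>Coefficients of the new \<open>u_x\<close> as an affine function of
    \<open>(u_t, u_x)\<close>, by Cramer's rule with \<open>T_x\<close> still present.\<close>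
  define f g h where "f qu = (pd_t T2 (fst qu) * part_x U qu - pd_x T2 (fst qu) * part_t U qu) / Jq (fst qu)"
    and "g qu = - (pd_x T2 (fst qu) * part_u U qu) / Jq (fst qu)"
    and "h qu = (pd_t T2 (fst qu) * part_u U qu) / Jq (fst qu)" for qu
  have sfgh: "smooth_on f E" "smooth_on g E" "smooth_on h E"
    unfolding f_def[abs_def] g_def[abs_def] h_def[abs_def]
    by (intro smooth opens sm_U lift spd sJ Jnz; force)+
  note prl = prol_base[OF sm_T2 sm_X opens(1), folded Jq_def]
  let ?Tj = "\<lambda>w. T2 (jet_tx w)" and ?Xj = "\<lambda>w. X (jet_tx w)" and ?Uj = "\<lambda>w. U (jet_txu w)"
  let ?F = "\<lambda>w. f (jet_txu w) + g (jet_txu w) * jet_ut w + h (jet_txu w) * jet_ux w"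
  have tot: "total_t ?Uj w = part_t U (jet_txu w) + part_u U (jet_txu w) * jet_ut w"
    "total_x ?Uj w = part_x U (jet_txu w) + part_u U (jet_txu w) * jet_ux w" if "w \<in> Z" for w
    using that total_txu[OF sm_U] by (cases w rule: contact_plane.cases; auto simp: jet_txu_def jet_tx_def jet_u_def)+
  have F: "prol_x ?Tj ?Xj ?Uj w = ?F w" if "w \<in> Z" for w
  proof -
    have q: "jet_tx w \<in> P" using that by (auto simp: jet_tx_def)
    have "fst (jet_txu w) = jet_tx w" by (simp add: jet_txu_def)
    then show ?thesis unfolding prl(2)[OF q] tot[OF that] f_def g_def h_def
      using Jnz[OF q] by (simp add: field_simps)
  qed
  have wZ: "?w s \<in> Z" "?w 0 \<in> Z" using wN N(3) by auto
  have jtx: "jet_tx (?w s) = q" "jet_txu (?w s) = (q, u)" for s by (simp_all add: jet_tx_def jet_txu_def jet_u_def tx)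
  have qE: "((t, x), u) \<in> E" using q u tx by auto
  define uxx' where "uxx' s = prol_x ?Tj ?Xj (prol_x ?Tj ?Xj ?Uj) (?w s)" for s
  have uxx': "uxx' s = (pd_t T2 q * total_x ?F (?w s) - pd_x T2 q * total_t ?F (?w s)) / Jq q" if "?w s \<in> Z" for s
  proof -
    have "uxx' s = prol_x ?Tj ?Xj ?F (?w s)"
      unfolding uxx'_def by (rule prol_cong(2)[OF opens(3) that refl refl F])
    also have "\<dots> = (pd_t T2 q * total_x ?F (?w s) - pd_x T2 q * total_t ?F (?w s)) / Jq q"
      by (subst prl(2)) (use q in \<open>auto simp: jtx\<close>)
    finally show ?thesis .
  qed
  \<comment> \<open>\<open>u_tt\<close> enters only through \<open>D_t\<close> of the new
    \<open>u_x\<close>, where its coefficient is \<open>- T_x * U_u / J\<close>; the second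
    prolongation contributes another factor \<open>- T_x / J\<close>.\<close>
  have diff: "uxx' s - uxx' 0 = (pd_x T2 q)\<^sup>2 * part_u U (q, u) * s / (Jq q)\<^sup>2"
    unfolding uxx'[OF wZ(1)] uxx'[OF wZ(2)] total_affine_jet[OF sfgh qE]
    using Jnz[OF q] by (simp add: tx g_def field_simps power2_eq_square)
  have eq': "psi (?w s) = ((T2 q, X q), U (q, u), (prol_t ?Tj ?Xj ?Uj (?w s), prol_x ?Tj ?Xj ?Uj (?w s)),
      (prol_t ?Tj ?Xj (prol_t ?Tj ?Xj ?Uj) (?w s), prol_x ?Tj ?Xj (prol_t ?Tj ?Xj ?Uj) (?w s), uxx' s))" for s
    by (simp add: psi_def prolong2_def uxx'_def jtx)
  have val: "prol_t ?Tj ?Xj ?Uj (?w s) = ((part_t U (q, u) + part_u U (q, u) * ut) * pd_x X q -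
        (part_x U (q, u) + part_u U (q, u) * ux) * pd_t X q) / Jq q"
    "prol_x ?Tj ?Xj ?Uj (?w s) = (pd_t T2 q * (part_x U (q, u) + part_u U (q, u) * ux) -
        pd_x T2 q * (part_t U (q, u) + part_u U (q, u) * ut)) / Jq q" if "?w s \<in> Z" for s
    using prl[of "?w s", unfolded jtx, OF q] tot[OF that, unfolded jtx] by simp_all
  have same: "prol_t ?Tj ?Xj ?Uj (?w s) = prol_t ?Tj ?Xj ?Uj (?w 0)" "prol_x ?Tj ?Xj ?Uj (?w s) = prol_x ?Tj ?Xj ?Uj (?w 0)"
    unfolding val[OF wZ(1)] val[OF wZ(2)] by simp_all
  \<comment> \<open>Both image jets solve the new equation and agree in every coordinate occurring
    there except the new \<open>u_xx\<close>.\<close>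
  have "A' (T2 q, X q) * uxx' s = A' (T2 q, X q) * uxx' 0"
    using in_eq unfolding eq' FP_eq_iff[OF FP] same by simp
  moreover have "A' (T2 q, X q) \<noteq> 0" using tr[OF wN(2)] FP by (auto simp: FP_coeffs_def base2_def tx)
  ultimately have "uxx' s - uxx' 0 = 0" by simp
  then show ?thesis unfolding diff using s Jnz[OF q] U_u[OF qE] by (simp add: tx)
qed

end

section \<open>Determining equations\<close>

text \<open>
  Here \<open>t\<close> is frozen, \<open>m, n\<close> stand for \<open>X\<^sub>x, X\<^sub>t\<close>, and \<open>f + h y\<close> is the new \<open>u\<^sub>x\<close> as a function
  of the old one. Comparing coefficients of \<open>s = u\<^sub>x\<^sub>x\<close>, \<open>y\<^sup>2\<close> and \<open>y = u\<^sub>x\<close> determines the new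
  coefficients near \<open>x\<^sub>0\<close>; their derivatives enter the terms of order zero.
\<close>

lemma determining_equations:
  fixes a b b1 x0 u0 y0 s0 e \<tau> kd md2 nd :: real and m md n A0 A1 A2 B0 B1 :: "real \<Rightarrow> real"
    and U \<nu> f h fx fu hx hu :: "real \<Rightarrow> real \<Rightarrow> real"
  assumes e: "e > 0" and \<tau>: "\<tau> \<noteq> 0" and a: "a \<noteq> 0"
    and E: "\<And>x u y s. \<bar>x - x0\<bar> < e \<Longrightarrow> \<bar>u - u0\<bar> < e \<Longrightarrow> \<bar>y - y0\<bar> < e \<Longrightarrow> \<bar>s - s0\<bar> < e \<Longrightarrow>
      (\<nu> x u + h x u * m x * (a * s + (b + b1 * (x - x0)) * y + b1 * u) - n x * (f x u + h x u * y)) / \<tau> =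
      A2 x * U x u + 2 * A1 x * (f x u + h x u * y)
      + A0 x * ((fx x u + fu x u * y + (hx x u + hu x u * y) * y + h x u * s) / m x)
      + B1 x * U x u + B0 x * (f x u + h x u * y)"
    and m: "\<And>x. \<bar>x - x0\<bar> < e \<Longrightarrow> m x \<noteq> 0" and h: "\<And>x. \<bar>x - x0\<bar> < e \<Longrightarrow> h x u0 \<noteq> 0"
    and dA0: "\<And>x. \<bar>x - x0\<bar> < e \<Longrightarrow> (A0 has_real_derivative A1 x * m x) (at x)"
    and dA1: "\<And>x. \<bar>x - x0\<bar> < e \<Longrightarrow> (A1 has_real_derivative A2 x * m x) (at x)"
    and dB0: "\<And>x. \<bar>x - x0\<bar> < e \<Longrightarrow> (B0 has_real_derivative B1 x * m x) (at x)"
    and dm: "\<And>x. \<bar>x - x0\<bar> < e \<Longrightarrow> (m has_real_derivative md x) (at x)"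
    and dmd: "(md has_real_derivative md2) (at x0)" and dn: "(n has_real_derivative nd) (at x0)"
    and dk: "((\<lambda>x. m x * (fu x u0 + hx x u0) / h x u0) has_real_derivative kd) (at x0)"
  defines "k \<equiv> \<lambda>x. m x * (fu x u0 + hx x u0) / h x u0"
  shows "A0 x0 = a * (m x0)\<^sup>2 / \<tau>"
    and "B0 x0 = (m x0 * b - n x0 - a * k x0 - 4 * a * md x0) / \<tau>"
    and "m x0 * \<nu> x0 u0 + h x0 u0 * (m x0)\<^sup>2 * b1 * u0 =
      a * (m x0 * (m x0 * fx x0 u0 - k x0 * f x0 u0) - (kd + 2 * md2) * U x0 u0)
      + (m x0)\<^sup>2 * b * f x0 u0 + (md x0 * b + m x0 * b1 - nd) * U x0 u0"
proof -
  define N where "N = ball x0 e"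
  have N: "open N" "x0 \<in> N" and N_iff: "x \<in> N \<longleftrightarrow> \<bar>x - x0\<bar> < e" for x
    using e by (auto simp: N_def dist_real_def)
  have A0: "A0 x = a * (m x)\<^sup>2 / \<tau>" if x: "x \<in> N" for x
  proof -
    \<comment> \<open>Coefficients of the difference of the two sides of \<open>E\<close> as a
      polynomial in \<open>s\<close>, at \<open>u = u0\<close> and \<open>y = y0\<close>. Vanishing
      at two values of \<open>s\<close> kills \<open>c1\<close>.\<close>
    define c0 c1 where "c0 = (\<nu> x u0 + h x u0 * m x * ((b + b1 * (x - x0)) * y0 + b1 * u0) - n x * (f x u0 + h x u0 * y0)) / \<tau>
        - (A2 x * U x u0 + 2 * A1 x * (f x u0 + h x u0 * y0)
        + A0 x * ((fx x u0 + fu x u0 * y0 + (hx x u0 + hu x u0 * y0) * y0) / m x) + B1 x * U x u0 + B0 x * (f x u0 + h x u0 * y0))"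
      and "c1 = h x u0 * m x * a / \<tau> - A0 x * h x u0 / m x"
    have l: "c0 + c1 * s = 0" if "\<bar>s - s0\<bar> < e" for s
      using E[of x u0 y0 s] that x e unfolding N_iff c0_def c1_def
      by (simp add: add_divide_distrib diff_divide_distrib algebra_simps)
    have "c0 + c1 * s0 = 0" "c0 + c1 * (s0 + e / 2) = 0" using l e by auto
    then have "c1 * e = 0" by algebra
    then have "c1 = 0" using e by simp
    then show ?thesis using m[of x] h[of x] \<tau> x unfolding N_iff c1_def
      by (simp add: field_simps power2_eq_square)
  qed
  have lin: "A0 x * hu x u0 = 0"
    "(h x u0 * m x * (b + b1 * (x - x0)) - n x * h x u0) / \<tau> =
      2 * A1 x * h x u0 + A0 x * ((fu x u0 + hx x u0) / m x) + B0 x * h x u0" if x: "x \<in> N" for x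
  proof -
    define d where "d = e / 2"
    have d: "d > 0" using e by (simp add: d_def)
    \<comment> \<open>Now \<open>s = s0\<close> is fixed and the difference is quadratic in
      \<open>y\<close>, with leading coefficient \<open>- c2\<close>. Its vanishing at
      \<open>y0\<close>, \<open>y0 + d\<close> and \<open>y0 - d\<close> kills \<open>c2\<close> and
      then \<open>c1\<close>.\<close>
    define c0 c1 c2 where "c0 = (\<nu> x u0 + h x u0 * m x * (a * s0 + b1 * u0) - n x * f x u0) / \<tau> - (A2 x * U x u0 + 2 * A1 x * f x u0
        + A0 x * ((fx x u0 + h x u0 * s0) / m x) + B1 x * U x u0 + B0 x * f x u0)"
      and "c1 = (h x u0 * m x * (b + b1 * (x - x0)) - n x * h x u0) / \<tau> -
        (2 * A1 x * h x u0 + A0 x * ((fu x u0 + hx x u0) / m x) + B0 x * h x u0)"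
      and "c2 = A0 x * hu x u0 / m x"
    have q: "c0 + c1 * y - c2 * y\<^sup>2 = 0" if "\<bar>y - y0\<bar> < e" for y
      using E[of x u0 y s0] that x e unfolding N_iff c0_def c1_def c2_def
      by (simp add: add_divide_distrib diff_divide_distrib algebra_simps power2_eq_square)
    have 1: "c0 + c1 * y0 - c2 * y0\<^sup>2 = 0" and 2: "c0 + c1 * (y0 + d) - c2 * (y0 + d)\<^sup>2 = 0"
      and 3: "c0 + c1 * (y0 - d) - c2 * (y0 - d)\<^sup>2 = 0"
      using q[of y0] q[of "y0 + d"] q[of "y0 - d"] e by (auto simp: d_def)
    have "2 * c2 * d\<^sup>2 = 0" using 1 2 3 by algebra
    then have c2: "c2 = 0" using d by simp
    then have "c1 * d = 0" using 1 2 by algebra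
    then have c1: "c1 = 0" using d by simp
    show "A0 x * hu x u0 = 0" using c2 m[of x] x by (simp add: c2_def N_iff)
    show "(h x u0 * m x * (b + b1 * (x - x0)) - n x * h x u0) / \<tau> =
      2 * A1 x * h x u0 + A0 x * ((fu x u0 + hx x u0) / m x) + B0 x * h x u0"
      using c1 by (simp add: c1_def)
  qed
  \<comment> \<open>The formula for \<open>A0\<close> holds on a neighbourhood and can be
    differentiated. The factor \<open>m\<close> arises because \<open>A1\<close> is a derivative
    with respect to the new \<open>x\<close>.\<close>
  have A1: "A1 x = 2 * a * md x / \<tau>" if x: "x \<in> N" for x
  proof -
    have "((\<lambda>x. a * (m x)\<^sup>2 / \<tau>) has_real_derivative 2 * a * m x * md x / \<tau>) (at x)"
      using x \<tau> by (auto intro!: derivative_eq_intros dm simp: N_iff field_simps)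
    then have "(A0 has_real_derivative 2 * a * m x * md x / \<tau>) (at x)"
      by (rule has_field_derivative_transform_within_open[OF _ N(1) x]) (simp add: A0)
    from DERIV_unique[OF this dA0] m[of x] x \<tau> show ?thesis by (simp add: N_iff field_simps)
  qed
  have A2: "A2 x0 * m x0 = 2 * a * md2 / \<tau>"
  proof -
    have "((\<lambda>x. 2 * a * md x / \<tau>) has_real_derivative 2 * a * md2 / \<tau>) (at x0)"
      using \<tau> by (auto intro!: derivative_eq_intros dmd)
    then have "(A1 has_real_derivative 2 * a * md2 / \<tau>) (at x0)"
      by (rule has_field_derivative_transform_within_open[OF _ N]) (simp add: A1)
    from DERIV_unique[OF dA1 this] e show ?thesis by simp
  qed
  have B0: "B0 x = (m x * (b + b1 * (x - x0)) - n x - a * k x - 4 * a * md x) / \<tau>" if x: "x \<in> N" for x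
  proof -
    have "A0 x * ((fu x u0 + hx x u0) / m x) = a * k x * h x u0 / \<tau>"
      using m[of x] h[of x] x \<tau> unfolding A0[OF x] k_def N_iff by (simp add: power2_eq_square)
    then have "h x u0 * (m x * (b + b1 * (x - x0)) - n x - a * k x - 4 * a * md x - \<tau> * B0 x) = 0"
      using lin(2)[OF x] \<tau> unfolding A1[OF x] by (simp add: field_simps)
    then have "m x * (b + b1 * (x - x0)) - n x - a * k x - 4 * a * md x - \<tau> * B0 x = 0"
      unfolding mult_eq_0_iff using h[of x] x by (simp add: N_iff)
    then show ?thesis using \<tau> by (simp add: field_simps)
  qed
  have B1: "B1 x0 * m x0 = (md x0 * b + m x0 * b1 - nd - a * kd - 4 * a * md2) / \<tau>"
  proof -
    have "((\<lambda>x. (m x * (b + b1 * (x - x0)) - n x - a * k x - 4 * a * md x) / \<tau>) has_real_derivative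
        (md x0 * b + m x0 * b1 - nd - a * kd - 4 * a * md2) / \<tau>) (at x0)"
      using \<tau> e dk[folded k_def] by (auto intro!: derivative_eq_intros dm dn dmd)
    then have "(B0 has_real_derivative (md x0 * b + m x0 * b1 - nd - a * kd - 4 * a * md2) / \<tau>) (at x0)"
      by (rule has_field_derivative_transform_within_open[OF _ N]) (simp add: B0)
    from DERIV_unique[OF dB0 this] e show ?thesis by simp
  qed
  show "A0 x0 = a * (m x0)\<^sup>2 / \<tau>" by (rule A0[OF N(2)])
  show "B0 x0 = (m x0 * b - n x0 - a * k x0 - 4 * a * md x0) / \<tau>" using B0[OF N(2)] by simp
  have m0: "m x0 \<noteq> 0" "h x0 u0 \<noteq> 0" using m h e by auto
  \<comment> \<open>The quadratic coefficient vanishes and \<open>A0\<close> does not; this removes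
    \<open>hu\<close> from the remaining equation.\<close>
  have hu0: "hu x0 u0 = 0" using lin(1)[OF N(2)] A0[OF N(2)] a m0 \<tau> by simp
  have E0: "(\<nu> x0 u0 + h x0 u0 * m x0 * (a * s0 + b * y0 + b1 * u0) - n x0 * (f x0 u0 + h x0 u0 * y0)) / \<tau> =
      A2 x0 * U x0 u0 + 2 * A1 x0 * (f x0 u0 + h x0 u0 * y0)
      + A0 x0 * ((fx x0 u0 + fu x0 u0 * y0 + hx x0 u0 * y0 + h x0 u0 * s0) / m x0)
      + B1 x0 * U x0 u0 + B0 x0 * (f x0 u0 + h x0 u0 * y0)"
    using E[of x0 u0 y0 s0] e by (simp add: hu0 algebra_simps)
  have kh: "k x0 * h x0 u0 = m x0 * (fu x0 u0 + hx x0 u0)" using m0 by (simp add: k_def)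
  have A0': "A0 x0 = a * m x0 * m x0 / \<tau>" using A0[OF N(2)] by (simp add: power2_eq_square)
  \<comment> \<open>Multiplication by \<open>\<tau> * m x0\<close> produces the products
    \<open>A2 * m\<close> and \<open>B1 * m\<close>, whose values are known, and clears the
    denominators.\<close>
  have *: "m x0 * (\<nu> x0 u0 + h x0 u0 * m x0 * (a * s0 + b * y0 + b1 * u0) - n x0 * (f x0 u0 + h x0 u0 * y0)) =
      \<tau> * (A2 x0 * m x0) * U x0 u0 + m x0 * (\<tau> * (2 * A1 x0 + B0 x0)) * (f x0 u0 + h x0 u0 * y0)
      + \<tau> * A0 x0 * (fx x0 u0 + fu x0 u0 * y0 + hx x0 u0 * y0 + h x0 u0 * s0)
      + \<tau> * (B1 x0 * m x0) * U x0 u0"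
  proof -
    define Q where "Q = A0 x0 * ((fx x0 u0 + fu x0 u0 * y0 + hx x0 u0 * y0 + h x0 u0 * s0) / m x0)"
    have "Q * m x0 = A0 x0 * (fx x0 u0 + fu x0 u0 * y0 + hx x0 u0 * y0 + h x0 u0 * s0)"
      using m0 by (simp add: Q_def)
    moreover note iffD1[OF nonzero_divide_eq_eq[OF \<tau>] E0[folded Q_def]]
    ultimately show ?thesis by algebra
  qed
  have "m x0 * (\<nu> x0 u0 + h x0 u0 * m x0 * (a * s0 + b * y0 + b1 * u0) - n x0 * (f x0 u0 + h x0 u0 * y0)) =
      2 * a * md2 * U x0 u0 + m x0 * (m x0 * b - n x0 - a * k x0) * (f x0 u0 + h x0 u0 * y0)
      + a * m x0 * m x0 * (fx x0 u0 + fu x0 u0 * y0 + hx x0 u0 * y0 + h x0 u0 * s0)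
      + (md x0 * b + m x0 * b1 - nd - a * kd - 4 * a * md2) * U x0 u0"
  proof -
    have "\<tau> * (A2 x0 * m x0) = 2 * a * md2" "\<tau> * A0 x0 = a * m x0 * m x0"
      "\<tau> * (2 * A1 x0 + B0 x0) = m x0 * b - n x0 - a * k x0"
      "\<tau> * (B1 x0 * m x0) = md x0 * b + m x0 * b1 - nd - a * kd - 4 * a * md2"
      unfolding A2 B1 A1[OF N(2)] B0[OF N(2)] A0' using \<tau> by (simp_all add: distrib_left)
    then show ?thesis using * by presburger
  qed
  then show "m x0 * \<nu> x0 u0 + h x0 u0 * (m x0)\<^sup>2 * b1 * u0 =
      a * (m x0 * (m x0 * fx x0 u0 - k x0 * f x0 u0) - (kd + 2 * md2) * U x0 u0)
      + (m x0)\<^sup>2 * b * f x0 u0 + (md x0 * b + m x0 * b1 - nd) * U x0 u0"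
    using kh by algebra
qed

section \<open>The determining equations on a box\<close>

lemma open_cube:
  fixes x u y s :: real
  assumes "open S" "(x, u, y, s) \<in> S"
  obtains e where "e > 0"
    "\<And>x' u' y' s'. \<bar>x' - x\<bar> < e \<Longrightarrow> \<bar>u' - u\<bar> < e \<Longrightarrow> \<bar>y' - y\<bar> < e \<Longrightarrow> \<bar>s' - s\<bar> < e \<Longrightarrow> (x', u', y', s') \<in> S"
proof -
  obtain d1 e1 where 1: "d1 > 0" "e1 > 0" "ball x d1 \<times> ball (u, y, s) e1 \<subseteq> S"
    by (rule open_product_balls[OF assms])
  obtain d2 e2 where 2: "d2 > 0" "e2 > 0" "ball u d2 \<times> ball (y, s) e2 \<subseteq> ball (u, y, s) e1"
    by (rule open_product_balls[of "ball (u, y, s) e1" u "(y, s)"]) (use 1 in auto)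
  obtain d3 e3 where 3: "d3 > 0" "e3 > 0" "ball y d3 \<times> ball s e3 \<subseteq> ball (y, s) e2"
    by (rule open_product_balls[of "ball (y, s) e2" y s]) (use 2 in auto)
  define e where "e = min (min d1 d2) (min d3 e3)"
  show thesis
  proof (rule that[of e])
    show "e > 0" using 1 2 3 by (simp add: e_def)
    fix x' u' y' s' assume "\<bar>x' - x\<bar> < e" "\<bar>u' - u\<bar> < e" "\<bar>y' - y\<bar> < e" "\<bar>s' - s\<bar> < e"
    then have "x' \<in> ball x d1" "u' \<in> ball u d2" "y' \<in> ball y d3" "s' \<in> ball s e3"
      by (auto simp: e_def dist_real_def abs_minus_commute)
    then show "(x', u', y', s') \<in> S" using 1(3) 2(3) 3(3) by blast
  qed
qed

lemma has_real_derivative_part_x: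
  assumes "smooth_on f S" "((t, x), u) \<in> S"
  shows "((\<lambda>y. f ((t, y), u)) has_real_derivative part_x f ((t, x), u)) (at x)"
proof -
  have 1: "((\<lambda>y. ((t, y), u)) has_derivative (\<lambda>h. ((0, h), 0))) (at x)"
    by (auto intro!: derivative_eq_intros)
  show ?thesis unfolding has_field_derivative_def
    using has_derivative_compose[OF 1 has_derivative_part[OF assms]] by simp
qed

context FP_box
begin

text \<open>\<open>T2\<close> is constant in \<open>x\<close> on the box, so freezing
  \<open>x\<close> at any point of \<open>J\<close> makes it a function of \<open>t\<close>
  alone.\<close>

definition x1 :: real where "x1 = (SOME x. x \<in> J)"
definition T1 :: "real \<Rightarrow> real" where "T1 s = T2 (s, x1)"

lemma x1: "x1 \<in> J"
  using nonempty_box(2) by (simp add: x1_def some_in_eq)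

lemma T2_eq:
  assumes "q \<in> P"
  shows "T2 q = T1 (fst q)"
proof -
  obtain t x where tx: "q = (t, x)" by (cases q)
  have "T2 (t, x) = T2 (t, x1)"
  proof (rule has_derivative_zero_unique[where f="\<lambda>y. T2 (t, y)" and s=J])
    show "convex J" by (rule convex_box)
    show "((\<lambda>y. T2 (t, y)) has_derivative (\<lambda>h. 0)) (at y within J)" if "y \<in> J" for y
    proof -
      have y: "(t, y) \<in> P" using that assms tx by auto
      have "((\<lambda>y. T2 (t, y)) has_real_derivative 0) (at y)"
        using has_real_derivative_pd(2)[OF sm_T2 opens(1) y] pd_x_T2[OF y] by simp
      then have "((\<lambda>y. T2 (t, y)) has_derivative (\<lambda>h. 0 * h)) (at y)"
        by (simp only: has_field_derivative_def)
      then show ?thesis by (simp add: has_derivative_at_withinI)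
    qed
  qed (use assms x1 tx in auto)
  then show ?thesis by (simp add: tx T1_def)
qed

lemma smooth_T1: "smooth_on T1 I"
  unfolding T1_def[abs_def]
  by (rule smooth_on_compose[OF sm_T2 opens(1) open_box(1)]) (auto intro!: smooth open_box x1)

lemma deriv_T1:
  assumes "q \<in> P"
  shows "deriv T1 (fst q) = pd_t T2 q"
proof -
  obtain t x where tx: "q = (t, x)" by (cases q)
  have "(T1 has_real_derivative pd_t T2 (t, x)) (at t)"
    by (rule has_field_derivative_transform_within_open[OF has_real_derivative_pd(1)[OF sm_T2 opens(1)] open_box(1)])
       (use assms tx T2_eq in auto)
  then show ?thesis using DERIV_imp_deriv tx by simp
qed

sublocale tr: FP_transf T1 X I P
proof
  fix q assume q: "q \<in> P"
  have "deriv T1 (fst q) * pd_x X q \<noteq> 0"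
    using jac[OF q] pd_x_T2[OF q] by (simp add: deriv_T1[OF q])
  then show "deriv T1 (fst q) \<noteq> 0" "pd_x X q \<noteq> 0" by auto
qed (use open_box opens smooth_T1 sm_X in auto)

lemma base2_eq: "q \<in> P \<Longrightarrow> base2 q = tr.base q"
  by (simp add: base2_def tr.base_def T2_eq)

definition "m = pd_x X"
definition "n = pd_t X"
text \<open>The new \<open>u_x\<close> is \<open>ff + hh * u_x\<close>. Through \<open>kk\<close>
  these functions enter the new \<open>B\<close>, and \<open>EE\<close> is the factor of
  \<open>a\<close> in the terms of order zero.\<close>

definition "ff qu = part_x U qu / m (fst qu)"
definition "hh qu = part_u U qu / m (fst qu)"
definition "kk qu = m (fst qu) * (part_u ff qu + part_x hh qu) / hh qu"
definition "EE qu = m (fst qu) * (m (fst qu) * part_x ff qu - kk qu * ff qu)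
  - (part_x kk qu + 2 * pd_x (pd_x m) (fst qu)) * U qu"

lemma m_nz: "q \<in> P \<Longrightarrow> m q \<noteq> 0"
  using tr.nz(2) by (auto simp: m_def)

lemma hh_nz: "qu \<in> E \<Longrightarrow> hh qu \<noteq> 0"
  using U_u m_nz by (auto simp: hh_def)

lemma lift: "smooth_on k P \<Longrightarrow> smooth_on (\<lambda>qu. k (fst qu)) E" for k :: "real \<times> real \<Rightarrow> real"
  by (rule smooth_on_compose[OF _ opens(1,2)]) (auto intro!: smooth opens)

lemma smooth_mn: "smooth_on m P" "smooth_on n P"
  unfolding m_def n_def by (intro smooth sm_X opens)+

lemma smooth_fhk: "smooth_on ff E" "smooth_on hh E" "smooth_on kk E"
proof -
  show f: "smooth_on ff E" and h: "smooth_on hh E" unfolding ff_def[abs_def] hh_def[abs_def]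
    by (intro smooth opens lift smooth_mn sm_U m_nz; force)+
  show "smooth_on kk E" unfolding kk_def[abs_def]
    by (intro smooth opens lift smooth_mn f h hh_nz)
qed

text \<open>The new equation at the image jet, written in the old coordinates with
  \<open>T_x = 0\<close> built in. Its shape is that of the hypothesis \<open>E\<close> of
  \<open>determining_equations\<close>.\<close>

lemma psi_in_FP_eq:
  fixes t x u ut ux utt utx uxx :: real
  assumes z: "((t, x), u, (ut, ux), (utt, utx, uxx)) \<in> Z" and FP: "FP_coeffs V A B"
    and eq: "psi ((t, x), u, (ut, ux), (utt, utx, uxx)) \<in> FP_eq V A B"
  defines "q \<equiv> (t, x)" and "qu \<equiv> ((t, x), u)"
  shows "(part_t U qu + hh qu * m q * ut - n q * (ff qu + hh qu * ux)) / deriv T1 t =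
     pd_x (pd_x A) (tr.base q) * U qu + 2 * pd_x A (tr.base q) * (ff qu + hh qu * ux)
     + A (tr.base q) * ((part_x ff qu + part_u ff qu * ux + (part_x hh qu + part_u hh qu * ux) * ux + hh qu * uxx) / m q)
     + pd_x B (tr.base q) * U qu + B (tr.base q) * (ff qu + hh qu * ux)"
proof -
  let ?z = "((t, x), u, (ut, ux), (utt, utx, uxx))"
  let ?Tj = "\<lambda>w. T1 (fst (jet_tx w))" and ?Xj = "\<lambda>w. X (jet_tx w)" and ?Uj = "\<lambda>w. U (jet_txu w)"
  have qP: "(t, x) \<in> P" and qE: "((t, x), u) \<in> E" using z by auto
  have psi: "psi ?z = prolong2 ?Tj ?Xj ?Uj ?z"
    unfolding psi_def by (rule prolong2_cong[OF opens(3) z]) (auto simp: jet_tx_def T2_eq)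
  have jz: "jet_tx ?z = (t, x)" "jet_txu ?z = ((t, x), u)" by (auto simp: jet_tx_def jet_txu_def jet_u_def)
  let ?F = "\<lambda>w. ff (jet_txu w) + (\<lambda>_. 0) (jet_txu w) * jet_ut w + hh (jet_txu w) * jet_ux w"
  have F: "prol_x ?Tj ?Xj ?Uj w = ?F w" if w: "w \<in> Z" for w
  proof -
    have wP: "jet_tx w \<in> P" and wE: "jet_txu w \<in> E" using w by (auto simp: jet_tx_def jet_txu_def jet_u_def)
    have "total_x ?Uj w = part_x U (jet_txu w) + part_u U (jet_txu w) * jet_ux w"
      using w total_txu(2)[OF sm_U] by (cases w rule: contact_plane.cases) (auto simp: jet_txu_def jet_tx_def jet_u_def)
    then show ?thesis unfolding tr.prol(2)[OF wP]
      by (simp add: ff_def hh_def m_def jet_txu_def add_divide_distrib)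
  qed
  have "prol_x ?Tj ?Xj (prol_x ?Tj ?Xj ?Uj) ?z = prol_x ?Tj ?Xj ?F ?z"
    by (rule prol_cong(2)[OF opens(3) z refl refl F])
  also have "\<dots> = total_x ?F ?z / m (t, x)"
    using tr.prol(2)[of ?z ?F] qP by (simp add: jz m_def)
  also have "total_x ?F ?z = part_x ff qu + part_u ff qu * ux + (part_x hh qu + part_u hh qu * ux) * ux + hh qu * uxx"
  proof -
    have "part_x (\<lambda>_. 0) qu = 0" "part_u (\<lambda>_. 0) qu = 0"
      using part_eqI[OF has_derivative_const[of "0::real" "at qu"]] by auto
    then show ?thesis
      using total_affine_jet(2)[OF smooth_fhk(1) smooth_on_const[OF opens(2), of 0] smooth_fhk(2) qE] by (simp add: qu_def)
  qed
  finally have xx: "prol_x ?Tj ?Xj (prol_x ?Tj ?Xj ?Uj) ?z =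
    (part_x ff qu + part_u ff qu * ux + (part_x hh qu + part_u hh qu * ux) * ux + hh qu * uxx) / m q"
    by (simp add: q_def)
  have x: "prol_x ?Tj ?Xj ?Uj ?z = ff qu + hh qu * ux" using F[OF z] by (simp add: jz qu_def)
  have t: "prol_t ?Tj ?Xj ?Uj ?z = (part_t U qu + part_u U qu * ut - n q * (ff qu + hh qu * ux)) / deriv T1 t"
    using tr.prol(1)[of ?z ?Uj, unfolded jz, OF qP] tr.prol(2)[of ?z ?Uj, unfolded jz, OF qP, symmetric]
      total_txu(1)[OF sm_U qE, of ut ux "(utt, utx, uxx)"]
    by (simp add: x n_def q_def qu_def)
  have u: "part_u U qu = hh qu * m q"
    using m_nz[of q] qP by (simp add: hh_def q_def qu_def)
  have b: "T1 (fst (jet_tx ?z)) = fst (tr.base q)" "X (jet_tx ?z) = snd (tr.base q)" "U (jet_txu ?z) = U qu"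
    by (simp_all add: jz tr.base_def q_def qu_def)
  show ?thesis
    using eq[unfolded psi prolong2_def x t xx b, unfolded FP_eq_iff[OF FP], THEN conjunct2]
    by (simp only: u prod.collapse)
qed

text \<open>The slope \<open>b1\<close> is tied to the jet by the requirement that the jet lie on
  the test equation; hence changing \<open>u_t\<close> at fixed \<open>(a, b)\<close> amounts to
  changing \<open>b1\<close>.\<close>

lemma determining_at:
  fixes t x u ut ux utt utx uxx a b :: real
  assumes z: "((t, x), u, (ut, ux), (utt, utx, uxx)) \<in> Z" and ab: "(a, b) \<in> M" and u: "u \<noteq> 0"
  defines "q \<equiv> (t, x)" and "qu \<equiv> ((t, x), u)" and "b1 \<equiv> (ut - a * uxx - b * ux) / u"
  shows "snd (\<Phi> (((t, x), u, (ut, ux), (utt, utx, uxx)), (a, b))) =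
      (a * (m q)\<^sup>2 / deriv T1 t, (m q * b - n q - a * kk qu - 4 * a * pd_x m q) / deriv T1 t)"
    and "m q * part_t U qu + hh qu * (m q)\<^sup>2 * b1 * u =
      a * EE qu + (m q)\<^sup>2 * b * ff qu + (pd_x m q * b + m q * b1 - pd_x n q) * U qu"
proof -
  let ?z = "((t, x), u, (ut, ux), (utt, utx, uxx))"
  obtain N V A' B' where N: "open N" "?z \<in> N" "N \<subseteq> Z" and FP: "FP_coeffs V A' B'"
    and tr': "\<And>t x' u ut ux utt utx uxx. ((t, x'), u, (ut, ux), (utt, utx, uxx)) \<in> N \<Longrightarrow>
      base2 (t, x') \<in> V \<and>
      snd (\<Phi> (((t, x'), u, (ut, ux), (utt, utx, uxx)), (a, b + b1 * (x' - x)))) = (A' (base2 (t, x')), B' (base2 (t, x'))) \<and>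
      (ut = a * uxx + (b + b1 * (x' - x)) * ux + b1 * u \<longleftrightarrow> psi ((t, x'), u, (ut, ux), (utt, utx, uxx)) \<in> FP_eq V A' B')"
    by (rule transfer[OF z ab, of b1]) blast
  have V: "open V" "smooth_on A' V" "smooth_on B' V" using FP by (auto simp: FP_coeffs_def)
  have pW: "(?z, (a, b)) \<in> W" using box_W z ab by auto
  then have a: "a \<noteq> 0" using W_ext by (auto simp: ext_space_def)
  have tI: "t \<in> I" and qP: "(t, x) \<in> P" using z by auto
  define \<tau> where "\<tau> = deriv T1 t"
  have \<tau>: "\<tau> \<noteq> 0" using tr.nz(1)[OF qP] by (simp add: \<tau>_def)
  \<comment> \<open>Parametrises the test equation at fixed \<open>t\<close>, \<open>u_tt\<close>,
    \<open>u_tx\<close> by \<open>(x, u, u_x, u_xx)\<close>. By continuity a small cube of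
    parameters stays inside \<open>N\<close>.\<close>
  define jet where "jet = (\<lambda>(y, v, p, s). ((t, y), v, (a * s + (b + b1 * (y - x)) * p + b1 * v, p), (utt, utx, s)) :: jet2)"
  have cj: "continuous_on UNIV jet" unfolding jet_def case_prod_unfold by (intro continuous_intros)
  have utq: "a * uxx + (b + b1 * (x - x)) * ux + b1 * u = ut" using u by (simp add: b1_def)
  have "open (jet -` N)" using open_vimage[OF N(1) cj] .
  moreover have "(x, u, ux, uxx) \<in> jet -` N" using N(2) utq by (simp add: jet_def)
  ultimately obtain e where e: "e > 0" and cube: "\<And>x' u' y' s'. \<bar>x' - x\<bar> < e \<Longrightarrow> \<bar>u' - u\<bar> < e \<Longrightarrow> \<bar>y' - ux\<bar> < e
      \<Longrightarrow> \<bar>s' - uxx\<bar> < e \<Longrightarrow> jet (x', u', y', s') \<in> N"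
    by (rule open_cube) (use vimageD in blast)
  define A0 A1 A2 B0 B1 where "A0 y = A' (tr.base (t, y))" and "A1 y = pd_x A' (tr.base (t, y))"
    and "A2 y = pd_x (pd_x A') (tr.base (t, y))" and "B0 y = B' (tr.base (t, y))" and "B1 y = pd_x B' (tr.base (t, y))" for y
  have nearP: "(t, y) \<in> P" "((t, y), u) \<in> E" "tr.base (t, y) \<in> V" if "\<bar>y - x\<bar> < e" for y
  proof -
    have j: "jet (y, u, ux, uxx) \<in> N" using cube[of y u ux uxx] that e by simp
    then show p: "(t, y) \<in> P" "((t, y), u) \<in> E" using N(3) by (auto simp: jet_def)
    show "tr.base (t, y) \<in> V" using tr'[of t y] j base2_eq[OF p(1)] by (auto simp: jet_def)
  qed
  have pull: "((\<lambda>y. f (tr.base (t, y))) has_real_derivative pd_x f (tr.base (t, y)) * m (t, y)) (at y)"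
    if "smooth_on f V" "\<bar>y - x\<bar> < e" for f y
    using pd_eqI(4)[OF has_derivative_compose[OF tr.has_derivative_base[OF nearP(1)[OF that(2)]]
          has_derivative_pd[OF that(1) V(1) nearP(3)[OF that(2)]]]]
    by (simp add: m_def)
  note smm = smooth_on_pd(2)[OF smooth_mn(1) opens(1)]
  have eqE: "(part_t U ((t, y), v) + hh ((t, y), v) * m (t, y) * (a * s + (b + b1 * (y - x)) * p + b1 * v)
        - n (t, y) * (ff ((t, y), v) + hh ((t, y), v) * p)) / \<tau> =
      A2 y * U ((t, y), v) + 2 * A1 y * (ff ((t, y), v) + hh ((t, y), v) * p)
      + A0 y * ((part_x ff ((t, y), v) + part_u ff ((t, y), v) * p + (part_x hh ((t, y), v) + part_u hh ((t, y), v) * p) * p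
        + hh ((t, y), v) * s) / m (t, y))
      + B1 y * U ((t, y), v) + B0 y * (ff ((t, y), v) + hh ((t, y), v) * p)"
    if c: "\<bar>y - x\<bar> < e" "\<bar>v - u\<bar> < e" "\<bar>p - ux\<bar> < e" "\<bar>s - uxx\<bar> < e" for y v p s
  proof -
    have jN: "((t, y), v, (a * s + (b + b1 * (y - x)) * p + b1 * v, p), (utt, utx, s)) \<in> N"
      using cube[OF c] by (simp add: jet_def)
    from psi_in_FP_eq[OF subsetD[OF N(3) this] FP] tr'[OF this]
    show ?thesis unfolding A0_def A1_def A2_def B0_def B1_def \<tau>_def by simp
  qed
  have x0: "\<bar>x - x\<bar> < e" using e by simp
  have dk: "((\<lambda>y. m (t, y) * (part_u ff ((t, y), u) + part_x hh ((t, y), u)) / hh ((t, y), u)) has_real_derivative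
      part_x kk ((t, x), u)) (at x)"
    using has_real_derivative_part_x[OF smooth_fhk(3), of t x u] nearP(2)[OF x0] by (simp add: kk_def[abs_def])
  have m0: "m (t, y) \<noteq> 0" and h0: "hh ((t, y), u) \<noteq> 0" if "\<bar>y - x\<bar> < e" for y
    using m_nz hh_nz nearP[OF that] by auto
  have d1: "(A0 has_real_derivative A1 y * m (t, y)) (at y)" and d2: "(A1 has_real_derivative A2 y * m (t, y)) (at y)"
    and d3: "(B0 has_real_derivative B1 y * m (t, y)) (at y)" and d4: "((\<lambda>y. m (t, y)) has_real_derivative pd_x m (t, y)) (at y)"
    if "\<bar>y - x\<bar> < e" for y
    unfolding A0_def[abs_def] A1_def[abs_def] A2_def B0_def[abs_def] B1_def
    by (intro pull V smooth_on_pd that has_real_derivative_pd(2)[OF smooth_mn(1) opens(1)] nearP)+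
  have d5: "((\<lambda>y. pd_x m (t, y)) has_real_derivative pd_x (pd_x m) (t, x)) (at x)"
    and d6: "((\<lambda>y. n (t, y)) has_real_derivative pd_x n (t, x)) (at x)"
    by (intro has_real_derivative_pd(2)[OF _ opens(1)] smm smooth_mn qP)+
  note core = determining_equations[where \<nu>="\<lambda>y v. part_t U ((t, y), v)" and h="\<lambda>y v. hh ((t, y), v)" and m="\<lambda>y. m (t, y)"
    and n="\<lambda>y. n (t, y)" and f="\<lambda>y v. ff ((t, y), v)" and U="\<lambda>y v. U ((t, y), v)" and fx="\<lambda>y v. part_x ff ((t, y), v)"
    and fu="\<lambda>y v. part_u ff ((t, y), v)" and hx="\<lambda>y v. part_x hh ((t, y), v)" and hu="\<lambda>y v. part_u hh ((t, y), v)"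
    and md="\<lambda>y. pd_x m (t, y)" and ?A0.0=A0 and ?A1.0=A1 and ?A2.0=A2 and ?B0.0=B0 and ?B1.0=B1
    and kd="part_x kk ((t, x), u)" and ?md2.0="pd_x (pd_x m) (t, x)" and nd="pd_x n (t, x)"
    and a=a and b=b and ?b1.0=b1 and ?x0.0=x and ?u0.0=u and ?y0.0=ux and ?s0.0=uxx,
    OF e \<tau> a _ m0 h0 d1 d2 d3 d4 d5 d6 dk]
  have conc: "A0 x = a * (m (t, x))\<^sup>2 / \<tau> \<and> B0 x = (m (t, x) * b - n (t, x) - a * kk ((t, x), u) - 4 * a * pd_x m (t, x)) / \<tau> \<and>
    m (t, x) * part_t U ((t, x), u) + hh ((t, x), u) * (m (t, x))\<^sup>2 * b1 * u =
      a * (m (t, x) * (m (t, x) * part_x ff ((t, x), u) - kk ((t, x), u) * ff ((t, x), u))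
        - (part_x kk ((t, x), u) + 2 * pd_x (pd_x m) (t, x)) * U ((t, x), u))
      + (m (t, x))\<^sup>2 * b * ff ((t, x), u) + (pd_x m (t, x) * b + m (t, x) * b1 - pd_x n (t, x)) * U ((t, x), u)"
    unfolding kk_def[of "((t, x), u)"] fst_conv
    by (intro conjI; rule core; (assumption | rule eqE)+)
  have "snd (\<Phi> (?z, (a, b))) = (A0 x, B0 x)"
    using tr'[OF N(2)] base2_eq[OF qP] by (simp add: A0_def B0_def)
  then show "snd (\<Phi> (?z, (a, b))) =
      (a * (m q)\<^sup>2 / deriv T1 t, (m q * b - n q - a * kk qu - 4 * a * pd_x m q) / deriv T1 t)"
    using conc by (simp add: q_def qu_def \<tau>_def)
  show "m q * part_t U qu + hh qu * (m q)\<^sup>2 * b1 * u =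
      a * EE qu + (m q)\<^sup>2 * b * ff qu + (pd_x m q * b + m q * b1 - pd_x n q) * U qu"
    using conc by (simp add: q_def qu_def EE_def)
qed

end

text \<open>Carries identities proved for \<open>u \<noteq> 0\<close> over to \<open>u = 0\<close>,
  along a line in the \<open>u\<close>-direction.\<close>

lemma continuous_punctured_line:
  fixes f :: "'a::real_normed_vector \<Rightarrow> 'b::t1_space"
  assumes "continuous_on N f" "open N" "p \<in> N"
    and "\<And>s. s \<noteq> 0 \<Longrightarrow> p + s *\<^sub>R v \<in> N \<Longrightarrow> f (p + s *\<^sub>R v) = c"
  shows "f p = c"
proof (rule ccontr)
  assume ne: "f p \<noteq> c"
  have "open (N \<inter> f -` (- {c}))"
    by (rule continuous_open_preimage[OF assms(1,2)]) auto
  moreover have "p \<in> N \<inter> f -` (- {c})" using assms(3) ne by auto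
  ultimately obtain s :: real where s: "s \<noteq> 0" "p + s *\<^sub>R v \<in> N \<inter> f -` (- {c})"
    by (rule exists_nonzero_shift)
  then show False using assms(4)[of s] by auto
qed

lemma has_derivative_base_times_u:
  fixes g :: "real \<times> real \<Rightarrow> real"
  assumes "smooth_on g D" "open D" "fst qu \<in> D"
  shows "((\<lambda>qu. g (fst qu) * snd qu) has_derivative
     (\<lambda>v. g (fst qu) * snd v + (pd_t g (fst qu) * fst (fst v) + pd_x g (fst qu) * snd (fst v)) * snd qu)) (at qu)"
    "((\<lambda>qu. g (fst qu)) has_derivative
     (\<lambda>v. pd_t g (fst qu) * fst (fst v) + pd_x g (fst qu) * snd (fst v))) (at qu)"
proof -
  show 1: "((\<lambda>qu. g (fst qu)) has_derivative
     (\<lambda>v. pd_t g (fst qu) * fst (fst v) + pd_x g (fst qu) * snd (fst v))) (at qu)"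
    by (rule has_derivative_compose[OF has_derivative_fst[OF has_derivative_ident] has_derivative_pd[OF assms]])
  show "((\<lambda>qu. g (fst qu) * snd qu) has_derivative
     (\<lambda>v. g (fst qu) * snd v + (pd_t g (fst qu) * fst (fst v) + pd_x g (fst qu) * snd (fst v)) * snd qu)) (at qu)"
    by (rule has_derivative_mult[OF 1 has_derivative_snd[OF has_derivative_ident]])
qed

section \<open>Solving for \<open>U\<close> and the new coefficients\<close>

context FP_box
begin

text \<open>Small shifts of \<open>u_t\<close>, \<open>b\<close> and \<open>a\<close> inside the
  open sets \<open>R\<close> and \<open>M\<close> isolate the factors of \<open>b1\<close>,
  \<open>b\<close> and \<open>a\<close> in \<open>determining_at\<close>. Since
  \<open>m * hh = U_u\<close> and \<open>m * ff = U_x\<close>, the first two identities concern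
  \<open>u * U_u\<close> and \<open>(m * U)_x\<close>; the third becomes
  \<open>(m * U)_t = 0\<close> by symmetry of the mixed derivatives of \<open>X\<close>.\<close>

lemma varied_parameters:
  assumes qu: "qu \<in> E" and u: "snd qu \<noteq> 0"
  shows "hh qu * m (fst qu) * snd qu = U qu"
    and "(m (fst qu))\<^sup>2 * ff qu + pd_x m (fst qu) * U qu = 0"
    and "m (fst qu) * part_t U qu + pd_x n (fst qu) * U qu = 0"
proof -
  obtain t x v where que: "qu = ((t, x), v)" by (metis surj_pair)
  define q where "q = (t, x)"
  have mq: "m q \<noteq> 0" using m_nz[of q] qu by (auto simp: que q_def)
  obtain ut ux utt utx uxx where r: "((ut, ux), (utt, utx, uxx)) \<in> R" using nonempty_box by auto
  obtain a b where ab: "(a, b) \<in> M" using nonempty_box by auto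
  have det: "m q * part_t U qu + hh qu * (m q)\<^sup>2 * ((ut' - a' * uxx - b' * ux) / v) * v =
      a' * EE qu + (m q)\<^sup>2 * b' * ff qu + (pd_x m q * b' + m q * ((ut' - a' * uxx - b' * ux) / v) - pd_x n q) * U qu"
    if "((ut', ux), (utt, utx, uxx)) \<in> R" "(a', b') \<in> M" for ut' a' b'
  proof -
    have "((t, x), v, (ut', ux), (utt, utx, uxx)) \<in> Z" using that qu by (auto simp: que)
    from determining_at(2)[OF this that(2)] u show ?thesis by (simp add: que q_def)
  qed
  obtain s where s: "s \<noteq> 0" "((ut + s, ux), (utt, utx, uxx)) \<in> R"
    by (rule exists_nonzero_shift[OF open_box(4) r, of "((1, 0), (0, 0, 0))"]) auto
  have v: "v \<noteq> 0" using u by (simp add: que)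
  have "hh qu * (m q)\<^sup>2 * s = m q * (s / v) * U qu"
  proof -
    define \<beta> where "\<beta> = (ut - a * uxx - b * ux) / v"
    have "(ut + s - a * uxx - b * ux) / v = \<beta> + s / v"
      using v by (simp add: \<beta>_def field_simps)
    then have "hh qu * (m q)\<^sup>2 * (s / v) * v = m q * (s / v) * U qu"
      using det[OF s(2) ab] det[OF r ab] unfolding \<beta>_def[symmetric] by algebra
    then show ?thesis using v by simp
  qed
  then have hU: "hh qu * m q * v = U qu" using s(1) v mq by (simp add: field_simps power2_eq_square)
  then show "hh qu * m (fst qu) * snd qu = U qu" by (simp add: que q_def)
  \<comment> \<open>By \<open>hU\<close> the terms with \<open>b1\<close> cancel, so
    \<open>a\<close> and \<open>b\<close> can be varied although \<open>b1\<close> changes with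
    them.\<close>
  have red: "m q * part_t U qu = a' * EE qu + (m q)\<^sup>2 * b' * ff qu + (pd_x m q * b' - pd_x n q) * U qu"
    if "(a', b') \<in> M" for a' b'
  proof -
    define \<beta> where "\<beta> = (ut - a' * uxx - b' * ux) / v"
    show ?thesis using det[OF r that] hU unfolding \<beta>_def[symmetric] by algebra
  qed
  obtain s where s: "s \<noteq> 0" "(a, b + s) \<in> M"
    by (rule exists_nonzero_shift[OF open_box(5) ab, of "(0, 1)"]) auto
  have "s * ((m q)\<^sup>2 * ff qu + pd_x m q * U qu) = 0"
    using red[OF ab] red[OF s(2)] by algebra
  then have fU: "(m q)\<^sup>2 * ff qu + pd_x m q * U qu = 0" using s(1) by simp
  then show "(m (fst qu))\<^sup>2 * ff qu + pd_x m (fst qu) * U qu = 0" by (simp add: que q_def)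
  obtain s where s: "s \<noteq> 0" "(a + s, b) \<in> M"
    by (rule exists_nonzero_shift[OF open_box(5) ab, of "(1, 0)"]) auto
  have "s * EE qu = 0" using red[OF ab] red[OF s(2)] by algebra
  then have "EE qu = 0" using s(1) by simp
  then have "m q * part_t U qu + pd_x n q * U qu = 0" using red[OF ab] fU by algebra
  then show "m (fst qu) * part_t U qu + pd_x n (fst qu) * U qu = 0" by (simp add: que q_def)
qed

definition "E0 = P \<times> (K - {0})"

lemma E0: "open E0" "E0 \<subseteq> E" "qu \<in> E0 \<longleftrightarrow> qu \<in> E \<and> snd qu \<noteq> 0"
  using opens(1) open_box(3) by (auto simp: E0_def mem_Times_iff intro!: open_Times open_delete)

lemma extend_to_E:
  fixes f :: "(real \<times> real) \<times> real \<Rightarrow> real"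
  assumes "continuous_on E f" "\<And>qu. qu \<in> E0 \<Longrightarrow> f qu = 0" "qu \<in> E"
  shows "f qu = 0"
proof (cases "snd qu = 0")
  case True
  show ?thesis
  proof (rule continuous_punctured_line[OF assms(1) opens(2) assms(3), where v="(0, 1)"])
    fix s :: real assume s: "s \<noteq> 0" "qu + s *\<^sub>R (0, 1) \<in> E"
    then have "qu + s *\<^sub>R (0, 1) \<in> E0" using True unfolding E0(3) by simp
    then show "f (qu + s *\<^sub>R (0, 1)) = 0" by (rule assms(2))
  qed
next
  case False
  then show ?thesis using assms by (simp add: E0)
qed

text \<open>The set \<open>u \<noteq> 0\<close> may be disconnected, and a vanishing derivative
  there would allow a separate constant for each sign of \<open>u\<close>. The function
  \<open>w = V_u\<close> is smooth across \<open>u = 0\<close>: its derivatives vanish on all of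
  \<open>E\<close> by continuity, and convexity of \<open>E\<close> leaves a single
  constant.\<close>

lemma U_form:
  obtains c where "c \<noteq> 0" "\<And>qu. qu \<in> E \<Longrightarrow> U qu = c / m (fst qu) * snd qu"
proof -
  define V where "V qu = m (fst qu) * U qu" for qu
  have sV: "smooth_on V E" unfolding V_def[abs_def] by (intro smooth opens lift smooth_mn sm_U)
  have dV: "part_t V qu = 0" "part_x V qu = 0" "part_u V qu * snd qu = V qu" if qu: "qu \<in> E0" for qu
  proof -
    have quE: "qu \<in> E" "snd qu \<noteq> 0" "fst qu \<in> P" using qu by (auto simp: E0)
    note d = has_derivative_mult[OF has_derivative_base_times_u(2)[OF smooth_mn(1) opens(1) quE(3)]
        has_derivative_part[OF sm_U quE(1)]]
    have mt: "pd_t m (fst qu) = pd_x n (fst qu)"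
      unfolding m_def n_def by (rule pd_commute[OF sm_X opens(1) quE(3)])
    note v = varied_parameters[OF quE(1,2)]
    have "m (fst qu) * part_x U qu = (m (fst qu))\<^sup>2 * ff qu"
      using m_nz[OF quE(3)] by (simp add: ff_def power2_eq_square)
    then have x: "m (fst qu) * part_x U qu + pd_x m (fst qu) * U qu = 0" using v(2) by simp
    have u: "hh qu * m (fst qu) = part_u U qu" using m_nz[OF quE(3)] by (simp add: hh_def)
    show "part_t V qu = 0" "part_x V qu = 0" "part_u V qu * snd qu = V qu"
      unfolding V_def[abs_def] part_eqI[OF d] using v(1,3) x u mt by (simp_all add: algebra_simps)
  qed
  define w where "w = part_u V"
  have sw: "smooth_on w E" unfolding w_def by (intro smooth sV)
  have dw0: "part_t w qu = 0 \<and> part_x w qu = 0 \<and> part_u w qu = 0" if qu: "qu \<in> E0" for qu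
  proof -
    have quE: "qu \<in> E" "snd qu \<noteq> 0" using qu by (auto simp: E0)
    \<comment> \<open>Off \<open>u = 0\<close> the function \<open>w\<close> is
      \<open>V / u\<close>, whose derivative vanishes by the three equations for
      \<open>V\<close>.\<close>
    have "((\<lambda>qu. V qu / snd qu) has_derivative (\<lambda>v. 0)) (at qu)"
    proof (rule has_derivative_eq_rhs[OF has_derivative_divide'[OF has_derivative_part[OF sV quE(1)]
            has_derivative_snd[OF has_derivative_ident] quE(2)]], rule ext)
      fix v :: "(real \<times> real) \<times> real"
      have "part_u V qu * snd v * snd qu = V qu * snd v" by (simp add: dV(3)[OF qu, symmetric] mult_ac)
      then show "((part_t V qu * fst (fst v) + part_x V qu * snd (fst v) + part_u V qu * snd v) * snd qu - V qu * snd v) /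
        (snd qu * snd qu) = 0" using dV(1,2)[OF qu] by simp
    qed
    then have "(w has_derivative (\<lambda>v. 0)) (at qu)"
      by (rule has_derivative_transform_within_open[OF _ E0(1) qu])
         (use dV(3) E0(3) in \<open>simp add: w_def field_simps\<close>)
    from part_eqI[OF this] show ?thesis by simp
  qed
  note swp = smooth_on_part[OF sw, THEN smooth_on_imp_continuous_on]
  have dw: "(w has_derivative (\<lambda>v. 0)) (at qu)" if qu: "qu \<in> E" for qu
    using has_derivative_part[OF sw qu] extend_to_E[OF swp(1) _ qu] extend_to_E[OF swp(2) _ qu]
      extend_to_E[OF swp(3) _ qu] dw0 by simp
  obtain q0 where q0: "q0 \<in> E" using nonempty_box by auto
  define c where "c = w q0"
  have wc: "w qu = c" if "qu \<in> E" for qu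
    unfolding c_def
  proof (rule has_derivative_zero_unique[where f=w and s=E])
    show "convex E" using convex_box by (intro convex_Times)
    show "(w has_derivative (\<lambda>h. 0)) (at x within E)" if "x \<in> E" for x
      using dw[OF that] by (rule has_derivative_at_withinI)
  qed (use that q0 in auto)
  have Vc: "V qu - c * snd qu = 0" if qu: "qu \<in> E" for qu
  proof (rule extend_to_E[OF _ _ qu])
    show "continuous_on E (\<lambda>qu. V qu - c * snd qu)"
      by (intro continuous_intros smooth_on_imp_continuous_on sV)
    show "V qu - c * snd qu = 0" if "qu \<in> E0" for qu
      using dV(3)[OF that] wc[of qu] that by (auto simp: E0 w_def)
  qed
  have U: "U qu = c / m (fst qu) * snd qu" if "qu \<in> E" for qu
    using Vc[OF that] m_nz[of "fst qu"] that by (auto simp: V_def field_simps)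
  have "c \<noteq> 0"
  proof
    assume "c = 0"
    then have "frechet_derivative U (at q0) = frechet_derivative (\<lambda>_. 0) (at q0)"
      by (intro frechet_derivative_cong_open[OF opens(2) q0]) (simp add: U)
    then have "part_u U q0 = 0" by (simp add: part_u_def)
    then show False using U_u[OF q0] by simp
  qed
  then show thesis using that U by blast
qed

lemma continuous_\<Phi>: "continuous_on W \<Phi>"
  by (intro continuous_at_imp_continuous_on ballI has_derivative_continuous[OF deriv_facts(1)])

text \<open>Once \<open>U\<close> is known, \<open>kk = - 3 * X_xx\<close>; together with the term
  \<open>- 4 * a * X_xx\<close> of \<open>determining_at\<close> this leaves the single
  \<open>- a * X_xx\<close> of the stated formula. At \<open>u = 0\<close> the formula for the new
  coefficients follows from continuity of \<open>\<Phi>\<close>.\<close>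

lemma FP_form_box:
  obtains c where "c \<noteq> 0" "FP_form c T1 X \<Phi> (Z \<times> M)"
proof -
  obtain c where c: "c \<noteq> 0" and U: "\<And>qu. qu \<in> E \<Longrightarrow> U qu = c / m (fst qu) * snd qu"
    by (rule U_form) blast
  have kk: "kk qu = - 3 * pd_x m (fst qu)" if qu: "qu \<in> E0" for qu
  proof -
    obtain t x v where que: "qu = ((t, x), v)" by (metis surj_pair)
    have qP: "fst qu \<in> P" using qu E0 by auto
    have mq: "m (fst qu) \<noteq> 0" by (rule m_nz[OF qP])
    \<comment> \<open>Closed forms of \<open>ff / u\<close> and \<open>hh\<close> coming from
      \<open>U = c * u / X_x\<close>. They are valid on the open set \<open>E0\<close>, so they may
      be differentiated there.\<close>
    define g1 g2 where "g1 q = - (c * pd_x m q) / (m q) ^ 3" and "g2 q = c / (m q)\<^sup>2" for q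
    have s: "smooth_on g1 P" "smooth_on g2 P"
      unfolding g1_def[abs_def] g2_def[abs_def] by (intro smooth opens smooth_mn; use m_nz in simp)+
    have f: "g1 (fst qu) * snd qu = ff qu" and h: "g2 (fst qu) = hh qu" if "qu \<in> E0" for qu
    proof -
      have qu: "qu \<in> E" "snd qu \<noteq> 0" "fst qu \<in> P" using that by (auto simp: E0)
      have mq: "m (fst qu) \<noteq> 0" by (rule m_nz[OF qu(3)])
      have "ff qu = - pd_x m (fst qu) * U qu / (m (fst qu))\<^sup>2"
        using varied_parameters(2)[OF qu(1,2)] mq by (simp add: field_simps)
      then show "g1 (fst qu) * snd qu = ff qu"
        using mq unfolding U[OF qu(1)] g1_def by (simp add: field_simps power2_eq_square power3_eq_cube)
      have "hh qu = U qu / (m (fst qu) * snd qu)"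
        using varied_parameters(1)[OF qu(1,2)] mq qu(2) by (simp add: field_simps)
      then show "g2 (fst qu) = hh qu"
        using mq qu(2) unfolding U[OF qu(1)] g2_def by (simp add: field_simps power2_eq_square)
    qed
    have "part_u ff qu = g1 (fst qu)"
      using part_eqI(3)[OF has_derivative_transform_within_open[OF has_derivative_base_times_u(1)[OF s(1) opens(1) qP] E0(1) qu f]]
      by simp
    moreover have "part_x hh qu = pd_x g2 (fst qu)"
      using part_eqI(2)[OF has_derivative_transform_within_open[OF has_derivative_base_times_u(2)[OF s(2) opens(1) qP] E0(1) qu h]]
      by simp
    moreover have "pd_x g2 (fst qu) = - 2 * c * pd_x m (fst qu) / (m (fst qu)) ^ 3"
    proof -
      have "((\<lambda>y. g2 (t, y)) has_real_derivative - 2 * c * pd_x m (t, x) / (m (t, x)) ^ 3) (at x)"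
        using has_real_derivative_pd(2)[OF smooth_mn(1) opens(1)] qP mq unfolding g2_def que
        by (auto intro!: derivative_eq_intros simp: power2_eq_square power3_eq_cube mult_ac)
      from pd_x_eqI[of g2, OF this] show ?thesis by (simp add: que)
    qed
    ultimately show ?thesis
      using mq c unfolding kk_def h[OF qu, symmetric] g1_def g2_def
      by (simp add: field_simps power2_eq_square power3_eq_cube)
  qed
  define \<theta> where "\<theta> q a b = (a * (m q)\<^sup>2 / deriv T1 (fst q), (m q * b - n q - a * pd_x m q) / deriv T1 (fst q))" for q a b
  have \<Theta>: "snd (\<Phi> (z, (a, b))) = \<theta> (jet_tx z) a b"
    if p: "(z, (a, b)) \<in> Z \<times> M" for z a b
  proof -
    have nz: "snd (\<Phi> (z, (a, b))) = \<theta> (jet_tx z) a b"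
      if p: "(z, (a, b)) \<in> Z \<times> M" and u: "jet_u z \<noteq> 0" for z
    proof -
      obtain t x v ut ux utt utx uxx where z: "z = ((t, x), v, (ut, ux), (utt, utx, uxx))"
        by (cases z rule: contact_plane.cases)
      have v: "v \<noteq> 0" and mem: "((t, x), v, (ut, ux), (utt, utx, uxx)) \<in> Z" "(a, b) \<in> M"
        using p u by (auto simp: z jet_u_def)
      have "kk ((t, x), v) = - 3 * pd_x m (t, x)" using kk[of "((t, x), v)"] mem v by (auto simp: E0)
      then show ?thesis using determining_at(1)[OF mem v] by (simp add: z jet_tx_def \<theta>_def algebra_simps)
    qed
    show ?thesis
    proof (cases "jet_u z = 0")
      case False
      then show ?thesis using nz[OF p] by blast
    next
      case True
      have ZW: "Z \<times> M \<subseteq> W" using box_W .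
      have c: "continuous_on (Z \<times> M) (\<lambda>p. snd (\<Phi> p))"
        by (intro continuous_intros continuous_on_subset[OF continuous_\<Phi> ZW])
      have o: "open (Z \<times> M)" using opens open_box by (intro open_Times)
      show ?thesis
      proof (rule continuous_punctured_line[OF c o p, where v="((0, 1, 0), 0)"])
        fix s :: real assume s: "s \<noteq> 0" "(z, (a, b)) + s *\<^sub>R ((0, 1, 0), 0) \<in> Z \<times> M"
        have e: "(z, (a, b)) + s *\<^sub>R ((0, 1, 0), 0) = (z + s *\<^sub>R (0, 1, 0), (a, b))" by (simp add: zero_prod_def)
        have "jet_tx (z + s *\<^sub>R (0, 1, 0)) = jet_tx z" "jet_u (z + s *\<^sub>R (0, 1, 0)) \<noteq> 0"
          using s True by (auto simp: jet_tx_def jet_u_def)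
        then show "snd (\<Phi> ((z, (a, b)) + s *\<^sub>R ((0, 1, 0), 0))) = \<theta> (jet_tx z) a b"
          using nz[of "z + s *\<^sub>R (0, 1, 0)"] s(2) unfolding e by simp
      qed
    qed
  qed
  have \<psi>: "fst (\<Phi> (z, (a, b))) = prolong2 (\<lambda>w. T1 (fst (jet_tx w))) (\<lambda>w. X (jet_tx w))
                (\<lambda>w. c / pd_x X (jet_tx w) * jet_u w) z" if p: "(z, (a, b)) \<in> Z \<times> M" for z a b
  proof -
    have z: "z \<in> Z" using p by simp
    have e: "T2 (jet_tx w) = T1 (fst (jet_tx w))" "U (jet_txu w) = c / pd_x X (jet_tx w) * jet_u w" if "w \<in> Z" for w
    proof -
      have "jet_tx w \<in> P" "jet_txu w \<in> E" using that by (auto simp: jet_tx_def jet_txu_def jet_u_def)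
      then show "T2 (jet_tx w) = T1 (fst (jet_tx w))" "U (jet_txu w) = c / pd_x X (jet_tx w) * jet_u w"
        using T2_eq U[of "jet_txu w"] by (auto simp: jet_txu_def m_def)
    qed
    have "fst (\<Phi> (z, (a, b))) = prolong2 (\<lambda>w. T2 (jet_tx w)) (\<lambda>w. X (jet_tx w)) (\<lambda>w. U (jet_txu w)) z"
      using fst_\<Phi>[OF p] by simp
    also have "\<dots> = prolong2 (\<lambda>w. T1 (fst (jet_tx w))) (\<lambda>w. X (jet_tx w)) (\<lambda>w. c / pd_x X (jet_tx w) * jet_u w) z"
      by (rule prolong2_cong[OF opens(3) z e(1) refl e(2)])
    finally show ?thesis .
  qed
  have "FP_form c T1 X \<Phi> (Z \<times> M)"
    unfolding FP_form_iff
  proof (intro conjI ballI)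
    show "smooth_on T1 ((\<lambda>(z, \<theta>). fst (jet_tx z)) ` (Z \<times> M))"
      by (rule smooth_on_subset[OF smooth_T1]) (auto simp: jet_tx_def)
    show "smooth_on X ((\<lambda>(z, \<theta>). jet_tx z) ` (Z \<times> M))"
      by (rule smooth_on_subset[OF sm_X]) (auto simp: jet_tx_def)
    fix p assume p: "p \<in> Z \<times> M"
    obtain z a b where pe: "p = (z, (a, b))" by (metis surj_pair)
    have zP: "jet_tx z \<in> P" using p by (auto simp: pe jet_tx_def)
    have "\<Phi> p = (fst (\<Phi> p), snd (\<Phi> p))" by simp
    then show "FP_form_at c T1 X \<Phi> p"
      using tr.nz[OF zP] unfolding pe \<psi>[OF p[unfolded pe]] \<Theta>[OF p[unfolded pe]] \<theta>_def FP_form_at_def Let_def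
      by (simp add: m_def n_def divide_inverse algebra_simps)
  qed
  then show thesis using that c by blast
qed

end

lemma (in FP_equiv) local_FP_form:
  assumes "p \<in> W"
  shows "\<exists>N c T X. open N \<and> p \<in> N \<and> N \<subseteq> W \<and> c \<noteq> 0 \<and> FP_form c T X \<Phi> N"
proof -
  obtain I J K R M T2 X U where b: "FP_box \<Phi> W I J K R M T2 X U" "p \<in> ((I \<times> J) \<times> (K \<times> R)) \<times> M"
    by (rule local_box[OF assms])
  interpret FP_box \<Phi> W I J K R M T2 X U by (rule b(1))
  obtain c where "c \<noteq> 0" "FP_form c T1 X \<Phi> (((I \<times> J) \<times> (K \<times> R)) \<times> M)"
    by (rule FP_form_box)
  moreover have "open (((I \<times> J) \<times> (K \<times> R)) \<times> M)" using opens open_box by (intro open_Times)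
  ultimately show ?thesis using b(2) box_W by blast
qed

section \<open>From local to global\<close>

lemma FP_form_values:
  assumes "FP_form c T X \<Phi> N" "p \<in> N"
  shows "jet_tx (fst (\<Phi> p)) = (T (fst (jet_tx (fst p))), X (jet_tx (fst p)))"
    and "jet_u (fst (\<Phi> p)) = c / pd_x X (jet_tx (fst p)) * jet_u (fst p)"
    and "pd_x X (jet_tx (fst p)) \<noteq> 0"
  using assms by (auto simp: FP_form_iff FP_form_at_def Let_def prolong2_def jet_tx_def jet_u_def)

lemma FP_form_subset: "FP_form c T X \<Phi> N \<Longrightarrow> M \<subseteq> N \<Longrightarrow> FP_form c T X \<Phi> M"
  unfolding FP_form_iff by (blast intro: smooth_on_subset[OF _ image_mono])

text \<open>\<open>\<Phi>\<close> determines \<open>X\<close> on the open projection of the overlap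
  and hence \<open>X_x\<close>; at a jet with \<open>u \<noteq> 0\<close> the ratio of the new and
  the old \<open>u\<close> then fixes the constant. The overlap is open, so it contains such a
  jet.\<close>

lemma FP_form_unique_const:
  assumes f: "FP_form c T X \<Phi> N" "FP_form c' T' X' \<Phi> N'" and N: "open N" "open N'" and p: "p \<in> N" "p \<in> N'"
  shows "c = c'"
proof -
  let ?M = "N \<inter> N'"
  have g: "FP_form c T X \<Phi> ?M" "FP_form c' T' X' \<Phi> ?M" using f FP_form_subset by blast+
  have M: "open ?M" using N by blast
  obtain s where s: "p + s *\<^sub>R ((0, 1, 0), 0) \<in> ?M" "jet_u (fst (p + s *\<^sub>R ((0, 1, 0), 0))) \<noteq> 0"
  proof (cases "jet_u (fst p) = 0")
    case True
    have "p \<in> ?M" using p by blast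
    obtain s where "s \<noteq> 0" "p + s *\<^sub>R ((0, 1, 0), 0) \<in> ?M"
      by (rule exists_nonzero_shift[OF M \<open>p \<in> ?M\<close>])
    then show thesis using True that by (simp add: jet_u_def)
  next
    case False
    show thesis by (rule that[of 0]) (use False p in \<open>simp_all del: scaleR_Pair\<close>)
  qed
  define q where "q = p + s *\<^sub>R ((0, 1, 0), 0)"
  have q: "q \<in> ?M" "jet_u (fst q) \<noteq> 0" using s by (simp_all add: q_def)
  let ?D = "(\<lambda>(z, \<theta>). jet_tx z) ` ?M"
  have XX: "X y = X' y" if "y \<in> ?D" for y
    using that FP_form_values(1)[OF g(1)] FP_form_values(1)[OF g(2)] by fastforce
  have "jet_tx (fst q) \<in> ?D" using q(1) by (auto simp: image_iff case_prod_unfold)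
  then have "pd_x X (jet_tx (fst q)) = pd_x X' (jet_tx (fst q))"
    using pd_cong(2)[OF FP_form_projections(1)[OF g(1) M] _ XX FP_form_projections(4)[OF g(1) M]] by blast
  then show "c = c'"
    using FP_form_values[OF g(1) q(1)] FP_form_values[OF g(2) q(1)] q(2) by simp
qed

text \<open>The projections of \<open>N\<close> are open, so equality of the functions on them
  passes to all derivatives occurring in \<open>FP_form\<close>.\<close>

lemma FP_form_cong:
  assumes f: "FP_form c T' X' \<Phi> N" and N: "open N"
    and T: "\<And>p. p \<in> N \<Longrightarrow> T (fst (jet_tx (fst p))) = T' (fst (jet_tx (fst p)))"
    and X: "\<And>p. p \<in> N \<Longrightarrow> X (jet_tx (fst p)) = X' (jet_tx (fst p))"
  shows "FP_form c T X \<Phi> N"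
proof -
  let ?D = "(\<lambda>(z, \<theta>). jet_tx z) ` N" and ?I = "(\<lambda>(z, \<theta>). fst (jet_tx z)) ` N"
  note pr = FP_form_projections[OF f N]
  have TI: "T' s = T s" if "s \<in> ?I" for s using that T by fastforce
  have XD: "X' q = X q" if "q \<in> ?D" for q using that X by fastforce
  have DI: "fst q \<in> ?I" if "q \<in> ?D" for q using that by (force simp: image_iff)
  have dT: "deriv T' s = deriv T s" if "s \<in> ?I" for s
    using has_field_derivative_transform_within_open[OF smooth_on_deriv(2)[OF pr(3,2) that] pr(2) that TI]
    by (metis DERIV_imp_deriv)
  have dX: "pd_t X' q = pd_t X q" "pd_x X' q = pd_x X q" if "q \<in> ?D" for q
    using pd_cong[OF pr(1) that XD pr(4)] by auto
  have dXX: "pd_x (pd_x X') q = pd_x (pd_x X) q" if "q \<in> ?D" for q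
    using pd_cong(2)[OF pr(1) that dX(2) smooth_on_pd(2)[OF pr(4,1)]] .
  show ?thesis unfolding FP_form_iff
  proof (intro conjI ballI)
    show "smooth_on T ?I" by (rule smooth_on_cong[OF pr(3,2) TI])
    show "smooth_on X ?D" by (rule smooth_on_cong[OF pr(4,1) XD])
    fix p assume p: "p \<in> N"
    have z: "jet_tx (fst p) \<in> ?D" using p by (auto simp: image_iff case_prod_unfold)
    have prol: "prolong2 (\<lambda>w. T' (fst (jet_tx w))) (\<lambda>w. X' (jet_tx w)) (\<lambda>w. c / pd_x X' (jet_tx w) * jet_u w) (fst p) =
        prolong2 (\<lambda>w. T (fst (jet_tx w))) (\<lambda>w. X (jet_tx w)) (\<lambda>w. c / pd_x X (jet_tx w) * jet_u w) (fst p)"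
      by (rule prolong2_cong[OF open_jet_tx_vimage[OF pr(1)]]) (use z TI XD DI dX(2) in simp_all)
    have "FP_form_at c T' X' \<Phi> p" using f p by (simp add: FP_form_iff)
    then show "FP_form_at c T X \<Phi> p"
      unfolding FP_form_at_def Let_def prol dT[OF DI[OF z]] dX[OF z] dXX[OF z] .
  qed
qed

lemma FP_form_glue:
  assumes "\<And>p. p \<in> W \<Longrightarrow> \<exists>N. open N \<and> p \<in> N \<and> N \<subseteq> W \<and> FP_form c T X \<Phi> N"
  shows "FP_form c T X \<Phi> W"
  unfolding FP_form_iff
proof (intro conjI ballI)
  show "smooth_on T ((\<lambda>(z, \<theta>). fst (jet_tx z)) ` W)"
  proof (rule smooth_on_local)
    fix s assume "s \<in> (\<lambda>(z, \<theta>). fst (jet_tx z)) ` W"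
    then obtain p where p: "p \<in> W" "s = fst (jet_tx (fst p))" by auto
    from assms[OF p(1)] obtain N where N: "open N" "p \<in> N" "N \<subseteq> W" "FP_form c T X \<Phi> N" by blast
    then show "\<exists>N. open N \<and> s \<in> N \<and> smooth_on T N"
      using FP_form_projections(2,3)[OF N(4,1)] p(2)
      by (intro exI[of _ "(\<lambda>(z, \<theta>). fst (jet_tx z)) ` N"]) (auto simp: image_iff case_prod_unfold)
  qed
  show "smooth_on X ((\<lambda>(z, \<theta>). jet_tx z) ` W)"
  proof (rule smooth_on_local)
    fix s assume "s \<in> (\<lambda>(z, \<theta>). jet_tx z) ` W"
    then obtain p where p: "p \<in> W" "s = jet_tx (fst p)" by auto
    from assms[OF p(1)] obtain N where N: "open N" "p \<in> N" "N \<subseteq> W" "FP_form c T X \<Phi> N" by blast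
    then show "\<exists>N. open N \<and> s \<in> N \<and> smooth_on X N"
      using FP_form_projections(1,4)[OF N(4,1)] p(2)
      by (intro exI[of _ "(\<lambda>(z, \<theta>). jet_tx z) ` N"]) (auto simp: image_iff case_prod_unfold)
  qed
  show "FP_form_at c T X \<Phi> p" if "p \<in> W" for p
    using assms[OF that] by (auto simp: FP_form_iff)
qed

text \<open>Two points of a convex set in one fibre of a linear map are joined by a segment inside
  that fibre, and \<open>F\<close> is locally constant along it. This makes \<open>T\<close> and
  \<open>X\<close> single valued on a convex domain.\<close>

lemma constant_on_convex_fibres:
  fixes \<pi> :: "'a::real_normed_vector \<Rightarrow> 'b::real_vector"
  assumes W: "convex W" and \<pi>: "linear \<pi>"
    and loc: "\<And>p. p \<in> W \<Longrightarrow> \<exists>N f. open N \<and> p \<in> N \<and> (\<forall>q\<in>N. F q = f (\<pi> q))"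
    and pq: "p \<in> W" "q \<in> W" "\<pi> p = \<pi> q"
  shows "F p = F q"
proof (rule connected_local_const[of "closed_segment p q"])
  show "connected (closed_segment p q)" by (rule connected_segment)
  have eq: "\<pi> r = \<pi> p" if r: "r \<in> closed_segment p q" for r
  proof -
    obtain s where "r = (1 - s) *\<^sub>R p + s *\<^sub>R q" using r unfolding in_segment by blast
    then have "\<pi> r = (1 - s) *\<^sub>R \<pi> p + s *\<^sub>R \<pi> q" by (simp add: linear_add[OF \<pi>] linear_cmul[OF \<pi>])
    also have "\<dots> = \<pi> p" unfolding pq(3) scaleR_left_distrib[symmetric] by simp
    finally show ?thesis .
  qed
  have sub: "closed_segment p q \<subseteq> W" using closed_segment_subset[OF pq(1,2) W] .
  show "\<forall>a\<in>closed_segment p q. \<forall>\<^sub>F b in at a within closed_segment p q. F a = F b"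
  proof
    fix a assume a: "a \<in> closed_segment p q"
    have "a \<in> W" using a sub by blast
    from loc[OF this] obtain N f where N: "open N" "a \<in> N" "\<forall>q\<in>N. F q = f (\<pi> q)"
      by (elim exE conjE)
    have "F a = F b" if b: "b \<in> N" "b \<in> closed_segment p q" for b
      using bspec[OF N(3,2)] bspec[OF N(3) b(1)] unfolding eq[OF a] eq[OF b(2)] by simp
    then show "\<forall>\<^sub>F b in at a within closed_segment p q. F a = F b"
      unfolding eventually_at_topological using N by blast
  qed
qed auto

text \<open>Uniqueness makes the constant locally constant, hence global on a connected
  \<open>W\<close>. The functions \<open>T\<close> and \<open>X\<close> are given only locally
  there, since the parts of \<open>W\<close> above one \<open>t\<close> or one \<open>(t, x)\<close>
  may be disconnected; for convex \<open>W\<close> they can be glued.\<close>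

theorem corollary31:
  fixes \<Phi> :: "ext \<Rightarrow> ext" and W :: "ext set"
  assumes "open W" and "connected W" and "W \<subseteq> ext_space"
  shows "(\<Phi> \<in> FP_equivalence_group W \<longleftrightarrow>
            (\<exists>c\<^sub>1. c\<^sub>1 \<noteq> 0 \<and>
               (\<forall>p\<in>W. \<exists>N. open N \<and> p \<in> N \<and> N \<subseteq> W \<and> (\<exists>T X. FP_form c\<^sub>1 T X \<Phi> N)))) \<and>
         (convex W \<longrightarrow>
            (\<Phi> \<in> FP_equivalence_group W \<longleftrightarrow>
               (\<exists>c\<^sub>1 T X. c\<^sub>1 \<noteq> 0 \<and> FP_form c\<^sub>1 T X \<Phi> W)))"
proof -
  have local: "\<exists>c. c \<noteq> 0 \<and> (\<forall>p\<in>W. \<exists>N. open N \<and> p \<in> N \<and> N \<subseteq> W \<and> (\<exists>T X. FP_form c T X \<Phi> N))"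
    if "\<Phi> \<in> FP_equivalence_group W"
  proof (cases "W = {}")
    case True
    then show ?thesis by (intro exI[of _ 1]) auto
  next
    case False
    then obtain p0 where p0: "p0 \<in> W" by blast
    interpret FP_equiv \<Phi> W by unfold_locales (use assms that in auto)
    have ex: "\<forall>p\<in>W. \<exists>c. \<exists>N. open N \<and> p \<in> N \<and> N \<subseteq> W \<and> c \<noteq> 0 \<and> (\<exists>T X. FP_form c T X \<Phi> N)"
    proof
      fix p assume "p \<in> W"
      from local_FP_form[OF this] show "\<exists>c. \<exists>N. open N \<and> p \<in> N \<and> N \<subseteq> W \<and> c \<noteq> 0 \<and> (\<exists>T X. FP_form c T X \<Phi> N)"
        by (elim exE conjE) (intro exI conjI)
    qed
    obtain C where "\<forall>p\<in>W. \<exists>N. open N \<and> p \<in> N \<and> N \<subseteq> W \<and> C p \<noteq> 0 \<and> (\<exists>T X. FP_form (C p) T X \<Phi> N)"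
      by (rule exE[OF bchoice[OF ex]])
    then have C: "\<exists>N. open N \<and> p \<in> N \<and> N \<subseteq> W \<and> C p \<noteq> 0 \<and> (\<exists>T X. FP_form (C p) T X \<Phi> N)" if "p \<in> W" for p
      using that by blast
    \<comment> \<open>For \<open>b\<close> in the neighbourhood belonging to \<open>a\<close>, the
      neighbourhood chosen for \<open>b\<close> overlaps it at \<open>b\<close>, and uniqueness on
      the overlap gives \<open>C a = C b\<close>.\<close>
    have const: "C p = C p0" if "p \<in> W" for p
    proof (rule connected_local_const[OF assms(2) that p0])
      show "\<forall>a\<in>W. \<forall>\<^sub>F b in at a within W. C a = C b"
      proof
        fix a assume "a \<in> W"
        then obtain N T X where N: "open N" "a \<in> N" "FP_form (C a) T X \<Phi> N" using C by blast
        have "C a = C b" if b: "b \<in> N" "b \<in> W" for b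
        proof -
          obtain N' T' X' where "open N'" "b \<in> N'" "FP_form (C b) T' X' \<Phi> N'" using C[OF b(2)] by blast
          then show ?thesis using FP_form_unique_const[OF N(3) _ N(1) _ b(1)] by blast
        qed
        then show "\<forall>\<^sub>F b in at a within W. C a = C b"
          unfolding eventually_at_topological using N by blast
      qed
    qed
    have "C p0 \<noteq> 0" using C[OF p0] by blast
    moreover have "\<forall>p\<in>W. \<exists>N. open N \<and> p \<in> N \<and> N \<subseteq> W \<and> (\<exists>T X. FP_form (C p0) T X \<Phi> N)"
      using C const by metis
    ultimately show ?thesis by blast
  qed
  have conv: "\<exists>c T X. c \<noteq> 0 \<and> FP_form c T X \<Phi> W" if W: "convex W" and grp: "\<Phi> \<in> FP_equivalence_group W"
  proof -
    obtain c where c: "c \<noteq> 0"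
      and form: "\<And>p. p \<in> W \<Longrightarrow> \<exists>N. open N \<and> p \<in> N \<and> N \<subseteq> W \<and> (\<exists>T X. FP_form c T X \<Phi> N)"
      using local[OF grp] by blast
    \<comment> \<open>Any point of \<open>W\<close> above \<open>s\<close> may be chosen; convexity
      makes the value independent of the choice. The value is arbitrary if no point lies above
      \<open>s\<close>.\<close>
    define T where "T s = fst (jet_tx (fst (\<Phi> (SOME p. p \<in> W \<and> fst (jet_tx (fst p)) = s))))" for s
    define X where "X q = snd (jet_tx (fst (\<Phi> (SOME p. p \<in> W \<and> jet_tx (fst p) = q))))" for q
    have lin: "linear (\<lambda>p::ext. fst (jet_tx (fst p)))" "linear (\<lambda>p::ext. jet_tx (fst p))"
      by (auto simp: jet_tx_def linear_iff)
    have T: "T (fst (jet_tx (fst p))) = fst (jet_tx (fst (\<Phi> p)))" if p: "p \<in> W" for p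
    proof -
      let ?q = "SOME q. q \<in> W \<and> fst (jet_tx (fst q)) = fst (jet_tx (fst p))"
      have q: "?q \<in> W \<and> fst (jet_tx (fst ?q)) = fst (jet_tx (fst p))"
        by (rule someI[of _ p]) (use p in simp)
      show ?thesis unfolding T_def
      proof (rule constant_on_convex_fibres[OF W lin(1), of "\<lambda>p. fst (jet_tx (fst (\<Phi> p)))"])
        show "\<exists>N f. open N \<and> p \<in> N \<and> (\<forall>q\<in>N. fst (jet_tx (fst (\<Phi> q))) = f (fst (jet_tx (fst q))))" if "p \<in> W" for p
          using form[OF that] FP_form_values(1) by (metis fst_conv)
      qed (use p q in auto)
    qed
    have X: "X (jet_tx (fst p)) = snd (jet_tx (fst (\<Phi> p)))" if p: "p \<in> W" for p
    proof -
      let ?q = "SOME q. q \<in> W \<and> jet_tx (fst q) = jet_tx (fst p)"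
      have q: "?q \<in> W \<and> jet_tx (fst ?q) = jet_tx (fst p)"
        by (rule someI[of _ p]) (use p in simp)
      show ?thesis unfolding X_def
      proof (rule constant_on_convex_fibres[OF W lin(2), of "\<lambda>p. snd (jet_tx (fst (\<Phi> p)))"])
        show "\<exists>N f. open N \<and> p \<in> N \<and> (\<forall>q\<in>N. snd (jet_tx (fst (\<Phi> q))) = f (jet_tx (fst q)))" if "p \<in> W" for p
          using form[OF that] FP_form_values(1) by (metis snd_conv)
      qed (use p q in auto)
    qed
    have "FP_form c T X \<Phi> W"
    proof (rule FP_form_glue)
      fix p assume "p \<in> W"
      from form[OF this] obtain N T' X' where N: "open N" "p \<in> N" "N \<subseteq> W" "FP_form c T' X' \<Phi> N" by blast
      have "FP_form c T X \<Phi> N"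
      proof (rule FP_form_cong[OF N(4,1)])
        fix q assume "q \<in> N"
        then have "q \<in> W" using N by blast
        then show "T (fst (jet_tx (fst q))) = T' (fst (jet_tx (fst q)))" "X (jet_tx (fst q)) = X' (jet_tx (fst q))"
          using T X FP_form_values(1)[OF N(4) \<open>q \<in> N\<close>] by simp_all
      qed
      then show "\<exists>N. open N \<and> p \<in> N \<and> N \<subseteq> W \<and> FP_form c T X \<Phi> N" using N by blast
    qed
    then show ?thesis using c by blast
  qed
  show ?thesis
  proof (intro conjI impI iffI)
    assume "\<Phi> \<in> FP_equivalence_group W"
    then show "\<exists>c\<^sub>1. c\<^sub>1 \<noteq> 0 \<and> (\<forall>p\<in>W. \<exists>N. open N \<and> p \<in> N \<and> N \<subseteq> W \<and> (\<exists>T X. FP_form c\<^sub>1 T X \<Phi> N))"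
      by (rule local)
  next
    assume "\<exists>c\<^sub>1. c\<^sub>1 \<noteq> 0 \<and> (\<forall>p\<in>W. \<exists>N. open N \<and> p \<in> N \<and> N \<subseteq> W \<and> (\<exists>T X. FP_form c\<^sub>1 T X \<Phi> N))"
    then show "\<Phi> \<in> FP_equivalence_group W" using FP_form_imp_equivalence_group[OF assms(1)] by blast
  next
    assume "convex W" "\<Phi> \<in> FP_equivalence_group W"
    then show "\<exists>c\<^sub>1 T X. c\<^sub>1 \<noteq> 0 \<and> FP_form c\<^sub>1 T X \<Phi> W" by (rule conv)
  next
    assume "\<exists>c\<^sub>1 T X. c\<^sub>1 \<noteq> 0 \<and> FP_form c\<^sub>1 T X \<Phi> W"
    then obtain c T X where "c \<noteq> 0" "FP_form c T X \<Phi> W" by blast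
    then show "\<Phi> \<in> FP_equivalence_group W"
      using assms(1) by (intro FP_form_imp_equivalence_group[of W c]) blast+
  qed
qed

end
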